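(* There exist absolute constants $b,\varepsilon>0$ such that for every positive integer $n$ and every non-identity subgroup $H\le S_n$ with minimal degree $m=m(H)\ge b$, and every integer $k$ with $1\le k\le n$, $$|H_k|\le n^{-\varepsilon m}\binom{n}{k}^{1/2}(k!)^{1/4}.$$
   Context: For $h\in S_n$, $\mathrm{supp}(h)=\{i\in\{1,\dots,n\} : h(i)\ne i\}$. The minimal degree of $1\neq H\le S_n$ is $m(H)=\min\{|\mathrm{supp}(h)| : 1\ne h\in H\}$. For an integer $k$, $H_k=\{h\in H : |\mathrm{supp}(h)|=k\}$. *)

theory Defs
  imports Complex_Main "HOL-Algebra.Sym_Groups"
begin

definition supp :: "nat \<Rightarrow> (nat \<Rightarrow> nat) \<Rightarrow> nat set"
  where "supp n h = {i \<in> {1..n}. h i \<noteq> i}"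

text \<open>Only meaningful when \<open>H\<close> contains a non-identity element; the set of support sizes is
  always finite, since each of them is at most \<open>n\<close>.\<close>

definition min_degree :: "nat \<Rightarrow> (nat \<Rightarrow> nat) set \<Rightarrow> nat"
  where "min_degree n H = Min {card (supp n h) | h. h \<in> H \<and> h \<noteq> \<one>\<^bsub>sym_group n\<^esub>}"

definition elems_of_degree :: "nat \<Rightarrow> (nat \<Rightarrow> nat) set \<Rightarrow> nat \<Rightarrow> (nat \<Rightarrow> nat) set"
  where "elems_of_degree n H k = {h \<in> H. card (supp n h) = k}"

end

(* Large k (k at least a small power of n): weigh each point by the number of elements of H_k that move
it. If the minimal degree is large, some pointwise stabiliser H_X with X of small weight has only short
orbits: fix points greedily as long as this pays off in the entropy of the orbit lengths. If a long orbit
survived, H would induce the full symmetric group on a large set (a Jordan-type argument), hence contain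
elements with cycles of many different prime lengths; powers of these isolate single cycles, and commutators
of such powers with an element of small support would violate minimality. Half of the elements of H_k meet X
in few points, and such an element is determined, up to few choices, by its action on X and on half of its
support.

Small k: consider the members of H_k that move all of R and agree with a fixed one on P <= R. Among the
pairs (R, P) for which they are at least as many as a product of penalties for the points of R and P
predicts, choose one with card R + card P maximal; then the members are spread out with respect to any
further condition of this kind. Unless card R is close to k, this is
contradictory. If P = R, two random members almost always have supports that meet only in R, or in one or two
further points, and commutators force most pairs to share a transposition, which spreading forbids. If P is a
proper subset, commutators with fresh members make the traces on R of elements of small support closed under
intersection; as nonempty traces have size proportional to the minimal degree, a small set of points meets
them all, and fixing the images of these points pins down the members on R - P. *)

theory Submission
  imports Defs "HOL-Computational_Algebra.Primes" "HOL-Number_Theory.Cong"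
    "HOL-Real_Asymp.Real_Asymp" "HOL-Library.FuncSet"
begin

section \<open>A lower bound for the number of primes\<close>

text \<open>For k well below the square root of n the target is about n^(k/2) (k!)^(-1/4). The
  guiding obstacle is a group generated by disjoint transpositions: it has about n^(k/2) (k!)^(-1/2)
  elements of degree k, up to factors exponential in k, and although its minimal degree excludes it,
  the counting meets the same configuration locally. So the exponent k/2 cannot be gained, and both
  ranges live on the gap (k!)^(1/4). For large k this gap exceeds a power n^(ck) and absorbs all
  errors and the saving. For small k it is too weak for that, so support points are charged one at a
  time: the penalty sqrt(n) l^(-1/4) for the l-th point has product n^(k/2) (k!)^(-1/4) over l = 1,
  ..., k, and the charging stops while at least \<open>m div 20\<close> points are still unpaid.
  These unpaid penalties are the factor n^(-eps m). Any exponent of l strictly between 0 and 1/2 in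
  the penalty would defeat shared transpositions, since l^(1+2e) < l^2 for e < 1/2; the statement
  asks for e = 1/4.\<close>

lemma Lcm_interval_neq_0: "Lcm {1..n::nat} \<noteq> 0"
proof
  assume "Lcm {1..n} = 0"
  moreover have "Lcm {1..n} dvd \<Prod>{1..n}" by (rule Lcm_least) (auto intro: dvd_prodI)
  ultimately show False by simp
qed

text \<open>Leibniz's harmonic triangle: 1/((n+1) C(n,k+1)) = 1/(n C(n-1,k)) - 1/((n+1) C(n,k)).
  Multiplied by the least common multiple, both terms on the right are integers by induction, hence
  so is the left side.\<close>

lemma leibniz_dvd_Lcm:
  assumes "k \<le> n" shows "Suc n * (n choose k) dvd Lcm {1..Suc n}"
  using assms
proof (induction k arbitrary: n)
  case 0
  then show ?case by (auto intro!: dvd_Lcm)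
next
  case (Suc k)
  define L where "L = Lcm {1..Suc n}"
  obtain n' where n: "n = Suc n'" using Suc.prems by (cases n) auto
  have "Suc n * (n choose k) dvd L" unfolding L_def using Suc by simp
  then obtain A where A: "L = Suc n * (n choose k) * A" by (auto simp: dvd_def)
  have "Suc n' * (n' choose k) dvd Lcm {1..Suc n'}" using Suc n by simp
  also have "Lcm {1..Suc n'} dvd L"
    unfolding L_def n by (rule Lcm_subset) auto
  finally obtain B where B: "L = Suc n' * (n' choose k) * B" by (auto simp: dvd_def)
  let ?r = "real"
  have kn: "k < n" using Suc.prems by simp
  have pos: "?r (n choose k) > 0" "?r (n choose Suc k) > 0" "?r (n' choose k) > 0"
    using kn n Suc.prems by (auto simp only: of_nat_0_less_iff zero_less_binomial_iff)
  have e1: "?r (Suc k) * ?r (n choose Suc k) = ?r (n - k) * ?r (n choose k)"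
    using binomial_absorb_comp[of n k] Suc_times_binomial_eq[of "n'" k] n
    by (metis binomial_absorption mult.commute of_nat_mult binomial_absorb_comp diff_Suc_1)
  have e2: "?r (n - k) * ?r (n choose k) = ?r n * ?r (n' choose k)"
    using binomial_absorb_comp[of n k] n by (metis diff_Suc_1 of_nat_mult)
  have Br: "?r L / (?r n * ?r (n' choose k)) = ?r B"
  proof -
    have "?r L = (?r n * ?r (n' choose k)) * ?r B" unfolding B n by (simp only: of_nat_mult)
    moreover have "?r n * ?r (n' choose k) \<noteq> 0" using pos(3) kn by simp
    ultimately show ?thesis by (simp only: nonzero_mult_div_cancel_left not_False_eq_True)
  qed
  have Ar: "?r L / (?r (Suc n) * ?r (n choose k)) = ?r A"
  proof -
    have "?r L = (?r (Suc n) * ?r (n choose k)) * ?r A" unfolding A by (simp only: of_nat_mult)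
    moreover have "?r (Suc n) * ?r (n choose k) \<noteq> 0" using pos(1) by simp
    ultimately show ?thesis by (simp only: nonzero_mult_div_cancel_left not_False_eq_True)
  qed
  have nk: "?r (n - k) = ?r n - ?r k" using kn by simp
  define c where "c = ?r (n choose k)"
  define x where "x = ?r n - ?r k"
  have x: "x > 0" "c > 0" using kn pos by (auto simp: x_def c_def)
  have c1: "?r (n choose Suc k) = x * c / ?r (Suc k)"
    using e1 nk by (simp add: x_def c_def field_simps)
  have c2: "?r n * ?r (n' choose k) = x * c" using e2 nk by (simp add: x_def c_def)
  have "?r L / (?r (Suc n) * ?r (n choose Suc k)) = ?r B - ?r A"
  proof -
    have "?r B - ?r A = ?r L / (x * c) - ?r L / (?r (Suc n) * c)"
      using Ar Br c2 by (simp add: c_def)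
    also have "\<dots> = ?r L * (?r (Suc n) - x) / (?r (Suc n) * x * c)"
    proof -
      have "L' / (x * c) - L' / (N * c) = L' * (N - x) / (N * x * c)" if "N > 0" for N L' :: real
        using x that by (simp add: field_simps)
      then show ?thesis by simp
    qed
    also have "?r (Suc n) - x = ?r (Suc k)" using kn by (simp add: x_def)
    also have "?r L * ?r (Suc k) / (?r (Suc n) * x * c) = ?r L / (?r (Suc n) * ?r (n choose Suc k))"
      unfolding c1 by simp
    finally show ?thesis by simp
  qed
  moreover have "?r L / (?r (Suc n) * ?r (n choose Suc k)) \<ge> 0" by simp
  ultimately have "?r L / (?r (Suc n) * ?r (n choose Suc k)) = ?r (B - A)" by simp
  moreover have "?r (Suc n) * ?r (n choose Suc k) \<noteq> 0" using pos(2) by simp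
  ultimately have "?r L = ?r (B - A) * (?r (Suc n) * ?r (n choose Suc k))"
    using nonzero_divide_eq_eq by blast
  then have "?r L = ?r (Suc n * (n choose Suc k) * (B - A))"
    by (simp only: of_nat_mult ac_simps)
  then have "L = Suc n * (n choose Suc k) * (B - A)" by (simp only: of_nat_eq_iff)
  then show ?case unfolding L_def by (metis dvd_triv_left)
qed

text \<open>Every prime power in the factorisation of the lcm already divides a single number of the
  interval, hence is at most \<open>n\<close>, and only primes up to \<open>n\<close> occur.\<close>

lemma Lcm_atLeastAtMost_le_power:
  fixes n :: nat
  assumes "n \<ge> 1"
  shows "Lcm {1..n} \<le> n ^ card {p. prime p \<and> p \<le> n}"
proof -
  let ?L = "Lcm {1..n}"
  have L0: "?L \<noteq> 0" by (rule Lcm_interval_neq_0)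
  have fin: "finite {p. prime p \<and> p \<le> n}" by simp
  have sub: "prime_factors ?L \<subseteq> {p. prime p \<and> p \<le> n}"
  proof
    fix p assume "p \<in> prime_factors ?L"
    then have p: "prime p" "p dvd ?L" by auto
    have "?L dvd \<Prod>{1..n}" by (rule Lcm_least) (auto intro: dvd_prodI)
    with p have "p dvd \<Prod>{1..n}" using dvd_trans by blast
    then obtain i where "i \<in> {1..n}" "p dvd i" using prime_dvd_prod_iff[of "{1..n}" p] p by auto
    then show "p \<in> {p. prime p \<and> p \<le> n}" using p by (auto dest: dvd_imp_le)
  qed
  have le: "p ^ multiplicity p ?L \<le> n" if p: "prime p" for p
  proof -
    define M where "M = Max (multiplicity p ` {1..n})"
    have M: "multiplicity p i \<le> M" if "i \<in> {1..n}" for i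
      unfolding M_def using that by (intro Max_ge) auto
    obtain L' where L': "?L = p ^ multiplicity p ?L * L'" "\<not> p dvd L'"
      using multiplicity_decompose'[of ?L p] p L0 not_prime_unit by metis
    have "i dvd p ^ M * L'" if i: "i \<in> {1..n}" for i
    proof -
      have "i \<noteq> 0" using i by simp
      then obtain j where j: "i = p ^ multiplicity p i * j" "\<not> p dvd j"
        using multiplicity_decompose'[of i p] p not_prime_unit by metis
      have "j dvd i" using j(1) dvd_triv_right by metis
      moreover have "i dvd ?L" using i by (rule dvd_Lcm)
      ultimately have "j dvd p ^ multiplicity p ?L * L'" using L'(1) dvd_trans by metis
      moreover have "coprime j (p ^ multiplicity p ?L)"
        using prime_imp_coprime[OF p j(2)] by (simp add: ac_simps)
      ultimately have "j dvd L'" using coprime_dvd_mult_right_iff by blast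
      moreover have "p ^ multiplicity p i dvd p ^ M" using M[OF i] by (rule le_imp_power_dvd)
      ultimately show ?thesis using j(1) mult_dvd_mono by metis
    qed
    then have "?L dvd p ^ M * L'" by (rule Lcm_least)
    then have "p ^ multiplicity p ?L * L' dvd p ^ M * L'" using L'(1) by metis
    moreover have "L' \<noteq> 0" using L'(2) by (metis dvd_0_right)
    ultimately have "p ^ multiplicity p ?L dvd p ^ M" by simp
    moreover have "M \<in> multiplicity p ` {1..n}"
      unfolding M_def by (rule Max_in) (use assms in auto)
    then obtain i where i: "i \<in> {1..n}" "M = multiplicity p i" by blast
    moreover have "p ^ multiplicity p i dvd i" by (rule multiplicity_dvd)
    ultimately have "p ^ multiplicity p ?L dvd i" using dvd_trans i by metis
    with i show ?thesis by (auto dest!: dvd_imp_le)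
  qed
  have "?L = (\<Prod>p\<in>prime_factors ?L. p ^ multiplicity p ?L)"
    using prime_factorization_nat L0 by blast
  also have "\<dots> \<le> (\<Prod>p\<in>prime_factors ?L. n)"
    by (intro prod_mono) (use le in auto)
  also have "\<dots> = n ^ card (prime_factors ?L)" by simp
  also have "\<dots> \<le> n ^ card {p. prime p \<and> p \<le> n}"
    using assms card_mono[OF fin sub] by (intro power_increasing) auto
  finally show ?thesis .
qed

text \<open>Chebyshev's lower bound: \<open>4 ^ n\<close> is below \<open>2 * n + 1\<close> times
  the central binomial coefficient, which divides the lcm of the first \<open>2 * n + 1\<close>
  numbers. It guarantees enough distinct cycle lengths that are all bounded by a small power of the
  degree.\<close>

lemma prime_count_lower_bound:
  assumes "n \<ge> 1"
  shows "4 ^ n \<le> (2 * n + 1) ^ (card {p. prime p \<and> p \<le> 2 * n + 1})"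
proof -
  have "4 ^ n \<le> 2 * real n * real (2 * n choose n)"
    using central_binomial_lower_bound[of n] assms by (simp add: field_simps)
  also have "\<dots> \<le> real (Suc (2 * n) * (2 * n choose n))" by (simp add: algebra_simps)
  also have "\<dots> \<le> real (Lcm {1..Suc (2 * n)})"
    using dvd_imp_le[OF leibniz_dvd_Lcm[of n "2 * n"]] Lcm_interval_neq_0[of "Suc (2 * n)"]
    by (intro of_nat_mono) linarith
  also have "\<dots> \<le> real ((2 * n + 1) ^ (card {p. prime p \<and> p \<le> 2 * n + 1}))"
    using Lcm_atLeastAtMost_le_power[of "2 * n + 1"] by (simp only: of_nat_le_iff) simp
  finally have "real (4 ^ n) \<le> real ((2 * n + 1) ^ (card {p. prime p \<and> p \<le> 2 * n + 1}))" by simp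
  then show ?thesis by (simp only: of_nat_le_iff)
qed

section \<open>Orbits, pointwise stabilisers and commutators\<close>

definition moved :: "('a \<Rightarrow> 'a) \<Rightarrow> 'a set"
  where "moved h = {x. h x \<noteq> x}"

definition fixer :: "('a \<Rightarrow> 'a) set \<Rightarrow> 'a set \<Rightarrow> ('a \<Rightarrow> 'a) set"
  where "fixer G X = {g \<in> G. \<forall>x\<in>X. g x = x}"

definition orb :: "('a \<Rightarrow> 'a) set \<Rightarrow> 'a \<Rightarrow> 'a set"
  where "orb G y = (\<lambda>g. g y) ` G"

text \<open>Permutations are plain functions closed under composition and inverse, so pointwise
  stabilisers are again instances (\<open>fixer_perm_group\<close>) and every lemma can be reused
  inside a stabiliser.\<close>

locale perm_group =
  fixes \<Omega> :: "'a set" and G :: "('a \<Rightarrow> 'a) set"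
  assumes finite_\<Omega>: "finite \<Omega>"
    and permutes: "g \<in> G \<Longrightarrow> g permutes \<Omega>"
    and id_mem: "id \<in> G"
    and comp_mem: "g \<in> G \<Longrightarrow> h \<in> G \<Longrightarrow> g \<circ> h \<in> G"
    and inv_mem: "g \<in> G \<Longrightarrow> inv' g \<in> G"
begin

lemma finite_G: "finite G"
  using finite_subset[OF _ finite_permutations[OF finite_\<Omega>]] permutes by blast

lemma inv_apply: "g \<in> G \<Longrightarrow> inv' g (g x) = x" "g \<in> G \<Longrightarrow> g (inv' g x) = x"
  using permutes_inverses[OF permutes] by auto

lemma inj_mem: "g \<in> G \<Longrightarrow> g x = g y \<longleftrightarrow> x = y"
  by (metis inv_apply(1))

lemma moved_subset: "g \<in> G \<Longrightarrow> moved g \<subseteq> \<Omega>"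
  using permutes unfolding moved_def permutes_def by blast

lemma finite_moved: "g \<in> G \<Longrightarrow> finite (moved g)"
  using moved_subset finite_\<Omega> finite_subset by blast

lemma fixer_perm_group: "perm_group \<Omega> (fixer G X)"
proof
  fix g assume "g \<in> fixer G X"
  then have g: "g \<in> G" "\<And>x. x \<in> X \<Longrightarrow> g x = x" by (auto simp: fixer_def)
  then have "inv' g x = x" if "x \<in> X" for x using that inv_apply(1) by metis
  with g show "inv' g \<in> fixer G X" by (auto simp: fixer_def inv_mem)
qed (auto simp: fixer_def finite_\<Omega> permutes id_mem comp_mem)

lemma mem_orb_self: "y \<in> orb G y"
  unfolding orb_def using id_mem by (metis id_apply image_eqI)

lemma finite_orb: "finite (orb G y)"
  unfolding orb_def using finite_G by simp

lemma card_orb_pos: "card (orb G y) > 0"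
  using finite_orb mem_orb_self card_gt_0_iff by blast

lemma orb_subset: "y \<in> \<Omega> \<Longrightarrow> orb G y \<subseteq> \<Omega>"
  unfolding orb_def using permutes permutes_in_image by fastforce

lemma orb_eq: "z \<in> orb G y \<Longrightarrow> orb G z = orb G y"
proof -
  have *: "orb G z \<subseteq> orb G y" if "z \<in> orb G y" for y z
  proof
    fix x assume "x \<in> orb G z"
    with that obtain g h where "g \<in> G" "h \<in> G" "x = g (h y)" unfolding orb_def by auto
    then show "x \<in> orb G y" unfolding orb_def by (intro image_eqI[of _ _ "g \<circ> h"]) (auto simp: comp_mem)
  qed
  assume z: "z \<in> orb G y"
  then obtain g where "g \<in> G" "z = g y" unfolding orb_def by auto
  then have "y = inv' g z" by (simp add: inv_apply(1))
  with \<open>g \<in> G\<close> have "y \<in> orb G z" unfolding orb_def using inv_mem by blast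
  with * z show ?thesis by blast
qed

lemma orb_apply: "g \<in> G \<Longrightarrow> orb G (g y) = orb G y"
  by (rule orb_eq) (auto simp: orb_def)

lemma orb_disjoint: "orb G y \<inter> orb G z \<noteq> {} \<Longrightarrow> orb G y = orb G z"
  using orb_eq by blast

lemma orb_fixer_subset: "orb (fixer G X) y \<subseteq> orb G y"
  by (auto simp: orb_def fixer_def)

lemma orb_fixer_mono: "X \<subseteq> Y \<Longrightarrow> orb (fixer G Y) y \<subseteq> orb (fixer G X) y"
  by (auto simp: orb_def fixer_def)

lemma orb_eq_singleton: "(\<And>g. g \<in> G \<Longrightarrow> g y = y) \<Longrightarrow> orb G y = {y}"
  using mem_orb_self[of y] by (auto simp: orb_def)

lemma card_transporter:
  assumes "b \<in> orb G a"
  shows "card {g \<in> G. g a = b} = card (fixer G {a})"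
proof -
  obtain t where t: "t \<in> G" "b = t a" using assms by (auto simp: orb_def)
  have "bij_betw (\<lambda>g. t \<circ> g) (fixer G {a}) {g \<in> G. g a = b}"
  proof (rule bij_betwI[where g = "\<lambda>g. inv' t \<circ> g"])
    show "(\<lambda>g. t \<circ> g) \<in> fixer G {a} \<rightarrow> {g \<in> G. g a = b}"
      using t by (auto simp: fixer_def comp_mem)
    show "(\<lambda>g. inv' t \<circ> g) \<in> {g \<in> G. g a = b} \<rightarrow> fixer G {a}"
      using t inv_apply[OF t(1)] by (auto simp: fixer_def comp_mem inv_mem)
  qed (use inv_apply[OF t(1)] in \<open>auto simp: fun_eq_iff\<close>)
  then show ?thesis by (rule bij_betw_same_card[symmetric])
qed

lemma card_eq_orb_times_fixer: "card G = card (orb G a) * card (fixer G {a})"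
proof -
  have "G = (\<Union>b\<in>orb G a. {g \<in> G. g a = b})" by (auto simp: orb_def)
  then have "card G = card (\<Union>b\<in>orb G a. {g \<in> G. g a = b})" by (rule arg_cong)
  also have "\<dots> = (\<Sum>b\<in>orb G a. card {g \<in> G. g a = b})"
    using finite_orb finite_G by (intro card_UN_disjoint) auto
  also have "\<dots> = card (orb G a) * card (fixer G {a})"
    using card_transporter by simp
  finally show ?thesis .
qed

lemma fixer_fixer: "fixer (fixer G X) Y = fixer G (X \<union> Y)"
  by (auto simp: fixer_def)

lemma card_fixer_pos: "card (fixer G X) > 0"
proof -
  interpret F: perm_group \<Omega> "fixer G X" by (rule fixer_perm_group)
  show ?thesis using F.finite_G F.id_mem card_gt_0_iff by blast
qed

lemma card_G_two:
  "card G = card (orb G a) * card (orb (fixer G {a}) b) * card (fixer G {a, b})"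
proof -
  interpret F: perm_group \<Omega> "fixer G {a}" by (rule fixer_perm_group)
  have "fixer (fixer G {a}) {b} = fixer G {a, b}"
    by (auto simp: fixer_def)
  then have "card (fixer G {a}) = card (orb (fixer G {a}) b) * card (fixer G {a, b})"
    using F.card_eq_orb_times_fixer[of b] by (simp only:)
  then show ?thesis
    using card_eq_orb_times_fixer[of a] by (simp only: mult.assoc)
qed

text \<open>Both sides are the index of the pointwise stabiliser of \<open>a\<close> and
  \<open>b\<close>. This gives the symmetry of dependence and the exchange property of independent
  sets.\<close>

lemma card_orb_exchange:
  "card (orb G a) * card (orb (fixer G {a}) b) = card (orb G b) * card (orb (fixer G {b}) a)"
proof -
  have "card (orb G a) * card (orb (fixer G {a}) b) * card (fixer G {a, b})
      = card (orb G b) * card (orb (fixer G {b}) a) * card (fixer G {a, b})"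
    using card_G_two[of a b] card_G_two[of b a] unfolding insert_commute[of b a] by (rule trans[OF sym])
  moreover have "card (fixer G {a, b}) \<noteq> 0" using card_fixer_pos[of "{a,b}"] by (simp only: neq0_conv)
  ultimately show ?thesis by (metis nonzero_mult_div_cancel_right)
qed

lemma card_transporter2_le:
  "card {g \<in> G. g a = x \<and> g y = z} \<le> card (fixer G {a, y})"
proof (cases "{g \<in> G. g a = x \<and> g y = z} = {}")
  case False
  then obtain t where t: "t \<in> G" "t a = x" "t y = z" by auto
  have sub: "(\<lambda>g. inv' t \<circ> g) ` {g \<in> G. g a = x \<and> g y = z} \<subseteq> fixer G {a, y}"
    using t inv_apply[OF t(1)] by (auto simp: fixer_def comp_mem inv_mem)
  have inj: "inj_on (\<lambda>g. inv' t \<circ> g) {g \<in> G. g a = x \<and> g y = z}"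
  proof (rule inj_onI, rule ext)
    fix g h w assume "inv' t \<circ> g = inv' t \<circ> h"
    then have "t (inv' t (g w)) = t (inv' t (h w))" by (simp add: fun_eq_iff)
    then show "g w = h w" using inv_apply[OF t(1)] by simp
  qed
  have "finite (fixer G {a, y})"
    using finite_G by (simp add: fixer_def)
  then show ?thesis by (rule card_inj_on_le[OF inj sub])
next
  case True then show ?thesis by (simp only: card.empty)
qed

lemma orb_fixer_apply:
  assumes "g \<in> G"
  shows "orb (fixer G (g ` Y)) (g y) = g ` orb (fixer G Y) y"
proof -
  have *: "g ` orb (fixer G Y) y \<subseteq> orb (fixer G (g ` Y)) (g y)" if g: "g \<in> G" for g Y y
  proof
    fix z assume "z \<in> g ` orb (fixer G Y) y"
    then obtain h where h: "h \<in> fixer G Y" "z = g (h y)" by (auto simp: orb_def)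
    then have "g \<circ> h \<circ> inv' g \<in> fixer G (g ` Y)"
      using g inv_apply[OF g] by (auto simp: fixer_def comp_mem inv_mem)
    then have "(g \<circ> h \<circ> inv' g) (g y) \<in> orb (fixer G (g ` Y)) (g y)" unfolding orb_def by (rule imageI)
    with h inv_apply[OF g] show "z \<in> orb (fixer G (g ` Y)) (g y)" by simp
  qed
  have "orb (fixer G (g ` Y)) (g y) \<subseteq> g ` orb (fixer G Y) y"
  proof
    fix z assume "z \<in> orb (fixer G (g ` Y)) (g y)"
    then obtain k where k: "k \<in> fixer G (g ` Y)" "z = k (g y)" by (auto simp: orb_def)
    then have "inv' g \<circ> k \<circ> g \<in> fixer G Y"
      using assms inv_apply[OF assms] by (auto simp: fixer_def comp_mem inv_mem)
    then have "(inv' g \<circ> k \<circ> g) y \<in> orb (fixer G Y) y" unfolding orb_def by (rule imageI)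
    moreover have "z = g ((inv' g \<circ> k \<circ> g) y)" using k inv_apply[OF assms] by simp
    ultimately show "z \<in> g ` orb (fixer G Y) y" by (rule rev_image_eqI)
  qed
  with *[OF assms] show ?thesis by (rule equalityI[rotated])
qed

lemma card_orb_fixer_apply:
  "g \<in> G \<Longrightarrow> card (orb (fixer G (g ` Y)) (g y)) = card (orb (fixer G Y) y)"
  by (simp add: orb_fixer_apply card_image inj_on_def inj_mem)

lemma funpow_mem: "g \<in> G \<Longrightarrow> g ^^ k \<in> G"
  by (induction k) (auto simp: id_mem comp_mem)

text \<open>Away from the common support the two permutations do not interfere: a point
  \<open>y\<close> moved by the commutator has \<open>y\<close> itself or its preimage under
  \<open>u\<close> or \<open>v\<close> in that support. Hence elements whose supports share few
  points have a commutator of small degree, to be compared with the minimal degree.\<close>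

lemma moved_commutator_subset:
  assumes "u \<in> G" "v \<in> G"
  shows "moved (v \<circ> u \<circ> inv' v \<circ> inv' u) \<subseteq>
    (moved u \<inter> moved v) \<union> u ` (moved u \<inter> moved v) \<union> v ` (moved u \<inter> moved v)"
proof
  let ?I = "moved u \<inter> moved v"
  note iu = inv_apply[OF assms(1)] and iv = inv_apply[OF assms(2)]
  fix y assume "y \<in> moved (v \<circ> u \<circ> inv' v \<circ> inv' u)"
  then have w: "v (u (inv' v (inv' u y))) \<noteq> y" by (simp add: moved_def)
  show "y \<in> ?I \<union> u ` ?I \<union> v ` ?I"
  proof (cases "u y = y")
    case True
    then have iuy: "inv' u y = y" using iu(1)[of y] by simp
    show ?thesis
    proof (cases "inv' v y \<in> ?I")
      case True
      then have "v (inv' v y) \<in> v ` ?I" by blast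
      then show ?thesis using iv by simp
    next
      case False
      have "v y \<noteq> y" using w True iuy iv(1)[of y] by auto
      then have "v (inv' v y) \<noteq> inv' v y" using iv(2) by metis
      then have "u (inv' v y) = inv' v y" using False by (auto simp: moved_def)
      then show ?thesis using w iuy iv by simp
    qed
  next
    case F: False
    show ?thesis
    proof (cases "v y = y")
      case True
      have "u (inv' u y) \<noteq> inv' u y" using F iu(2) by metis
      moreover have "v (inv' u y) \<noteq> inv' u y"
      proof
        assume "v (inv' u y) = inv' u y"
        then have "inv' v (inv' u y) = inv' u y" using iv(1) by metis
        then show False using w True iu by simp
      qed
      ultimately have "inv' u y \<in> ?I" by (auto simp: moved_def)
      then have "u (inv' u y) \<in> u ` ?I" by blast
      then show ?thesis using iu by simp
    next
      case False then show ?thesis using F by (auto simp: moved_def)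
    qed
  qed
qed

lemma card_moved_commutator_le:
  assumes "u \<in> G" "v \<in> G"
  shows "card (moved (v \<circ> u \<circ> inv' v \<circ> inv' u)) \<le> 3 * card (moved u \<inter> moved v)"
proof -
  let ?I = "moved u \<inter> moved v"
  have fin: "finite ?I" using finite_moved assms by blast
  have "card (moved (v \<circ> u \<circ> inv' v \<circ> inv' u)) \<le> card (?I \<union> u ` ?I \<union> v ` ?I)"
    using moved_commutator_subset[OF assms] fin by (intro card_mono) auto
  also have "\<dots> \<le> card ?I + card (u ` ?I) + card (v ` ?I)"
    by (rule order_trans[OF card_Un_le]) (intro add_right_mono card_Un_le)
  also have "\<dots> \<le> 3 * card ?I"
    using card_image_le[OF fin, of u] card_image_le[OF fin, of v] by simp
  finally show ?thesis .
qed

section \<open>Independent sets and induced symmetric groups\<close>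

definition big :: "'a set \<Rightarrow> 'a set \<Rightarrow> 'a \<Rightarrow> bool"
  where "big B Y z \<longleftrightarrow> card B < 2 * card (orb (fixer G Y) z)"

lemma orb_fixer_subset_orb:
  assumes "z \<in> orb G a" shows "orb (fixer G Y) z \<subseteq> orb G a"
  using orb_fixer_subset[of Y z] orb_eq[OF assms] by simp

lemma finite_orb_fixer: "finite (orb (fixer G Y) z)"
  using perm_group.finite_orb[OF fixer_perm_group] .

text \<open>Two subsets of \<open>orb G a\<close>, each with more than half of its points, must
  intersect.\<close>

lemma big_unique:
  assumes "z \<in> orb G a" "z' \<in> orb G a" "big (orb G a) Y z" "big (orb G a) Y z'"
  shows "orb (fixer G Y) z = orb (fixer G Y) z'"
proof (rule ccontr)
  assume ne: "orb (fixer G Y) z \<noteq> orb (fixer G Y) z'"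
  interpret F: perm_group \<Omega> "fixer G Y" by (rule fixer_perm_group)
  have "card (orb (fixer G Y) z \<union> orb (fixer G Y) z') = card (orb (fixer G Y) z) + card (orb (fixer G Y) z')"
    using F.orb_disjoint ne by (intro card_Un_disjoint F.finite_orb) blast
  moreover have "card (orb (fixer G Y) z \<union> orb (fixer G Y) z') \<le> card (orb G a)"
    using orb_fixer_subset_orb assms by (intro card_mono finite_orb) blast
  ultimately show False using assms(3,4) by (simp add: big_def)
qed

lemma big_mono:
  assumes "X \<subseteq> Y" "big B Y z" shows "big B X z"
  using card_mono[OF finite_orb_fixer orb_fixer_mono[OF assms(1)], of z] assms(2)
  by (simp add: big_def)

text \<open>Each point still has a majority orbit when all the others are fixed. It is the majority
  that forces the relevant orbits to coincide and so produces transpositions.\<close>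

definition independent :: "'a set \<Rightarrow> 'a set \<Rightarrow> bool"
  where "independent B Z \<longleftrightarrow> Z \<subseteq> B \<and> (\<forall>z\<in>Z. big B (Z - {z}) z)"

text \<open>With the other points \<open>W\<close> fixed, \<open>z\<close> and \<open>z'\<close>
  share the majority orbit, so some \<open>k\<close> fixing \<open>W\<close> maps \<open>z\<close>
  to \<open>z'\<close>. The point \<open>k z'\<close> has a majority orbit under the stabiliser of
  \<open>W\<close> and \<open>z'\<close>, as does \<open>z\<close>; these orbits coincide, so some
  \<open>k'\<close> fixing \<open>W\<close> and \<open>z'\<close> brings \<open>k z'\<close> back to
  \<open>z\<close>. Then \<open>k' \<circ> k\<close> is the transposition on
  \<open>Z\<close>.\<close>

lemma independent_transpose:
  assumes ind: "independent (orb G a) Z" and z: "z \<in> Z" "z' \<in> Z" "z \<noteq> z'"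
  shows "\<exists>k\<in>G. \<forall>y\<in>Z. k y = Transposition.transpose z z' y"
proof -
  define W where "W = Z - {z, z'}"
  let ?O = "orb G a"
  have W: "Z - {z} = insert z' W" "Z - {z'} = insert z W" using z by (auto simp: W_def)
  have zO: "z \<in> ?O" "z' \<in> ?O" using ind z by (auto simp: independent_def)
  have b: "big ?O (insert z' W) z" "big ?O (insert z W) z'"
    using ind z W by (auto simp: independent_def)
  then have "big ?O W z" "big ?O W z'" by (auto elim: big_mono[rotated])
  then have "orb (fixer G W) z = orb (fixer G W) z'" by (rule big_unique[OF zO])
  then have "z' \<in> orb (fixer G W) z"
    using perm_group.mem_orb_self[OF fixer_perm_group] by simp
  then obtain k where k: "k \<in> fixer G W" "k z = z'" by (auto simp: orb_def)
  then have kG: "k \<in> G" and kW: "\<And>y. y \<in> W \<Longrightarrow> k y = y" by (auto simp: fixer_def)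
  have kW': "k ` insert z W = insert z' W" using k kW by (auto simp: image_iff)
  have "card (orb (fixer G (insert z' W)) (k z')) = card (orb (fixer G (insert z W)) z')"
    using card_orb_fixer_apply[OF kG, of "insert z W" z'] kW' by simp
  then have "big ?O (insert z' W) (k z')" using b(2) by (simp add: big_def)
  moreover have "k z' \<in> ?O" using zO(2) kG orb_apply[of k z'] orb_eq[of z' a] mem_orb_self[of "k z'"] by simp
  ultimately have "orb (fixer G (insert z' W)) (k z') = orb (fixer G (insert z' W)) z"
    using big_unique zO b(1) by blast
  then have "z \<in> orb (fixer G (insert z' W)) (k z')"
    using perm_group.mem_orb_self[OF fixer_perm_group] by simp
  then obtain k' where k': "k' \<in> fixer G (insert z' W)" "k' (k z') = z" by (auto simp: orb_def)
  have "k' \<circ> k \<in> G" using k' kG by (auto simp: fixer_def comp_mem)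
  moreover have "(k' \<circ> k) y = Transposition.transpose z z' y" if yZ: "y \<in> Z" for y
  proof -
    consider "y = z" | "y = z'" | "y \<in> W" using yZ unfolding W_def by blast
    then show ?thesis
    proof cases
      case 3
      then have "y \<noteq> z" "y \<noteq> z'" by (auto simp: W_def)
      then show ?thesis using k' kW[OF 3] 3 by (auto simp: fixer_def)
    qed (use k k' z in \<open>auto simp: fixer_def\<close>)
  qed
  ultimately show ?thesis by blast
qed

text \<open>For \<open>y\<close> in \<open>Z\<close> and \<open>W\<close> the rest of
  \<open>Z\<close>, the points \<open>y\<close> and \<open>z\<close> lie in one majority orbit of
  the stabiliser of \<open>W\<close>. Orbit exchange then gives \<open>y\<close> after fixing
  \<open>z\<close> an orbit as long as that of \<open>z\<close> after fixing \<open>y\<close>. An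
  orbit of at least two points is required so that a fixed point, with its singleton orbit, is not
  \<open>big\<close>.\<close>

lemma independent_extend:
  assumes ind: "independent (orb G a) Z" and q: "card (orb G a) \<ge> 2"
    and z: "z \<in> orb G a" "big (orb G a) Z z"
  shows "z \<notin> Z" "independent (orb G a) (insert z Z)"
proof -
  let ?O = "orb G a"
  show nz: "z \<notin> Z"
  proof
    assume "z \<in> Z"
    then have "orb (fixer G Z) z = {z}"
      by (intro perm_group.orb_eq_singleton[OF fixer_perm_group]) (auto simp: fixer_def)
    then show False using z(2) q by (simp add: big_def)
  qed
  have "big ?O (insert z Z - {y}) y" if y: "y \<in> insert z Z" for y
  proof (cases "y = z")
    case True then show ?thesis using z(2) nz by simp
  next
    case False
    define W where "W = Z - {y}"
    interpret F: perm_group \<Omega> "fixer G W" by (rule fixer_perm_group)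
    have y: "y \<in> Z" "y \<in> ?O" and Z: "Z = insert y W" using y False ind by (auto simp: W_def independent_def)
    have "big ?O W y" using ind y unfolding independent_def W_def by blast
    moreover have "big ?O W z" using z(2) big_mono W_def by blast
    ultimately have "orb (fixer G W) y = orb (fixer G W) z" using big_unique y z by blast
    moreover have "card (orb (fixer G W) z) > 0" by (rule F.card_orb_pos)
    ultimately have "card (orb (fixer (fixer G W) {z}) y) = card (orb (fixer (fixer G W) {y}) z)"
      using F.card_orb_exchange[of z y] by simp
    moreover have "fixer (fixer G W) {y} = fixer G Z" "fixer (fixer G W) {z} = fixer G (insert z W)"
      unfolding Z by (auto simp: fixer_def)
    moreover have "insert z Z - {y} = insert z W" using False y nz by (auto simp: W_def)
    ultimately show ?thesis using z(2) by (simp add: big_def)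
  qed
  then show "independent ?O (insert z Z)" using ind z(1) by (auto simp: independent_def)
qed

lemma ex_independent:
  assumes q: "card (orb G a) \<ge> 2"
    and big: "\<And>Y. Y \<subseteq> orb G a \<Longrightarrow> card Y < t \<Longrightarrow> \<exists>z\<in>orb G a. big (orb G a) Y z"
  shows "\<exists>Z. independent (orb G a) Z \<and> card Z = t"
  using big
proof (induction t)
  case 0
  have "independent (orb G a) {}" by (simp add: independent_def)
  then show ?case by (intro exI[of _ "{}"]) simp
next
  case (Suc t)
  then obtain Z where Z: "independent (orb G a) Z" "card Z = t" by (auto simp: less_Suc_eq)
  then have "Z \<subseteq> orb G a" by (simp add: independent_def)
  then obtain z where z: "z \<in> orb G a" "big (orb G a) Z z" using Suc.prems Z(2) by blast
  have "finite Z" using \<open>Z \<subseteq> orb G a\<close> finite_orb finite_subset by blast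
  then have "card (insert z Z) = Suc t" using independent_extend(1)[OF Z(1) q z] Z(2) by simp
  then show ?case using independent_extend(2)[OF Z(1) q z] by blast
qed

lemma independent_symmetric:
  assumes ind: "independent (orb G a) Z" and \<sigma>: "\<sigma> permutes Z"
  shows "\<exists>g\<in>G. \<forall>z\<in>Z. g z = \<sigma> z"
proof -
  have "finite Z" using ind finite_orb finite_subset by (auto simp: independent_def)
  with \<sigma> show ?thesis
  proof (induction rule: permutes_induct)
    case id
    then show ?case using id_mem by (intro bexI[of _ id]) auto
  next
    case (swap x y p)
    then obtain g where g: "g \<in> G" "\<forall>z\<in>Z. g z = p z" by blast
    obtain k where k: "k \<in> G" "\<forall>z\<in>Z. k z = Transposition.transpose x y z"
      using independent_transpose[OF ind] swap by blast
    have "p z \<in> Z" if "z \<in> Z" for z using that swap permutes_in_image by metis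
    then show ?case using g k by (intro bexI[of _ "k \<circ> g"]) (auto simp: comp_mem)
  qed
qed

text \<open>Let \<open>s j\<close> be the least size of a still long orbit (at least
  \<open>1 / E\<close> of the original one) after fixing at most \<open>j\<close> points. Over
  \<open>l\<close> blocks of \<open>t\<close> fixed points it cannot halve every time, since
  \<open>card \<Omega> < 2 ^ l\<close>. At a block where it does not halve, fixing fewer than
  \<open>t\<close> further points of the current orbit always leaves a majority orbit, so an
  independent set of size \<open>t\<close> can be grown there.\<close>

lemma ex_symmetric_subset:
  fixes E C1 :: real and t l :: nat
  assumes n: "card \<Omega> < 2 ^ l" and a: "a \<in> \<Omega>" and E: "E \<ge> 1" and C1: "C1 \<ge> 1" and t: "t \<ge> 1"
    and large: "E * (C1 * (l * t)) < card (orb G a)"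
    and few: "\<And>Y. Y \<subseteq> orb G a \<Longrightarrow>
      card {y \<in> orb G a. E * card (orb (fixer G Y) y) < card (orb G a)} \<le> C1 * card Y"
  shows "\<exists>Z. Z \<subseteq> orb G a \<and> card Z = t \<and> (\<forall>\<sigma>. \<sigma> permutes Z \<longrightarrow> (\<exists>g\<in>G. \<forall>z\<in>Z. g z = \<sigma> z))"
proof -
  let ?O = "orb G a"
  define adm where "adm j q \<longleftrightarrow> (\<exists>Y y. Y \<subseteq> ?O \<and> card Y \<le> j \<and> y \<in> ?O \<and>
      q = card (orb (fixer G Y) y) \<and> card ?O \<le> E * q)" for j q
  define s where "s j = (LEAST q. adm j q)" for j
  have adm0: "adm j (card ?O)" for j
    unfolding adm_def using mem_orb_self[of a] E
    by (intro exI[of _ "{}"] exI[of _ a]) (auto simp: fixer_def mult_le_cancel_right1)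
  have adm_s: "adm j (s j)" for j unfolding s_def using LeastI[of "adm j"] adm0 by blast
  have s_le: "s j \<le> q" if "adm j q" for j q unfolding s_def using that Least_le[of "adm j"] by blast
  have s_pos: "s j > 0" for j
    using adm_s[of j] perm_group.card_orb_pos[OF fixer_perm_group] by (auto simp: adm_def)
  have "\<exists>i<l. s (i * t) < 2 * s (Suc i * t)"
  proof (rule ccontr)
    assume "\<not> ?thesis"
    then have *: "2 * s (Suc i * t) \<le> s (i * t)" if "i < l" for i using that by (meson not_le)
    have "2 ^ i * s (i * t) \<le> s 0" if "i \<le> l" for i
      using that
    proof (induction i)
      case (Suc i)
      have "2 ^ Suc i * s (Suc i * t) = 2 ^ i * (2 * s (Suc i * t))" by simp
      also have "\<dots> \<le> 2 ^ i * s (i * t)" using *[of i] Suc.prems by (intro mult_left_mono) auto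
      also have "\<dots> \<le> s 0" using Suc by simp
      finally show ?case .
    qed simp
    then have "2 ^ l * s (l * t) \<le> s 0" by simp
    also have "s 0 \<le> card ?O" using s_le adm0 by blast
    also have "\<dots> \<le> card \<Omega>" using orb_subset[OF a] finite_\<Omega> by (intro card_mono)
    also have "\<dots> < 2 ^ l * 1" using n by simp
    finally show False using s_pos[of "l * t"] by (simp only: mult_less_cancel1) linarith
  qed
  then obtain i where i: "i < l" "s (i * t) < 2 * s (Suc i * t)" by blast
  obtain Y y where Y: "Y \<subseteq> ?O" "card Y \<le> i * t" "y \<in> ?O" "s (i * t) = card (orb (fixer G Y) y)"
      "card ?O \<le> E * s (i * t)"
    using adm_s[of "i * t"] by (auto simp: adm_def)
  interpret K: perm_group \<Omega> "fixer G Y" by (rule fixer_perm_group)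
  let ?O' = "orb (fixer G Y) y"
  have sub: "?O' \<subseteq> ?O" using orb_fixer_subset_orb Y(3) .
  have qE: "C1 * (l * t) < card ?O'"
  proof -
    have "E * (C1 * (l * t)) < E * card ?O'" using large Y(5) unfolding Y(4) by (rule less_le_trans)
    then show ?thesis using E by simp
  qed
  have "1 * 1 \<le> real l * real t" using i(1) t by (intro mult_mono) auto
  then have "1 * 1 \<le> C1 * (real l * real t)" using C1 by (intro mult_mono) auto
  then have q2: "card ?O' \<ge> 2" using qE by simp
  have "\<exists>z\<in>?O'. K.big ?O' Y' z" if Y': "Y' \<subseteq> ?O'" "card Y' < t" for Y'
  proof -
    \<comment> \<open>Points whose orbit has become short. By \<open>few\<close> they do not fill
      the current orbit, and any other point has an orbit of size at least
      \<open>s (Suc i * t)\<close>, more than half of the current one.\<close>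
    define X where "X = {z \<in> ?O. E * card (orb (fixer G (Y \<union> Y')) z) < card ?O}"
    have cY: "card (Y \<union> Y') \<le> Suc i * t" using card_Un_le[of Y Y'] Y(2) Y'(2) by simp
    also have "\<dots> \<le> l * t" using i(1) by (intro mult_right_mono) auto
    finally have "real (card (Y \<union> Y')) \<le> l * t" by (simp only: of_nat_le_iff)
    then have "C1 * real (card (Y \<union> Y')) \<le> C1 * (l * t)" using C1 by (intro mult_left_mono) auto
    moreover have "card X \<le> C1 * card (Y \<union> Y')" unfolding X_def using few Y(1) Y'(1) sub by simp
    ultimately have "real (card X) < card ?O'" using qE by linarith
    moreover have "finite X" unfolding X_def using finite_orb by simp
    ultimately obtain z where z: "z \<in> ?O'" "z \<notin> X" using card_mono[of X ?O'] by fastforce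
    then have zO: "z \<in> ?O" using sub by blast
    have "adm (Suc i * t) (card (orb (fixer G (Y \<union> Y')) z))"
      unfolding adm_def using Y(1) Y'(1) sub cY zO z(2)
      by (intro exI[of _ "Y \<union> Y'"] exI[of _ z]) (auto simp: X_def)
    then have "s (Suc i * t) \<le> card (orb (fixer G (Y \<union> Y')) z)" by (rule s_le)
    then have "K.big ?O' Y' z" using i(2) Y(4) unfolding K.big_def fixer_fixer by linarith
    with z show ?thesis by blast
  qed
  then obtain Z where Z: "K.independent ?O' Z" "card Z = t" using K.ex_independent[OF q2] by metis
  then have "Z \<subseteq> ?O" using sub by (auto simp: K.independent_def)
  moreover have "\<exists>g\<in>G. \<forall>z\<in>Z. g z = \<sigma> z" if "\<sigma> permutes Z" for \<sigma>
    using K.independent_symmetric[OF Z(1) that] by (auto simp: fixer_def)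
  ultimately show ?thesis using Z(2) by blast
qed

section \<open>Periods of points and elements with prime cycles\<close>

lemma funpow_fixed:
  assumes "(h ^^ d) y = y" "d dvd m" shows "(h ^^ m) y = y"
proof -
  obtain c where "m = d * c" using assms(2) by auto
  moreover have "((h ^^ d) ^^ c) y = y" using assms(1) by (induction c) auto
  ultimately show ?thesis by (simp add: funpow_mult)
qed

lemma ex_period:
  assumes "h \<in> G" "card \<Omega> \<ge> 1"
  shows "\<exists>d. 1 \<le> d \<and> d \<le> card \<Omega> \<and> (h ^^ d) y = y"
proof (cases "y \<in> \<Omega>")
  case True
  have "(h ^^ i) y \<in> \<Omega>" for i using True permutes_in_image[OF permutes[OF funpow_mem[OF assms(1)]]] by simp
  then have "(\<lambda>i. (h ^^ i) y) ` {..card \<Omega>} \<subseteq> \<Omega>" by blast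
  then have "\<not> inj_on (\<lambda>i. (h ^^ i) y) {..card \<Omega>}"
    using card_inj_on_le[OF _ _ finite_\<Omega>, of "\<lambda>i. (h ^^ i) y" "{..card \<Omega>}"] by auto
  then obtain i j where ij: "i < j" "j \<le> card \<Omega>" "(h ^^ i) y = (h ^^ j) y"
    unfolding inj_on_def by (metis atMost_iff linorder_neqE_nat)
  have "(h ^^ i) ((h ^^ (j - i)) y) = (h ^^ j) y"
    using ij(1) funpow_add[of i "j - i" h] by (metis add_diff_inverse_nat comp_apply less_imp_le not_le)
  then have "(h ^^ (j - i)) y = y" using ij(3) inj_mem[OF funpow_mem[OF assms(1), of i]] by metis
  then show ?thesis using ij by (intro exI[of _ "j - i"]) auto
next
  case False
  then have "h y = y" using permutes[OF assms(1)] by (simp add: permutes_def)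
  then show ?thesis using assms by (intro exI[of _ 1]) auto
qed

end

lemma card_prime_divisors_less:
  fixes d :: nat
  assumes "1 \<le> d" "d < 2 ^ l" and S: "\<And>p. p \<in> S \<Longrightarrow> prime p \<and> p dvd d"
  shows "card S < l"
proof -
  have sub: "S \<subseteq> prime_factors d" using S assms(1) by (auto simp: in_prime_factors_iff)
  then have "finite S" using finite_subset by blast
  have "2 ^ card S = (\<Prod>p\<in>S. 2::nat)" by simp
  also have "\<dots> \<le> \<Prod>S" using S prime_ge_2_nat by (intro prod_mono) auto
  also have "\<dots> \<le> (\<Prod>p\<in>prime_factors d. p)"
    using sub by (intro dvd_imp_le prod_dvd_prod_subset prod_pos) (auto intro: prime_gt_0_nat)
  also have "\<dots> \<le> (\<Prod>p\<in>prime_factors d. p ^ multiplicity p d)"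
  proof (intro prod_mono conjI)
    fix p assume p: "p \<in> prime_factors d"
    then have "multiplicity p d > 0" by (simp add: prime_factors_multiplicity)
    then show "p \<le> p ^ multiplicity p d"
      using p prime_ge_1_nat[of p] by (intro self_le_power) auto
  qed simp
  also have "\<dots> = d" using prime_factorization_nat[of d] assms(1) by simp
  also have "\<dots> < 2 ^ l" by fact
  finally show ?thesis by simp
qed

text \<open>Raising a permutation to the power \<open>n! / p^e\<close> kills every cycle whose length is not
  divisible by \<open>p\<close>.\<close>

lemma (in perm_group) ex_prime_cycle_powers:
  fixes Pr :: "nat set"
  assumes n: "card \<Omega> \<ge> 1" "card \<Omega> < 2 ^ l"
    and Z: "card Z = \<Sum>Pr" "finite Z" "\<And>\<sigma>. \<sigma> permutes Z \<Longrightarrow> \<exists>g\<in>G. \<forall>z\<in>Z. g z = \<sigma> z"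
    and Pr: "finite Pr" "\<And>p. p \<in> Pr \<Longrightarrow> prime p"
  shows "\<exists>v x. inj_on x Pr \<and> x ` Pr \<subseteq> Z \<and> (\<forall>p\<in>Pr. v p \<in> G \<and> inj_on (\<lambda>j. (v p ^^ j) (x p)) {..<p}) \<and>
    (\<forall>y. card {p \<in> Pr. v p y \<noteq> y} < l)"
proof -
  \<comment> \<open>\<open>J\<close> is a disjoint union of one cycle of length \<open>p\<close> for
    each prime in \<open>Pr\<close>. It is transported to \<open>Z\<close> and lifted to some
    \<open>h\<close> in \<open>G\<close>, whose action outside \<open>Z\<close> is
    uncontrolled.\<close>
  define J where "J = Sigma Pr (\<lambda>p. {..<p})"
  have "finite J" and "card J = card Z" unfolding J_def using Pr Z by auto
  then obtain f where f: "bij_betw f J Z" using Z(2) by (metis finite_same_card_bij)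
  have finj: "f j = f j' \<longleftrightarrow> j = j'" if "j \<in> J" "j' \<in> J" for j j'
    using f that by (auto simp: bij_betw_def inj_on_def)
  define rot where "rot = (\<lambda>(p, i). (p, Suc i mod p))"
  have p0: "p > 0" if "p \<in> Pr" for p using Pr(2)[OF that] by (rule prime_gt_0_nat)
  have rotJ: "rot j \<in> J" if "j \<in> J" for j using that p0 by (auto simp: rot_def J_def)
  have rot_inj: "inj_on rot J"
  proof (rule inj_onI)
    fix j j' assume *: "j \<in> J" "j' \<in> J" "rot j = rot j'"
    obtain p i p' i' where [simp]: "j = (p, i)" "j' = (p', i')" by fastforce
    have "p' = p" "i < p" "i' < p" "Suc i mod p = Suc i' mod p" using * by (auto simp: rot_def J_def)
    then show "j = j'" by (cases "Suc i = p"; cases "Suc i' = p") auto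
  qed
  define \<sigma> where "\<sigma> z = (if z \<in> Z then f (rot (the_inv_into J f z)) else z)" for z
  have \<sigma>f: "\<sigma> (f j) = f (rot j)" if "j \<in> J" for j
    using f that by (auto simp: \<sigma>_def bij_betw_def the_inv_into_f_f)
  have "\<sigma> permutes Z"
  proof (rule inj_imp_permutes)
    have "inj_on (\<sigma> \<circ> f) J"
      using rot_inj finj rotJ \<sigma>f by (auto simp: inj_on_def)
    then show "inj_on \<sigma> Z" using f inj_on_imageI[of \<sigma> f J] by (simp add: bij_betw_def)
    show "\<sigma> z \<in> Z" if "z \<in> Z" for z
    proof -
      have "z \<in> f ` J" using f that by (simp add: bij_betw_def)
      then obtain j where "j \<in> J" "z = f j" by blast
      then have "\<sigma> z = f (rot j)" "rot j \<in> J" using \<sigma>f rotJ by auto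
      then show ?thesis using bij_betwE[OF f] by simp
    qed
  qed (use Z in \<open>auto simp: \<sigma>_def\<close>)
  then obtain h where h: "h \<in> G" "\<And>z. z \<in> Z \<Longrightarrow> h z = \<sigma> z" using Z(3) by blast
  have fZ: "f j \<in> Z" if "j \<in> J" for j using f that by (auto simp: bij_betw_def)
  have hpow: "(h ^^ m) (f (p, 0)) = f (p, m mod p)" if "p \<in> Pr" for m p
  proof (induction m)
    case (Suc m)
    have "(p, m mod p) \<in> J" using p0[OF that] that by (simp add: J_def)
    then show ?case using Suc h(2) fZ \<sigma>f by (simp add: rot_def mod_Suc_eq)
  qed (use p0 that in auto)
  define N where "N = (fact (card \<Omega>) :: nat)"
  define M where "M p = N div p ^ multiplicity p N" for p
  have N0: "N \<noteq> 0" by (simp add: N_def)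
  have NM: "N = p ^ multiplicity p N * M p" for p by (simp add: M_def multiplicity_dvd)
  have pM: "\<not> p dvd M p" if "p \<in> Pr" for p
    unfolding M_def using multiplicity_decompose[OF N0, of p] Pr(2)[OF that] not_prime_unit by blast
  define v where "v p = h ^^ M p" for p
  define x where "x p = f (p, 0)" for p
  have J0: "(p, 0) \<in> J" if "p \<in> Pr" for p using that p0 by (simp add: J_def)
  have "inj_on x Pr" using finj J0 by (auto simp: inj_on_def x_def)
  moreover have "x ` Pr \<subseteq> Z" using fZ J0 by (auto simp: x_def)
  moreover have "v p \<in> G" for p by (simp add: v_def funpow_mem h)
  moreover have "inj_on (\<lambda>j. (v p ^^ j) (x p)) {..<p}" if p: "p \<in> Pr" for p
  proof (rule inj_onI)
    fix i j assume ij: "i \<in> {..<p}" "j \<in> {..<p}" "(v p ^^ i) (x p) = (v p ^^ j) (x p)"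
    have "(v p ^^ i) (x p) = f (p, (M p * i) mod p)" for i
      using hpow[OF p, of "M p * i"] by (simp add: v_def x_def funpow_mult)
    then have "f (p, (M p * i) mod p) = f (p, (M p * j) mod p)" using ij(3) by simp
    then have "(M p * i) mod p = (M p * j) mod p"
      using finj[of "(p, (M p * i) mod p)" "(p, (M p * j) mod p)"] p p0 by (auto simp: J_def)
    then have "[M p * i = M p * j] (mod p)" by (simp add: unique_euclidean_semiring_class.cong_def)
    moreover have "coprime (M p) p" using prime_imp_coprime[OF Pr(2)[OF p] pM[OF p]] by (simp add: ac_simps)
    ultimately have "[i = j] (mod p)" using cong_mult_lcancel_nat by blast
    then show "i = j" using ij by (simp add: unique_euclidean_semiring_class.cong_def)
  qed
  moreover have "card {p \<in> Pr. v p y \<noteq> y} < l" for y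
  proof -
    \<comment> \<open>\<open>d\<close> is a return time of \<open>y\<close> under \<open>h\<close>.
      A prime \<open>p\<close> whose \<open>v p\<close> moves \<open>y\<close> must divide
      \<open>d\<close>, and a number below \<open>2 ^ l\<close> has fewer than \<open>l\<close>
      prime divisors.\<close>
    obtain d where d: "1 \<le> d" "d \<le> card \<Omega>" "(h ^^ d) y = y" using ex_period[OF h(1) n(1)] by blast
    have dN: "d dvd N" unfolding N_def using d by (auto intro: dvd_fact)
    have "p dvd d" if p: "p \<in> Pr" "v p y \<noteq> y" for p
    proof (rule ccontr)
      assume "\<not> p dvd d"
      then have "coprime d (p ^ multiplicity p N)"
        using prime_imp_coprime[OF Pr(2)[OF p(1)]] by (simp add: ac_simps)
      moreover have "d dvd p ^ multiplicity p N * M p" using dN NM by simp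
      ultimately have "d dvd M p" by (rule coprime_dvd_mult_right_iff[THEN iffD1])
      then have "v p y = y" unfolding v_def by (rule funpow_fixed[OF d(3)])
      with p show False by simp
    qed
    then show ?thesis using Pr(2) d n(2) by (intro card_prime_divisors_less[of d]) auto
  qed
  ultimately show ?thesis by blast
qed

section \<open>Bases of small weight\<close>

text \<open>Two points are dependent when fixing one of them shrinks the orbit of the other by more than
  the factor \<open>E\<close>; by orbit counting this relation is symmetric.\<close>

definition (in perm_group) dep :: "real \<Rightarrow> 'a \<Rightarrow> 'a set"
  where "dep E a = {y \<in> \<Omega>. E * card (orb (fixer G {a}) y) < card (orb G y)}"

context perm_group begin

lemma dep_sym: "a \<in> \<Omega> \<Longrightarrow> y \<in> dep E a \<Longrightarrow> a \<in> dep E y"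
proof -
  assume a: "a \<in> \<Omega>" and y: "y \<in> dep E a"
  have p: "real (card (orb G a)) > 0" "real (card (orb G y)) > 0" using card_orb_pos by auto
  have "real (card (orb G a)) * (E * card (orb (fixer G {a}) y)) < card (orb G a) * card (orb G y)"
    using y p(1) by (simp add: dep_def)
  moreover have "real (card (orb G a)) * card (orb (fixer G {a}) y) = card (orb G y) * card (orb (fixer G {y}) a)"
    using card_orb_exchange[of a y] by (simp only: flip: of_nat_mult)
  ultimately have "real (card (orb G y)) * (E * card (orb (fixer G {y}) a)) < card (orb G y) * card (orb G a)"
    by (simp add: algebra_simps)
  then show "a \<in> dep E y" using a p(2) by (simp add: dep_def)
qed

lemma dep_apply:
  assumes "g \<in> G"
  shows "g y \<in> dep E (g a) \<longleftrightarrow> y \<in> dep E a"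
  using card_orb_fixer_apply[OF assms, of "{a}" y] orb_apply[OF assms, of y]
    permutes_in_image[OF permutes[OF assms]] by (simp add: dep_def)

text \<open>Each point \<open>z\<close> is moved by at most \<open>l\<close> of the
  \<open>v p\<close>, and at most \<open>card (fixer G {a, y})\<close> elements realise a given pair
  of images of \<open>a\<close> and \<open>y\<close>. Since \<open>y\<close> is not dependent on
  \<open>a\<close>, the orbit of \<open>y\<close> times this stabiliser has size at most
  \<open>E * card G / card (orb G a)\<close>. Thus for a random \<open>g\<close> with
  \<open>g a\<close> among the \<open>x p\<close>, the chance that \<open>v p\<close> moves
  \<open>g y\<close> is at most \<open>l * E / card Pr\<close>.\<close>

lemma sum_card_transporters_le:
  fixes E :: real
  assumes a: "a \<in> \<Omega>" and y: "y \<in> \<Omega>" "y \<notin> dep E a" and E: "E \<ge> 1"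
    and Pr: "finite Pr" and x: "inj_on x Pr" and few: "\<And>z. card {p \<in> Pr. v p z \<noteq> z} \<le> l"
  shows "(\<Sum>p\<in>Pr. card {g \<in> G. g a = x p \<and> g y \<in> moved (v p)}) * card (orb G a) \<le> l * E * card G"
proof -
  have "(\<Sum>p\<in>Pr. card {g \<in> G. g a = x p \<and> g y \<in> moved (v p)})
      \<le> (\<Sum>p\<in>Pr. \<Sum>z\<in>orb G y. if v p z \<noteq> z then card (fixer G {a, y}) else 0)"
  proof (rule sum_mono)
    fix p
    have "{g \<in> G. g a = x p \<and> g y \<in> moved (v p)} =
        (\<Union>z\<in>{z \<in> orb G y. v p z \<noteq> z}. {g \<in> G. g a = x p \<and> g y = z})"
      by (auto simp: orb_def moved_def)
    then have "card {g \<in> G. g a = x p \<and> g y \<in> moved (v p)} \<le>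
        (\<Sum>z\<in>{z \<in> orb G y. v p z \<noteq> z}. card {g \<in> G. g a = x p \<and> g y = z})"
      using card_UN_le[of "{z \<in> orb G y. v p z \<noteq> z}" "\<lambda>z. {g \<in> G. g a = x p \<and> g y = z}"] finite_orb by simp
    also have "\<dots> \<le> (\<Sum>z\<in>{z \<in> orb G y. v p z \<noteq> z}. card (fixer G {a, y}))"
      by (intro sum_mono card_transporter2_le)
    also have "\<dots> = (\<Sum>z\<in>orb G y. if v p z \<noteq> z then card (fixer G {a, y}) else 0)"
      using finite_orb by (subst sum.inter_filter) auto
    finally show "card {g \<in> G. g a = x p \<and> g y \<in> moved (v p)} \<le> \<dots>" .
  qed
  also have "\<dots> = (\<Sum>z\<in>orb G y. \<Sum>p\<in>Pr. if v p z \<noteq> z then card (fixer G {a, y}) else 0)"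
    by (rule sum.swap)
  also have "\<dots> = (\<Sum>z\<in>orb G y. card {p \<in> Pr. v p z \<noteq> z} * card (fixer G {a, y}))"
    using Pr by (intro sum.cong refl) (simp flip: sum.inter_filter)
  also have "\<dots> \<le> (\<Sum>z\<in>orb G y. l * card (fixer G {a, y}))"
    using few by (intro sum_mono mult_right_mono) auto
  also have "\<dots> = l * (card (orb G y) * card (fixer G {a, y}))" by simp
  finally have 1: "(\<Sum>p\<in>Pr. card {g \<in> G. g a = x p \<and> g y \<in> moved (v p)})
      \<le> l * (card (orb G y) * card (fixer G {a, y}))" .
  have "a \<notin> dep E y" using dep_sym y by blast
  then have 2: "real (card (orb G a)) \<le> E * card (orb (fixer G {y}) a)" using a by (simp add: dep_def)
  have 3: "card G = card (orb G y) * card (orb (fixer G {y}) a) * card (fixer G {a, y})"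
    using card_G_two[of y a] by (simp only: insert_commute)
  have "real (\<Sum>p\<in>Pr. card {g \<in> G. g a = x p \<and> g y \<in> moved (v p)}) * card (orb G a)
      \<le> real (l * (card (orb G y) * card (fixer G {a, y}))) * (E * card (orb (fixer G {y}) a))"
    using 1 2 by (intro mult_mono of_nat_mono) auto
  also have "\<dots> = l * E * card G" unfolding 3 by simp
  finally show ?thesis by simp
qed

lemma card_transporters_to_image:
  assumes Pr: "finite Pr" and x: "inj_on x Pr" "x ` Pr \<subseteq> orb G a"
  shows "card {g \<in> G. g a \<in> x ` Pr} * card (orb G a) = card Pr * card G"
proof -
  have "{g \<in> G. g a \<in> x ` Pr} = (\<Union>p\<in>Pr. {g \<in> G. g a = x p})" by auto
  then have "card {g \<in> G. g a \<in> x ` Pr} = card (\<Union>p\<in>Pr. {g \<in> G. g a = x p})" by (rule arg_cong)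
  also have "\<dots> = (\<Sum>p\<in>Pr. card {g \<in> G. g a = x p})"
    using Pr finite_G x by (intro card_UN_disjoint) (auto simp: inj_on_def)
  also have "\<dots> = card Pr * card (fixer G {a})"
    using x card_transporter by (simp add: image_subset_iff)
  finally show ?thesis using card_eq_orb_times_fixer[of a] by simp
qed

text \<open>The heart of the large support case: if some orbit is so large that \<open>G\<close> contains elements with
  many prime cycles, then an element of minimal support among those moving a point of the orbit to an
  independent one must have bounded support, since otherwise its commutator with a suitable
  prime-cycle element is smaller.\<close>

lemma ex_small_moved:
  fixes E C1 :: real and B l :: nat
  assumes n: "card \<Omega> < 2 ^ l" and a0: "a0 \<in> \<Omega>" and E: "E \<ge> 1" and C1: "C1 \<ge> 1"
    and Pr: "finite Pr" "Pr \<noteq> {}" "\<And>p. p \<in> Pr \<Longrightarrow> prime p \<and> p > B"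
    and r: "8 * l * E \<le> card Pr"
    and large: "E * (C1 * (l * \<Sum>Pr)) < card (orb G a0)"
    and few: "\<And>Y. Y \<subseteq> orb G a0 \<Longrightarrow>
      card {y \<in> orb G a0. E * card (orb (fixer G Y) y) < card (orb G a0)} \<le> C1 * card Y"
    and B: "\<And>a. a \<in> orb G a0 \<Longrightarrow> card (dep E a) \<le> B"
  shows "\<exists>h\<in>G. h \<noteq> id \<and> card (moved h) \<le> 6 * B"
proof -
  let ?O = "orb G a0"
  have O\<Omega>: "?O \<subseteq> \<Omega>" using orb_subset[OF a0] .
  have finO: "finite ?O" by (rule finite_orb)
  have finM: "finite A" if "A \<subseteq> \<Omega>" for A using that finite_\<Omega> finite_subset by blast
  obtain p0 where p0: "p0 \<in> Pr" using Pr by blast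
  have "\<Sum>Pr \<ge> p0" using p0 Pr(1) by (intro member_le_sum) auto
  then have t1: "\<Sum>Pr \<ge> 1" using Pr(3)[OF p0] by linarith
  obtain Z where Z: "Z \<subseteq> ?O" "card Z = \<Sum>Pr" "\<And>\<sigma>. \<sigma> permutes Z \<Longrightarrow> \<exists>g\<in>G. \<forall>z\<in>Z. g z = \<sigma> z"
    using ex_symmetric_subset[OF n a0 E C1 t1 large few] by blast
  have "card \<Omega> \<ge> 1" using a0 finite_\<Omega> by (metis One_nat_def Suc_leI card_gt_0_iff empty_iff)
  from ex_prime_cycle_powers[OF this n Z(2) finite_subset[OF Z(1) finO] Z(3) Pr(1)]
  obtain v' x where vx0: "inj_on x Pr \<and> x ` Pr \<subseteq> Z \<and>
      (\<forall>p\<in>Pr. v' p \<in> G \<and> inj_on (\<lambda>j. (v' p ^^ j) (x p)) {..<p}) \<and>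
      (\<forall>y. card {p \<in> Pr. v' p y \<noteq> y} < l)"
    using Pr(3) by blast
  have vx: "inj_on x Pr" "x ` Pr \<subseteq> Z"
      "\<And>p. p \<in> Pr \<Longrightarrow> v' p \<in> G" "\<And>p. p \<in> Pr \<Longrightarrow> inj_on (\<lambda>j. (v' p ^^ j) (x p)) {..<p}"
      "\<And>y. card {p \<in> Pr. v' p y \<noteq> y} < l"
    using vx0 by auto
  \<comment> \<open>The cycle of \<open>v' p\<close> through \<open>x p\<close> has at least
    \<open>p > B\<close> points, more than depend on \<open>x p\<close>, so a suitable power sends
    \<open>x p\<close> to an independent point.\<close>
  have "\<exists>j. (v' p ^^ j) (x p) \<notin> dep E (x p)" if p: "p \<in> Pr" for p
  proof (rule ccontr)
    assume "\<not> ?thesis"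
    then have "(\<lambda>j. (v' p ^^ j) (x p)) ` {..<p} \<subseteq> dep E (x p)" by blast
    then have "card {..<p} \<le> card (dep E (x p))"
      using vx(4)[OF p] by (intro card_inj_on_le[of "\<lambda>j. (v' p ^^ j) (x p)"] finM) (auto simp: dep_def)
    also have "\<dots> \<le> B" using B vx(2) Z(1) p by (meson image_eqI subsetD)
    finally show False using Pr(3)[OF p] by simp
  qed
  then obtain J where J: "\<And>p. p \<in> Pr \<Longrightarrow> (v' p ^^ J p) (x p) \<notin> dep E (x p)" by metis
  define v where "v p = v' p ^^ J p" for p
  have v: "v p \<in> G" "v p (x p) \<notin> dep E (x p)" "x p \<in> ?O" if "p \<in> Pr" for p
    using that vx J Z(1) by (auto simp: v_def funpow_mem)
  have vl: "card {p \<in> Pr. v p y \<noteq> y} \<le> l" for y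
  proof -
    have "v' p y \<noteq> y" if "v p y \<noteq> y" for p
      using that funpow_fixed[of 1 "v' p" y "J p"] by (auto simp: v_def)
    then have "card {p \<in> Pr. v p y \<noteq> y} \<le> card {p \<in> Pr. v' p y \<noteq> y}"
      using Pr(1) by (intro card_mono) auto
    then show ?thesis using vx(5)[of y] by simp
  qed
  \<comment> \<open>Minimality is taken over this class, and not over all nontrivial elements,
    because sending a point to an independent one is a property that the commutators below
    inherit.\<close>
  define good where "good h \<longleftrightarrow> h \<in> G \<and> (\<exists>a\<in>?O. h a \<notin> dep E a)" for h
  have "good (v p0)" using v[OF p0] by (auto simp: good_def)
  then obtain h where h: "good h" "\<And>k. good k \<Longrightarrow> card (moved h) \<le> card (moved k)"
    using ex_has_least_nat[of good "v p0" "\<lambda>h. card (moved h)"] by blast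
  then obtain a where hG: "h \<in> G" and a: "a \<in> ?O" "h a \<notin> dep E a" by (auto simp: good_def)
  have OO: "orb G a = ?O" using a orb_eq by blast
  have a\<Omega>: "a \<in> \<Omega>" using a O\<Omega> by blast
  have adep: "b \<in> dep E b" if "b \<in> ?O" for b
  proof -
    have "orb (fixer G {b}) b = {b}"
      by (intro perm_group.orb_eq_singleton[OF fixer_perm_group]) (auto simp: fixer_def)
    moreover have "orb G b = ?O" using that orb_eq by blast
    moreover have "E * 1 < card ?O"
    proof -
      have "l \<ge> 1" using vx(5) by (metis One_nat_def Suc_leI gr0I not_less0)
      moreover have "1 \<le> real (\<Sum>Pr)" using t1 by (metis of_nat_1 of_nat_le_iff)
      ultimately have "1 * 1 \<le> real l * real (\<Sum>Pr)" by (intro mult_mono) linarith+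
      then have "1 * 1 \<le> C1 * (real l * real (\<Sum>Pr))" using C1 by (intro mult_mono) auto
      then have "E * 1 \<le> E * (C1 * (l * \<Sum>Pr))" using E by (intro mult_left_mono) auto
      then show ?thesis using large by linarith
    qed
    ultimately show ?thesis using that O\<Omega> by (auto simp: dep_def)
  qed
  have "h \<noteq> id" using a adep by auto
  define a' where "a' = inv' h a"
  have ha': "h a' = a" using inv_apply(2)[OF hG] by (simp add: a'_def)
  \<comment> \<open>If \<open>a'\<close> depended on \<open>a\<close>, applying \<open>h\<close>
    would make \<open>a\<close> depend on \<open>h a\<close>, and symmetry would contradict the
    choice of \<open>a\<close>.\<close>
  have a': "a' \<in> \<Omega>" "a' \<notin> dep E a"
  proof -
    have "a' \<in> orb G a" unfolding a'_def orb_def using inv_mem[OF hG] by blast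
    then show "a' \<in> \<Omega>" using OO O\<Omega> by blast
    show "a' \<notin> dep E a"
    proof
      assume "a' \<in> dep E a"
      then have "h a' \<in> dep E (h a)" using dep_apply[OF hG] by blast
      then have "a \<in> dep E (h a)" using ha' by simp
      moreover have "h a \<in> \<Omega>" using a\<Omega> permutes_in_image[OF permutes[OF hG]] by simp
      ultimately show False using dep_sym a(2) by blast
    qed
  qed
  let ?S = "moved h"
  let ?s = "card ?S" and ?r = "card Pr"
  have S\<Omega>: "?S \<subseteq> \<Omega>" using moved_subset[OF hG] .
  define \<G> where "\<G> p = {g \<in> G. g a = x p}" for p
  \<comment> \<open>The conjugate \<open>u\<close> of \<open>h\<close> carries \<open>g a'\<close>
    to \<open>x p\<close>. As \<open>v p\<close> fixes \<open>g a'\<close>, the commutator sends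
    \<open>x p\<close> to the independent point \<open>v p (x p)\<close>, so it is
    \<open>good\<close> and moves at least as many points as \<open>h\<close>.\<close>
  have key: "?s \<le> 3 * card (g ` ?S \<inter> moved (v p))"
    if p: "p \<in> Pr" and g: "g \<in> G" "g a = x p" "g a' \<notin> moved (v p)" for p g
  proof -
    define u where "u = g \<circ> h \<circ> inv' g"
    have uG: "u \<in> G" using g hG by (simp add: u_def comp_mem inv_mem)
    define w where "w = v p \<circ> u \<circ> inv' (v p) \<circ> inv' u"
    have wG: "w \<in> G" unfolding w_def using uG v p by (intro comp_mem inv_mem) auto
    have "u (g a') = x p" using g ha' inv_apply(1)[OF g(1)] by (simp add: u_def)
    then have "inv' u (x p) = g a'" using inv_apply(1)[OF uG] by metis
    moreover have "inv' (v p) (g a') = g a'" using g(3) inv_apply(1)[OF v(1)[OF p]] by (metis (mono_tags) mem_Collect_eq moved_def)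
    ultimately have "w (x p) = v p (x p)" using \<open>u (g a') = x p\<close> by (simp add: w_def)
    then have "w (x p) \<notin> dep E (x p)" using v(2)[OF p] by simp
    then have "good w" unfolding good_def using wG v(3)[OF p] by blast
    then have "?s \<le> card (moved w)" by (rule h(2))
    also have "\<dots> \<le> 3 * card (moved u \<inter> moved (v p))"
      unfolding w_def using card_moved_commutator_le uG v p by blast
    also have "moved u = g ` ?S"
    proof -
      have "y \<in> g ` ?S" if "u y \<noteq> y" for y
      proof (rule image_eqI)
        show "y = g (inv' g y)" using inv_apply(2)[OF g(1)] by simp
        show "inv' g y \<in> ?S" using that inv_apply(2)[OF g(1)] by (auto simp: moved_def u_def)
      qed
      moreover have "u (g y) \<noteq> g y" if "h y \<noteq> y" for y
        using that inv_apply(1)[OF g(1)] inj_mem[OF g(1)] by (simp add: u_def)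
      ultimately show ?thesis by (auto simp: moved_def)
    qed
    finally show ?thesis .
  qed
  define N where "N = card {g \<in> G. g a \<in> x ` Pr}"
  have NO: "real N * card ?O = ?r * card G"
  proof -
    have "x ` Pr \<subseteq> orb G a" using vx(2) Z(1) OO by blast
    then have "N * card (orb G a) = ?r * card G"
      unfolding N_def by (rule card_transporters_to_image[OF Pr(1) vx(1)])
    then have "real (N * card ?O) = real (?r * card G)" unfolding OO by (rule arg_cong)
    then show ?thesis by (simp only: of_nat_mult)
  qed
  have Nsum: "(\<Sum>p\<in>Pr. card (\<G> p)) = N"
  proof -
    have "{g \<in> G. g a \<in> x ` Pr} = (\<Union>p\<in>Pr. \<G> p)" by (auto simp: \<G>_def)
    then show ?thesis unfolding N_def using Pr(1) finite_G vx(1)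
      by (auto simp: \<G>_def inj_on_def intro!: card_UN_disjoint[symmetric])
  qed
  define \<phi> where "\<phi> y = (\<Sum>p\<in>Pr. card {g \<in> G. g a = x p \<and> g y \<in> moved (v p)})" for y
  have cO: "real (card ?O) > 0" using card_orb_pos by simp
  have Gpos: "real (card G) > 0" using finite_G id_mem card_gt_0_iff by fastforce
  have \<phi>: "8 * \<phi> y \<le> real N" if "y \<in> \<Omega>" "y \<notin> dep E a" for y
  proof -
    have "real (\<phi> y) * card ?O \<le> l * E * card G"
      unfolding \<phi>_def using sum_card_transporters_le[OF a\<Omega> that E Pr(1) vx(1) vl] OO by simp
    then have "8 * real (\<phi> y) * card ?O \<le> real (8 * l) * E * real (card G)" by simp
    also have "\<dots> \<le> real ?r * real (card G)" using r Gpos by (intro mult_right_mono) auto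
    also have "\<dots> = real N * card ?O" using NO by simp
    finally show ?thesis using cO by simp
  qed
  have \<phi>N: "\<phi> y \<le> N" for y
    unfolding \<phi>_def Nsum[symmetric] using finite_G by (intro sum_mono card_mono) (auto simp: \<G>_def)
  have sum_count: "(\<Sum>p\<in>Pr. \<Sum>g\<in>\<G> p. card (g ` ?S \<inter> moved (v p))) = (\<Sum>y\<in>?S. \<phi> y)"
  proof -
    have "card (g ` ?S \<inter> moved (v p)) = (\<Sum>y\<in>?S. if g y \<in> moved (v p) then 1 else 0)" if "g \<in> G" for g p
    proof -
      have "g ` ?S \<inter> moved (v p) = g ` {y \<in> ?S. g y \<in> moved (v p)}" by auto
      then have "card (g ` ?S \<inter> moved (v p)) = card {y \<in> ?S. g y \<in> moved (v p)}"
        using inj_mem[OF that] by (simp add: card_image inj_on_def)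
      also have "\<dots> = (\<Sum>y\<in>?S. if g y \<in> moved (v p) then 1 else 0)"
        using finM[OF S\<Omega>] by (simp flip: sum.inter_filter)
      finally show ?thesis .
    qed
    then have "(\<Sum>p\<in>Pr. \<Sum>g\<in>\<G> p. card (g ` ?S \<inter> moved (v p)))
        = (\<Sum>p\<in>Pr. \<Sum>g\<in>\<G> p. \<Sum>y\<in>?S. if g y \<in> moved (v p) then 1 else 0)"
      by (intro sum.cong refl) (simp add: \<G>_def)
    also have "\<dots> = (\<Sum>p\<in>Pr. \<Sum>y\<in>?S. \<Sum>g\<in>\<G> p. if g y \<in> moved (v p) then 1 else 0)"
      by (intro sum.cong refl sum.swap)
    also have "\<dots> = (\<Sum>y\<in>?S. \<Sum>p\<in>Pr. \<Sum>g\<in>\<G> p. if g y \<in> moved (v p) then 1 else 0)"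
      by (rule sum.swap)
    also have "\<dots> = (\<Sum>y\<in>?S. \<phi> y)"
    proof -
      have "(\<Sum>g\<in>\<G> p. if g y \<in> moved (v p) then 1 else 0) = card {g \<in> G. g a = x p \<and> g y \<in> moved (v p)}" for p y
      proof -
        have "finite (\<G> p)" using finite_G by (simp add: \<G>_def)
        then have "(\<Sum>g\<in>\<G> p. if g y \<in> moved (v p) then 1 else 0) = card {g \<in> \<G> p. g y \<in> moved (v p)}"
          by (simp flip: sum.inter_filter)
        also have "{g \<in> \<G> p. g y \<in> moved (v p)} = {g \<in> G. g a = x p \<and> g y \<in> moved (v p)}"
          by (auto simp: \<G>_def)
        finally show ?thesis .
      qed
      then show ?thesis by (simp add: \<phi>_def)
    qed
    finally show ?thesis .
  qed
  \<comment> \<open>\<open>key\<close> is summed over all \<open>p\<close> and all \<open>g\<close>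
    with \<open>g a = x p\<close>; the pairs for which \<open>v p\<close> moves \<open>g a'\<close>
    are exceptional and are counted with the trivial bound \<open>?s\<close>.\<close>
  have lower: "?s * N \<le> 3 * (\<Sum>y\<in>?S. \<phi> y) + ?s * \<phi> a'"
  proof -
    have "?s * N = (\<Sum>p\<in>Pr. \<Sum>g\<in>\<G> p. ?s)" by (simp flip: Nsum sum_distrib_right)
    also have "\<dots> \<le> (\<Sum>p\<in>Pr. \<Sum>g\<in>\<G> p. 3 * card (g ` ?S \<inter> moved (v p)) + (if g a' \<in> moved (v p) then ?s else 0))"
      using key by (intro sum_mono) (auto simp: \<G>_def intro: trans_le_add1)
    also have "\<dots> = 3 * (\<Sum>y\<in>?S. \<phi> y) + (\<Sum>p\<in>Pr. \<Sum>g\<in>\<G> p. if g a' \<in> moved (v p) then ?s else 0)"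
      by (simp add: sum.distrib flip: sum_distrib_left sum_count)
    also have "(\<Sum>p\<in>Pr. \<Sum>g\<in>\<G> p. if g a' \<in> moved (v p) then ?s else 0) = ?s * \<phi> a'"
    proof -
      have "(\<Sum>g\<in>\<G> p. if g a' \<in> moved (v p) then ?s else 0) = ?s * card {g \<in> G. g a = x p \<and> g a' \<in> moved (v p)}" for p
      proof -
        have "finite (\<G> p)" using finite_G by (simp add: \<G>_def)
        then have "(\<Sum>g\<in>\<G> p. if g a' \<in> moved (v p) then ?s else 0) = ?s * card {g \<in> \<G> p. g a' \<in> moved (v p)}"
          by (simp flip: sum.inter_filter)
        also have "{g \<in> \<G> p. g a' \<in> moved (v p)} = {g \<in> G. g a = x p \<and> g a' \<in> moved (v p)}"
          by (auto simp: \<G>_def)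
        finally show ?thesis .
      qed
      then show ?thesis by (simp add: \<phi>_def sum_distrib_left)
    qed
    finally show ?thesis .
  qed
  have "8 * real (\<Sum>y\<in>?S. \<phi> y) \<le> 8 * B * real N + ?s * real N"
  proof -
    have "real (\<Sum>y\<in>?S. \<phi> y) = (\<Sum>y\<in>?S \<inter> dep E a. real (\<phi> y)) + (\<Sum>y\<in>?S - dep E a. real (\<phi> y))"
      using sum.Int_Diff[OF finM[OF S\<Omega>], of "\<lambda>y. real (\<phi> y)" "dep E a"] by simp
    also have "(\<Sum>y\<in>?S \<inter> dep E a. real (\<phi> y)) \<le> (\<Sum>y\<in>?S \<inter> dep E a. real N)"
      using \<phi>N by (intro sum_mono) simp
    also have "\<dots> \<le> B * real N"
    proof -
      have "card (?S \<inter> dep E a) \<le> card (dep E a)" by (intro card_mono finM) (auto simp: dep_def)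
      also have "\<dots> \<le> B" using B a by blast
      finally show ?thesis by (simp add: mult_right_mono)
    qed
    also have "(\<Sum>y\<in>?S - dep E a. real (\<phi> y)) \<le> (\<Sum>y\<in>?S - dep E a. real N / 8)"
      using \<phi> S\<Omega> by (intro sum_mono) (auto simp: field_simps)
    also have "\<dots> \<le> ?s * (real N / 8)"
      using card_mono[OF finM[OF S\<Omega>], of "?S - dep E a"] by (simp add: mult_right_mono)
    finally show ?thesis by (simp add: algebra_simps)
  qed
  moreover have "8 * real (\<phi> a') \<le> real N" using \<phi>[OF a'] by simp
  then have "?s * (8 * real (\<phi> a')) \<le> ?s * real N" by (intro mult_left_mono) auto
  then have "8 * (?s * real (\<phi> a')) \<le> ?s * real N" by (simp only: mult.left_commute)
  moreover have "real ?s * N \<le> 3 * real (\<Sum>y\<in>?S. \<phi> y) + ?s * real (\<phi> a')"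
  proof -
    have "real (?s * N) \<le> real (3 * (\<Sum>y\<in>?S. \<phi> y) + ?s * \<phi> a')"
      using lower by (simp only: of_nat_le_iff)
    then show ?thesis by simp
  qed
  \<comment> \<open>Here \<open>q\<close> is \<open>?s * N\<close> and \<open>b\<close> is
    \<open>8 * B * N\<close>: each of the at most \<open>B\<close> dependent points contributes up
    to \<open>N\<close>, every other point at most an eighth of it. What remains is
    \<open>4 * ?s <= 24 * B\<close>, the origin of \<open>6 * B\<close>.\<close>
  moreover have "8 * q \<le> 3 * (b + q) + q" if "8 * A \<le> b + q" "8 * f \<le> q" "q \<le> 3 * A + f" for A b q f :: real
    using that by simp
  ultimately have "8 * (?s * real N) \<le> 3 * (8 * B * real N + ?s * real N) + ?s * real N"
    by blast
  then have "4 * real ?s * real N \<le> 24 * B * real N" by (simp add: algebra_simps)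
  moreover have "real N > 0"
  proof -
    have "?r > 0" using Pr by (simp add: card_gt_0_iff)
    then have "real N * card ?O > 0" using NO Gpos by simp
    then show ?thesis using cO by (simp add: zero_less_mult_iff)
  qed
  ultimately have "4 * real ?s \<le> 24 * B" by simp
  then have "?s \<le> 6 * B" by linarith
  with hG \<open>h \<noteq> id\<close> show ?thesis by blast
qed

end

text \<open>The potential \<open>\<Sum>\<^sub>y w(y) ln |orbit of y|\<close> measures how much information about a weighted random
  point is lost; a base is built by fixing points as long as each one is worth its weight.\<close>

lemma (in perm_group) ex_light_base:
  fixes w :: "'a \<Rightarrow> real" and E C C1 D :: real and B l :: nat
  assumes n: "card \<Omega> < 2 ^ l" "card \<Omega> \<ge> 2"
    and w: "\<And>y. y \<in> \<Omega> \<Longrightarrow> w y \<ge> 0" "\<And>g y. g \<in> G \<Longrightarrow> y \<in> \<Omega> \<Longrightarrow> w (g y) = w y"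
    and C: "C > 0" and E: "E > 1" and C1: "C1 \<ge> 1" "C * ln (card \<Omega>) = C1 * ln E"
    and Pr: "finite Pr" "Pr \<noteq> {}" "\<And>p. p \<in> Pr \<Longrightarrow> prime p \<and> p > B"
    and r: "8 * l * E \<le> card Pr"
    and B: "C1\<^sup>2 < B + 1"
    and D: "E * (C1 * (l * \<Sum>Pr)) \<le> D" "D \<ge> 1"
    and min: "\<And>h. h \<in> G \<Longrightarrow> h \<noteq> id \<Longrightarrow> card (moved h) > 6 * B"
  shows "\<exists>X. X \<subseteq> \<Omega> \<and> C * sum w X \<le> sum w \<Omega> \<and> (\<forall>y\<in>\<Omega>. card (orb (fixer G X) y) \<le> D)"
proof -
  define o' where "o' X y = real (card (orb (fixer G X) y))" for X y
  define \<Psi> where "\<Psi> X = (\<Sum>y\<in>\<Omega>. w y * ln (o' X y))" for X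
  define L where "L = ln (real (card \<Omega>))"
  have L: "L > 0" using n by (simp add: L_def)
  have lnE: "ln E > 0" using E by simp
  have CL: "C * L = C1 * ln E" using C1 by (simp add: L_def)
  have o1: "o' X y \<ge> 1" for X y
  proof -
    have "card (orb (fixer G X) y) > 0" by (rule perm_group.card_orb_pos[OF fixer_perm_group])
    then show ?thesis by (simp add: o'_def)
  qed
  have o_mono: "o' Y y \<le> o' X y" if "X \<subseteq> Y" for X Y y
    unfolding o'_def using orb_fixer_mono[OF that] perm_group.finite_orb[OF fixer_perm_group]
    by (intro of_nat_mono card_mono) auto
  have on: "o' X y \<le> card \<Omega>" if "y \<in> \<Omega>" for X y
    unfolding o'_def using perm_group.orb_subset[OF fixer_perm_group that] finite_\<Omega>
    by (intro of_nat_mono card_mono) auto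
  define P where "P X \<longleftrightarrow> X \<subseteq> \<Omega> \<and> C * L * sum w X \<le> \<Psi> {} - \<Psi> X" for X
  have "P {}" by (simp add: P_def)
  moreover have "card X < Suc (card \<Omega>)" if "P X" for X
    using that finite_\<Omega> by (auto simp: P_def less_Suc_eq_le intro: card_mono)
  ultimately obtain X where X: "P X" "\<And>Y. P Y \<Longrightarrow> card Y \<le> card X"
    using ex_has_greatest_nat[of P "{}" card] by blast
  have X\<Omega>: "X \<subseteq> \<Omega>" using X(1) by (simp add: P_def)
  have finX: "finite X" using X\<Omega> finite_\<Omega> finite_subset by blast
  \<comment> \<open>Maximality of \<open>X\<close>: a disjoint set would have been adjoined if its
    gain in potential covered the price \<open>C * L\<close> per unit of weight.\<close>
  have stuck: "\<Psi> X - \<Psi> (X \<union> Y) < C * L * sum w Y" if Y: "Y \<subseteq> \<Omega>" "Y \<inter> X = {}" "Y \<noteq> {}" for Y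
  proof (rule ccontr)
    assume "\<not> ?thesis"
    moreover have finY: "finite Y" using Y(1) finite_\<Omega> finite_subset by blast
    moreover have "sum w (X \<union> Y) = sum w X + sum w Y" using finX finY Y by (intro sum.union_disjoint) auto
    ultimately have "P (X \<union> Y)" using X(1) Y by (auto simp: P_def algebra_simps)
    then have "card (X \<union> Y) \<le> card X" by (rule X(2))
    moreover have "card (X \<union> Y) = card X + card Y" using finX finY Y by (intro card_Un_disjoint) auto
    ultimately show False using Y finY by simp
  qed
  have \<Psi>_diff: "ln E * sum w W \<le> \<Psi> X - \<Psi> (X \<union> Y)"
    if W: "W \<subseteq> \<Omega>" "\<And>y. y \<in> W \<Longrightarrow> E * o' (X \<union> Y) y < o' X y" for W Y
  proof -
    have "ln E * sum w W = (\<Sum>y\<in>W. w y * ln E)" by (simp add: sum_distrib_left mult.commute)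
    also have "\<dots> \<le> (\<Sum>y\<in>W. w y * (ln (o' X y) - ln (o' (X \<union> Y) y)))"
    proof (intro sum_mono mult_left_mono)
      fix y assume y: "y \<in> W"
      have "ln E + ln (o' (X \<union> Y) y) = ln (E * o' (X \<union> Y) y)"
        using o1[of "X \<union> Y" y] E by (simp add: ln_mult)
      also have "\<dots> \<le> ln (o' X y)"
        using W(2)[OF y] o1[of "X \<union> Y" y] E by (intro ln_mono) auto
      finally show "ln E \<le> ln (o' X y) - ln (o' (X \<union> Y) y)" by simp
    qed (use W w in auto)
    also have "\<dots> \<le> (\<Sum>y\<in>\<Omega>. w y * (ln (o' X y) - ln (o' (X \<union> Y) y)))"
    proof (intro sum_mono2 finite_\<Omega> W(1) mult_nonneg_nonneg)
      fix y
      have "ln (o' (X \<union> Y) y) \<le> ln (o' X y)"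
        using o_mono[of X "X \<union> Y" y] o1[of "X \<union> Y" y] by (intro ln_mono) auto
      then show "0 \<le> ln (o' X y) - ln (o' (X \<union> Y) y)" by simp
    qed (use w in auto)
    also have "\<dots> = \<Psi> X - \<Psi> (X \<union> Y)" by (simp add: \<Psi>_def right_diff_distrib sum_subtractf)
    finally show ?thesis .
  qed
  \<comment> \<open>A point whose orbit shrinks by more than \<open>E\<close> gains
    \<open>ln E\<close> times its weight, and \<open>C1\<close> is exactly the ratio of the price
    \<open>C * L\<close> to \<open>ln E\<close>.\<close>
  have light: "C1 * sum w Y \<ge> sum w W"
    if "Y \<subseteq> \<Omega>" "Y \<inter> X = {}" "Y \<noteq> {}" "W \<subseteq> \<Omega>" "\<And>y. y \<in> W \<Longrightarrow> E * o' (X \<union> Y) y < o' X y" for W Y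
  proof -
    have "ln E * sum w W \<le> C * L * sum w Y" using stuck[OF that(1-3)] \<Psi>_diff[OF that(4,5)] by simp
    then have "ln E * sum w W \<le> ln E * (C1 * sum w Y)" by (simp add: CL algebra_simps)
    then show ?thesis using lnE by simp
  qed
  \<comment> \<open>A point of weight zero costs nothing and would already belong to
    \<open>X\<close>.\<close>
  have wpos: "w a > 0" if "a \<in> \<Omega>" "a \<notin> X" for a
  proof -
    have "0 \<le> \<Psi> X - \<Psi> (X \<union> {a})" using \<Psi>_diff[of "{}" "{a}"] by simp
    also have "\<dots> < C * L * sum w {a}" using stuck[of "{a}"] that by auto
    finally have "0 < C * L * w a" by simp
    moreover have "0 < C * L" using C L by simp
    ultimately show ?thesis by (rule zero_less_mult_pos)
  qed
  have "C * sum w X \<le> sum w \<Omega>"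
  proof -
    have "\<Psi> X \<ge> 0" unfolding \<Psi>_def using w o1 by (intro sum_nonneg mult_nonneg_nonneg) auto
    moreover have "\<Psi> {} \<le> (\<Sum>y\<in>\<Omega>. w y * L)"
      unfolding \<Psi>_def L_def
    proof (intro sum_mono mult_left_mono)
      fix y assume "y \<in> \<Omega>"
      then show "ln (o' {} y) \<le> ln (real (card \<Omega>))" using o1[of "{}" y] on by (intro ln_mono) auto
    qed (use w in auto)
    ultimately have "C * L * sum w X \<le> sum w \<Omega> * L"
      using X(1) by (simp add: P_def sum_distrib_right)
    then have "L * (C * sum w X) \<le> L * sum w \<Omega>" by (simp add: algebra_simps)
    then show ?thesis using L by simp
  qed
  moreover have "card (orb (fixer G X) y0) \<le> D" if y0: "y0 \<in> \<Omega>" for y0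
  proof (rule ccontr)
    assume *: "\<not> ?thesis"
    interpret K: perm_group \<Omega> "fixer G X" by (rule fixer_perm_group)
    let ?O = "orb (fixer G X) y0"
    have OX: "a \<in> \<Omega>" "a \<notin> X" "w a = w y0" "orb (fixer G X) a = ?O" if a: "a \<in> ?O" for a
    proof -
      show "a \<in> \<Omega>" using K.orb_subset[OF y0] a by blast
      show oa: "orb (fixer G X) a = ?O" using K.orb_eq[OF a] .
      show "a \<notin> X"
      proof
        assume "a \<in> X"
        then have "orb (fixer G X) a = {a}" by (intro K.orb_eq_singleton) (auto simp: fixer_def)
        then show False using oa * D(2) by simp
      qed
      show "w a = w y0" using a w(2) y0 by (auto simp: orb_def fixer_def)
    qed
    \<comment> \<open>\<open>ex_small_moved\<close> is applied to the stabiliser of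
      \<open>X\<close>. The weight is constant on the long orbit, so the inequalities between
      weights in \<open>light\<close> become inequalities between cardinalities.\<close>
    have "\<exists>h\<in>fixer G X. h \<noteq> id \<and> card (moved h) \<le> 6 * B"
    proof (rule K.ex_small_moved[OF n(1) y0 _ C1(1) Pr r])
      show "E * (C1 * real (l * \<Sum>Pr)) < real (card ?O)" using * D(1) by linarith
    next
      fix Y assume Y: "Y \<subseteq> ?O"
      define W where "W = {y \<in> ?O. E * card (orb (fixer (fixer G X) Y) y) < card ?O}"
      have W: "W \<subseteq> ?O" by (auto simp: W_def)
      have finY: "finite Y" using Y K.finite_orb finite_subset by blast
      have "real (card W) \<le> C1 * card Y"
      proof (cases "Y = {}")
        case True
        have "W = {}"
        proof (rule equals0I)
          fix y assume "y \<in> W"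
          then have "E * card ?O < card ?O" using True OX(4) by (auto simp: W_def fixer_def)
          then show False using E mult_right_mono[of 1 E "real (card ?O)"] by linarith
        qed
        then show ?thesis using True by simp
      next
        case False
        have "sum w W \<le> C1 * sum w Y"
        proof (rule light)
          show "Y \<subseteq> \<Omega>" "Y \<inter> X = {}" "W \<subseteq> \<Omega>" using Y W OX by blast+
          show "E * o' (X \<union> Y) y < o' X y" if "y \<in> W" for y
            using that OX(4) by (simp add: W_def o'_def fixer_fixer)
        qed (rule False)
        moreover have "sum w W = card W * w y0" using W OX(3) by (simp add: subset_iff)
        moreover have "sum w Y = card Y * w y0" using Y OX(3) by (simp add: subset_iff)
        ultimately have "w y0 * card W \<le> w y0 * (C1 * card Y)" by (simp add: algebra_simps)
        moreover have "w y0 > 0" using wpos[OF y0] OX(2)[OF K.mem_orb_self] by simp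
        ultimately show ?thesis by simp
      qed
      then show "real (card {y \<in> ?O. E * card (orb (fixer (fixer G X) Y) y) < card ?O}) \<le> C1 * card Y"
        by (simp only: W_def)
    next
      fix a assume a: "a \<in> ?O"
      have dep_light: "sum w (K.dep E b) \<le> C1 * w b" if b: "b \<in> \<Omega>" "b \<notin> X" for b
      proof -
        have "sum w (K.dep E b) \<le> C1 * sum w {b}"
          using b by (intro light) (auto simp: K.dep_def o'_def fixer_fixer)
        then show ?thesis by simp
      qed
      have fin: "finite (K.dep E b)" for b using finite_\<Omega> by (simp add: K.dep_def)
      have a': "a \<in> \<Omega>" "a \<notin> X" using OX[OF a] by auto
      \<comment> \<open>By symmetry \<open>a\<close> depends on each \<open>y\<close> that depends
        on it, so such a \<open>y\<close> cannot be much lighter than \<open>a\<close>. This turns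
        the bound on the total weight of the dependent points into the bound
        \<open>C1\<^sup>2\<close> on their number.\<close>
      have "w a \<le> C1 * w y" if y: "y \<in> K.dep E a" for y
      proof -
        have y\<Omega>: "y \<in> \<Omega>" using y by (simp add: K.dep_def)
        have "y \<notin> X"
        proof
          assume "y \<in> X"
          then have "orb (fixer G X) y = {y}" by (intro K.orb_eq_singleton) (auto simp: fixer_def)
          moreover have "card (orb (fixer (fixer G X) {a}) y) > 0"
            by (rule perm_group.card_orb_pos[OF K.fixer_perm_group])
          ultimately have "E * card (orb (fixer (fixer G X) {a}) y) < 1 \<and> real (card (orb (fixer (fixer G X) {a}) y)) \<ge> 1"
            using y by (simp add: K.dep_def)
          then show False using E mult_mono[of 1 E 1 "real (card (orb (fixer (fixer G X) {a}) y))"] by linarith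
        qed
        have "a \<in> K.dep E y" using K.dep_sym[OF a'(1) y] .
        then have "w a \<le> sum w (K.dep E y)"
          using fin w(1) by (intro member_le_sum) (auto simp: K.dep_def)
        also have "\<dots> \<le> C1 * w y" by (rule dep_light[OF y\<Omega> \<open>y \<notin> X\<close>])
        finally show ?thesis .
      qed
      then have "(\<Sum>y\<in>K.dep E a. w a) \<le> (\<Sum>y\<in>K.dep E a. C1 * w y)" by (rule sum_mono)
      also have "\<dots> = C1 * sum w (K.dep E a)" by (simp add: sum_distrib_left)
      also have "\<dots> \<le> C1 * (C1 * w a)" using dep_light[OF a'] C1 by (intro mult_left_mono) auto
      finally have "w a * card (K.dep E a) \<le> w a * C1\<^sup>2" by (simp add: power2_eq_square algebra_simps)
      then have "real (card (K.dep E a)) \<le> C1\<^sup>2" using wpos[OF a'] by simp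
      then show "card (K.dep E a) \<le> B" using B by linarith
    qed (use E in auto)
    then show False using min by (fastforce simp: fixer_def)
  qed
  ultimately show ?thesis using X\<Omega> by blast
qed

text \<open>All primes between \<open>B\<close> and about \<open>2 * n powr (2 * \<eta>)\<close> are
  taken. By the Chebyshev bound their number exceeds \<open>n powr \<eta>\<close> times any power of
  a logarithm, while their sum is of order at most \<open>n powr (4 * \<eta>)\<close>; one more
  factor \<open>n powr \<eta>\<close> and the logarithms stay below
  \<open>n powr (6 * \<eta>)\<close>.\<close>

lemma many_primes_eventually:
  fixes \<eta> C1 :: real and B :: nat
  assumes \<eta>: "\<eta> > 0" and C1: "C1 > 0"
  shows "\<forall>\<^sub>F n in sequentially. \<exists>l Pr. n < 2 ^ l \<and> finite Pr \<and> Pr \<noteq> {} \<and>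
    (\<forall>p\<in>Pr. prime p \<and> p > B) \<and> 8 * real l * real n powr \<eta> \<le> card Pr \<and>
    real n powr \<eta> * (C1 * real (l * \<Sum>Pr)) \<le> real n powr (6 * \<eta>)"
proof -
  have e1: "\<forall>\<^sub>F x in at_top. 8 * (log 2 x + 1) * x powr \<eta> + B \<le> x powr (2 * \<eta>) * ln 4 / ln (2 * x powr (2 * \<eta>) + 3)"
    using \<eta> by real_asymp
  have e2: "\<forall>\<^sub>F x in at_top. x powr \<eta> * (C1 * ((log 2 x + 1) * ((2 * x powr (2 * \<eta>) + 3) * (2 * x powr (2 * \<eta>) + 4)))) \<le> x powr (6 * \<eta>)"
    using \<eta> by real_asymp
  have "\<forall>\<^sub>F n in sequentially. n \<ge> (2::nat)" by (rule eventually_ge_at_top)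
  then show ?thesis
    using eventually_compose_filterlim[OF e1 filterlim_real_sequentially]
      eventually_compose_filterlim[OF e2 filterlim_real_sequentially]
  proof eventually_elim
    case (elim n)
    define x where "x = real n"
    define N where "N = nat \<lceil>x powr (2 * \<eta>)\<rceil>"
    define l where "l = nat \<lfloor>log 2 x\<rfloor> + 1"
    define Pr where "Pr = {p. prime p \<and> p \<le> 2 * N + 1 \<and> p > B}"
    have x2: "x \<ge> 2" using elim(1) by (simp add: x_def)
    have lx: "log 2 x \<ge> 0" using x2 by simp
    have l: "real l \<le> log 2 x + 1" "log 2 x < real l" using lx unfolding l_def by linarith+
    have "x = 2 powr (log 2 x)" using x2 by simp
    also have "\<dots> < 2 powr real l" using l by simp
    also have "\<dots> = real (2 ^ l)" by (simp add: powr_realpow)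
    finally have nl: "n < 2 ^ l" unfolding x_def by (simp only: of_nat_less_iff)
    define X where "X = x powr (2 * \<eta>)"
    have X: "X \<ge> 1" using x2 \<eta> by (simp add: X_def ge_one_powr_ge_zero)
    have N: "X \<le> real N" "real N \<le> X + 1" using X unfolding N_def X_def by linarith+
    then have "N \<ge> 1" using X by linarith
    define M where "M = 2 * N + 1"
    let ?pi = "card {p. prime p \<and> p \<le> M}"
    have M: "real M = 2 * real N + 1" by (simp add: M_def)
    have "4 ^ N \<le> M ^ ?pi"
      unfolding M_def using prime_count_lower_bound[OF \<open>N \<ge> 1\<close>] .
    then have "real (4 ^ N) \<le> real (M ^ ?pi)" by (simp only: of_nat_le_iff)
    then have "ln (real (4 ^ N)) \<le> ln (real (M ^ ?pi))" by (intro ln_mono) auto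
    then have "N * ln 4 \<le> ?pi * ln (real M)"
      using M by (simp add: ln_realpow)
    moreover have lnM: "0 < ln (real M)" "ln (real M) \<le> ln (2 * X + 3)" using M N X by auto
    ultimately have "real N * ln 4 / ln (real M) \<le> ?pi" by (simp add: divide_le_eq)
    moreover have "X * ln 4 / ln (2 * X + 3) \<le> real N * ln 4 / ln (real M)"
      using N X lnM by (intro frac_le mult_right_mono) auto
    ultimately have pi: "8 * (log 2 x + 1) * x powr \<eta> + B \<le> ?pi"
      using elim(2) by (simp add: x_def X_def)
    have "{p. prime p \<and> p \<le> M} \<subseteq> Pr \<union> {1..B}" by (auto simp: Pr_def M_def dest: prime_ge_1_nat)
    then have "?pi \<le> card (Pr \<union> {1..B})" by (intro card_mono) (auto simp: Pr_def)
    also have "\<dots> \<le> card Pr + B" using card_Un_le[of Pr "{1..B}"] by simp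
    finally have "8 * (log 2 x + 1) * x powr \<eta> \<le> card Pr" using pi by linarith
    moreover have "8 * real l * x powr \<eta> \<le> 8 * (log 2 x + 1) * x powr \<eta>" using l by (intro mult_right_mono) auto
    ultimately have c: "8 * real l * x powr \<eta> \<le> card Pr" by linarith
    have "real l > 0" by (simp add: l_def)
    then have "0 < 8 * real l * x powr \<eta>" using x2 by simp
    with c have "Pr \<noteq> {}" by auto
    have finPr: "finite Pr" by (simp add: Pr_def)
    have "Pr \<subseteq> {..M}" by (auto simp: Pr_def M_def)
    have "\<Sum>Pr \<le> \<Sum>{..M}" using \<open>Pr \<subseteq> {..M}\<close> by (intro sum_mono2) auto
    also have "\<dots> \<le> M * Suc M" using sum_bounded_above[of "{..M}" "\<lambda>i. i" M] by simp
    finally have "real (\<Sum>Pr) \<le> real (M * Suc M)" by (simp only: of_nat_le_iff)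
    also have "\<dots> = (2 * real N + 1) * (2 * real N + 2)" by (simp add: M_def algebra_simps)
    also have "\<dots> \<le> (2 * X + 3) * (2 * X + 4)" using N X by (intro mult_mono) auto
    finally have s: "real (\<Sum>Pr) \<le> (2 * X + 3) * (2 * X + 4)" .
    have "real (l * \<Sum>Pr) = real l * real (\<Sum>Pr)" by simp
    also have "\<dots> \<le> (log 2 x + 1) * ((2 * X + 3) * (2 * X + 4))" using l s lx X by (intro mult_mono) (auto simp del: of_nat_sum)
    finally have "x powr \<eta> * (C1 * real (l * \<Sum>Pr)) \<le> x powr \<eta> * (C1 * ((log 2 x + 1) * ((2 * X + 3) * (2 * X + 4))))"
      using C1 by (intro mult_left_mono) auto
    also have "\<dots> \<le> x powr (6 * \<eta>)" using elim(3) by (simp only: x_def X_def)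
    finally have d: "x powr \<eta> * (C1 * real (l * \<Sum>Pr)) \<le> x powr (6 * \<eta>)" .
    show ?case
      using nl finPr \<open>Pr \<noteq> {}\<close> c d unfolding x_def
      by (intro exI[of _ l] exI[of _ Pr]) (simp add: Pr_def)
  qed
qed

text \<open>Because the shrinking factor \<open>E\<close> is a power of the degree,
  \<open>C1 = C / \<eta>\<close> is a constant, and so is the bound \<open>6 * B\<close> demanded of
  the minimal degree.\<close>

theorem light_base_eventually:
  fixes C \<delta> :: real
  assumes C: "C \<ge> 1" and \<delta>: "0 < \<delta>" "\<delta> \<le> 6"
  shows "\<exists>B n0. \<forall>(\<Omega> :: 'a set) G w. perm_group \<Omega> G \<longrightarrow> card \<Omega> \<ge> n0 \<longrightarrow>
    (\<forall>h\<in>G. h \<noteq> id \<longrightarrow> card (moved h) > B) \<longrightarrow> (\<forall>y\<in>\<Omega>. w y \<ge> 0) \<longrightarrow> (\<forall>g\<in>G. \<forall>y\<in>\<Omega>. w (g y) = w y) \<longrightarrow>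
    (\<exists>X. X \<subseteq> \<Omega> \<and> C * sum w X \<le> sum w \<Omega> \<and> (\<forall>y\<in>\<Omega>. card (orb (fixer G X) y) \<le> real (card \<Omega>) powr \<delta>))"
proof -
  define \<eta> where "\<eta> = \<delta> / 6"
  have \<eta>: "0 < \<eta>" "\<eta> \<le> 1" "\<delta> = 6 * \<eta>" using \<delta> by (auto simp: \<eta>_def)
  define C1 where "C1 = C / \<eta>"
  have C1: "C1 \<ge> 1" using C \<eta> by (simp add: C1_def field_simps)
  define B where "B = nat \<lfloor>C1\<^sup>2\<rfloor>"
  have B: "C1\<^sup>2 < B + 1" unfolding B_def by linarith
  have "C1 > 0" using C1 by simp
  from many_primes_eventually[OF \<eta>(1) this, of B] obtain n1 where n1: "\<And>n. n \<ge> n1 \<Longrightarrow>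
      \<exists>l Pr. n < 2 ^ l \<and> finite Pr \<and> Pr \<noteq> {} \<and>
    (\<forall>p\<in>Pr. prime p \<and> p > B) \<and> 8 * real l * real n powr \<eta> \<le> card Pr \<and>
    real n powr \<eta> * (C1 * real (l * \<Sum>Pr)) \<le> real n powr (6 * \<eta>)"
    unfolding eventually_sequentially by blast
  have main: "\<exists>X. X \<subseteq> \<Omega> \<and> C * sum w X \<le> sum w \<Omega> \<and> (\<forall>y\<in>\<Omega>. card (orb (fixer G X) y) \<le> real (card \<Omega>) powr \<delta>)"
    if G: "perm_group \<Omega> G" and n: "card \<Omega> \<ge> max n1 2" and min: "\<forall>h\<in>G. h \<noteq> id \<longrightarrow> card (moved h) > 6 * B"
      and w: "\<forall>y\<in>\<Omega>. w y \<ge> 0" "\<forall>g\<in>G. \<forall>y\<in>\<Omega>. w (g y) = w y" for \<Omega> :: "'a set" and G w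
  proof -
    define x where "x = real (card \<Omega>)"
    have x: "x \<ge> 2" using n by (simp add: x_def)
    obtain l Pr where lPr: "card \<Omega> < 2 ^ l" "finite Pr" "Pr \<noteq> {}" "\<And>p. p \<in> Pr \<Longrightarrow> prime p \<and> p > B"
        "8 * real l * x powr \<eta> \<le> card Pr" "x powr \<eta> * (C1 * real (l * \<Sum>Pr)) \<le> x powr (6 * \<eta>)"
      using n1[of "card \<Omega>"] n unfolding x_def by auto
    show ?thesis
    proof (rule perm_group.ex_light_base[OF G lPr(1), where E = "x powr \<eta>" and ?C1.0 = C1 and B = B and Pr = Pr])
      show "2 \<le> card \<Omega>" using n by simp
      show "C * ln (real (card \<Omega>)) = C1 * ln (x powr \<eta>)"
        using \<eta> x by (simp add: C1_def x_def ln_powr)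
      show "1 < x powr \<eta>" using x \<eta> by simp
      show "1 \<le> real (card \<Omega>) powr \<delta>" using n \<delta> by (intro ge_one_powr_ge_zero) auto
      show "x powr \<eta> * (C1 * real (l * \<Sum>Pr)) \<le> real (card \<Omega>) powr \<delta>"
        using lPr(6) by (simp only: \<eta>(3) x_def)
      show "real (8 * l) * x powr \<eta> \<le> real (card Pr)" using lPr(5) by simp
    qed (use C C1 B lPr min w in auto)
  qed
  show ?thesis
    by (rule exI[of _ "6 * B"], rule exI[of _ "max n1 2"], intro allI impI, rule main)
qed

section \<open>Elementary counting\<close>

lemma card_small_subsets_le:
  assumes "finite S"
  shows "finite {A. A \<subseteq> S \<and> card A \<le> e} \<and> card {A. A \<subseteq> S \<and> card A \<le> e} \<le> (card S + 1) ^ e"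
proof (induction e)
  case 0
  have "A = {}" if "A \<subseteq> S" "card A \<le> 0" for A
    using that finite_subset[OF that(1) assms] by simp
  then have "{A. A \<subseteq> S \<and> card A \<le> 0} = {{}}" by auto
  then show ?case by simp
next
  case (Suc e)
  let ?P = "\<lambda>e. {A. A \<subseteq> S \<and> card A \<le> e}"
  have sub: "?P (Suc e) \<subseteq> ?P e \<union> (\<lambda>(x, A). insert x A) ` (S \<times> ?P e)"
  proof
    fix A assume A: "A \<in> ?P (Suc e)"
    show "A \<in> ?P e \<union> (\<lambda>(x, A). insert x A) ` (S \<times> ?P e)"
    proof (cases "A = {}")
      case False
      then obtain x where x: "x \<in> A" by blast
      have "finite A" using A assms finite_subset by auto
      then have "card (A - {x}) \<le> e" using A x by (simp add: le_diff_conv)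
      then have "(x, A - {x}) \<in> S \<times> ?P e" using A x by auto
      moreover have "A = (\<lambda>(x, A). insert x A) (x, A - {x})" using x by auto
      ultimately show ?thesis by blast
    qed auto
  qed
  have fin: "finite (?P e)" "finite (S \<times> ?P e)" using Suc.IH assms by auto
  have "card (?P (Suc e)) \<le> card (?P e \<union> (\<lambda>(x, A). insert x A) ` (S \<times> ?P e))"
    using fin by (intro card_mono sub) auto
  also have "\<dots> \<le> card (?P e) + card ((\<lambda>(x, A). insert x A) ` (S \<times> ?P e))" by (rule card_Un_le)
  also have "\<dots> \<le> card (?P e) + card (S \<times> ?P e)" using card_image_le[OF fin(2)] by simp
  also have "\<dots> = (card S + 1) * card (?P e)" by (simp add: card_cartesian_product)
  also have "\<dots> \<le> (card S + 1) * (card S + 1) ^ e" using Suc.IH by (intro mult_left_mono) auto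
  finally have c: "card (?P (Suc e)) \<le> (card S + 1) * (card S + 1) ^ e" .
  have "finite (?P (Suc e))" by (rule finite_subset[OF sub]) (intro finite_UnI finite_imageI fin)
  then show ?case using c unfolding power_Suc by (rule conjI)
qed

lemma card_le_fibres:
  fixes b :: real
  assumes "finite F" "\<And>\<gamma>. \<gamma> \<in> f ` F \<Longrightarrow> card {h \<in> F. f h = \<gamma>} \<le> b"
  shows "card F \<le> card (f ` F) * b"
proof -
  have "F = (\<Union>\<gamma>\<in>f ` F. {h \<in> F. f h = \<gamma>})" by auto
  then have "card F = card (\<Union>\<gamma>\<in>f ` F. {h \<in> F. f h = \<gamma>})" by (rule arg_cong)
  also have "\<dots> \<le> (\<Sum>\<gamma>\<in>f ` F. card {h \<in> F. f h = \<gamma>})" using assms(1) by (intro card_UN_le) simp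
  finally have "real (card F) \<le> real (\<Sum>\<gamma>\<in>f ` F. card {h \<in> F. f h = \<gamma>})" by (simp only: of_nat_le_iff)
  also have "\<dots> = (\<Sum>\<gamma>\<in>f ` F. real (card {h \<in> F. f h = \<gamma>}))" by simp
  also have "\<dots> \<le> (\<Sum>\<gamma>\<in>f ` F. b)" using assms(2) by (intro sum_mono) auto
  finally show ?thesis by simp
qed

section \<open>Counting elements of large degree\<close>

text \<open>\<open>R\<close> meets every nontrivial cycle of \<open>h\<close>; invariant sets take
  the place of a cycle decomposition.\<close>

definition meets_cycles :: "('a \<Rightarrow> 'a) \<Rightarrow> 'a set \<Rightarrow> bool"
  where "meets_cycles h R \<longleftrightarrow> (\<forall>Q. Q \<subseteq> moved h \<and> Q \<noteq> {} \<and> h ` Q = Q \<longrightarrow> Q \<inter> R \<noteq> {})"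

text \<open>One point per cycle suffices, and nontrivial cycles have at least two points. A smallest
  nonempty invariant set serves as a cycle and is split off.\<close>

lemma ex_half_transversal_aux:
  assumes "finite S" "inj h" "h ` S = S" "\<And>x. x \<in> S \<Longrightarrow> h x \<noteq> x"
  shows "\<exists>R\<subseteq>S. 2 * card R \<le> card S \<and> (\<forall>Q. Q \<subseteq> S \<and> Q \<noteq> {} \<and> h ` Q = Q \<longrightarrow> Q \<inter> R \<noteq> {})"
  using assms
proof (induction S rule: finite_psubset_induct)
  case (psubset S)
  show ?case
  proof (cases "S = {}")
    case True then show ?thesis by (intro exI[of _ "{}"]) auto
  next
    case False
    let ?c = "\<lambda>Q. Q \<subseteq> S \<and> Q \<noteq> {} \<and> h ` Q = Q"
    obtain Q0 where Q0: "?c Q0" "\<And>Q. ?c Q \<Longrightarrow> card Q0 \<le> card Q"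
      using ex_has_least_nat[of ?c S card] psubset.prems(2) False by blast
    then obtain x where x: "x \<in> Q0" by blast
    have fin0: "finite Q0" using Q0(1) psubset.hyps by (auto intro: finite_subset)
    have Q0h: "h ` Q0 = Q0" using Q0(1) by simp
    have inj: "h ` (A \<inter> B) = h ` A \<inter> h ` B" "h ` (A - B) = h ` A - h ` B" for A B
      using psubset.prems(1) by (auto simp: image_Int image_set_diff)
    have sub: "S - Q0 \<subset> S" using Q0(1) by blast
    have hS: "h ` (S - Q0) = S - Q0" by (simp only: inj(2) Q0h psubset.prems(2))
    have "\<exists>R\<subseteq>S - Q0. 2 * card R \<le> card (S - Q0) \<and>
        (\<forall>Q. Q \<subseteq> S - Q0 \<and> Q \<noteq> {} \<and> h ` Q = Q \<longrightarrow> Q \<inter> R \<noteq> {})"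
      by (rule psubset.IH[OF sub psubset.prems(1) hS]) (use psubset.prems(3) in blast)
    then obtain R where R0: "R \<subseteq> S - Q0 \<and> 2 * card R \<le> card (S - Q0) \<and>
        (\<forall>Q. Q \<subseteq> S - Q0 \<and> Q \<noteq> {} \<and> h ` Q = Q \<longrightarrow> Q \<inter> R \<noteq> {})" ..
    then have R: "R \<subseteq> S - Q0" "2 * card R \<le> card (S - Q0)" by simp_all
    have Rhit: "Q \<inter> R \<noteq> {}" if "Q \<subseteq> S - Q0" "Q \<noteq> {}" "h ` Q = Q" for Q
      using R0 that by simp
    have "h x \<in> h ` Q0" using x by (rule imageI)
    then have "{x, h x} \<subseteq> Q0" using x unfolding Q0h by simp
    then have "card {x, h x} \<le> card Q0" using fin0 by (rule card_mono[rotated])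
    moreover have "card {x, h x} = 2" using psubset.prems(3)[of x] x Q0(1) by auto
    moreover have "card S = card (S - Q0) + card Q0"
    proof -
      have "Q0 \<subseteq> S" using Q0(1) by simp
      then show ?thesis using card_Diff_subset[OF fin0] card_mono[OF psubset.hyps] by simp
    qed
    moreover have "card (insert x R) \<le> Suc (card R)" by (rule card_insert_le_m1) auto
    ultimately have "2 * card (insert x R) \<le> card S" using R(2) by linarith
    moreover have "Q \<inter> insert x R \<noteq> {}" if Q: "?c Q" for Q
    proof (cases "Q \<inter> Q0 = {}")
      case True
      then have "Q \<subseteq> S - Q0" using Q by auto
      then have "Q \<inter> R \<noteq> {}" using Q by (intro Rhit) simp_all
      then show ?thesis by blast
    next
      case False
      have "h ` (Q \<inter> Q0) = Q \<inter> Q0" using Q by (simp only: inj(1) Q0h)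
      have "card Q0 \<le> card (Q \<inter> Q0)"
        by (rule Q0(2)) (use Q False in \<open>auto simp: inj(1) Q0h\<close>)
      then have "Q \<inter> Q0 = Q0" using fin0 card_seteq[of Q0 "Q \<inter> Q0"] by blast
      then show ?thesis using x by blast
    qed
    moreover have "insert x R \<subseteq> S" using x Q0(1) R(1) by auto
    ultimately show ?thesis by (intro exI[of _ "insert x R"]) simp
  qed
qed

lemma image_eq_self: "finite A \<Longrightarrow> inj h \<Longrightarrow> h ` A \<subseteq> A \<Longrightarrow> h ` A = A"
  by (rule endo_inj_surj) (auto intro: inj_on_subset)

lemma image_moved:
  assumes "inj h" "finite (moved h)" shows "h ` moved h = moved h"
  using assms(2,1)
proof (rule image_eq_self)
  show "h ` moved h \<subseteq> moved h" using assms(1) by (auto simp: moved_def inj_def)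
qed

lemma ex_half_transversal:
  assumes h: "h permutes \<Omega>" "finite \<Omega>"
  shows "\<exists>R\<subseteq>moved h. card R = card (moved h) div 2 \<and> meets_cycles h R"
proof -
  have inj: "inj h" using h permutes_inj by blast
  have fin: "finite (moved h)" using h permutes_altdef[of h \<Omega>] finite_subset by (auto simp: moved_def)
  obtain R where "R \<subseteq> moved h \<and> 2 * card R \<le> card (moved h) \<and> (\<forall>Q. Q \<subseteq> moved h \<and> Q \<noteq> {} \<and> h ` Q = Q \<longrightarrow> Q \<inter> R \<noteq> {})"
    using ex_half_transversal_aux[OF fin inj image_moved[OF inj fin]] by (auto simp: moved_def)
  then have R: "R \<subseteq> moved h" "2 * card R \<le> card (moved h)" "meets_cycles h R"
    by (simp_all add: meets_cycles_def)
  have "card R \<le> card (moved h) div 2" using R(2) by linarith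
  \<comment> \<open>Padded to exactly half of the support, so that the possible transversals are
    counted by a single binomial coefficient.\<close>
  then obtain B where B: "R \<subseteq> B" "B \<subseteq> moved h" "card B = card (moved h) div 2"
    using exists_subset_between[OF _ _ R(1) fin, of "card (moved h) div 2"] by auto
  moreover have "meets_cycles h B" unfolding meets_cycles_def
  proof (intro allI impI)
    fix Q assume "Q \<subseteq> moved h \<and> Q \<noteq> {} \<and> h ` Q = Q"
    then have "Q \<inter> R \<noteq> {}" by (rule R(3)[unfolded meets_cycles_def, rule_format])
    then show "Q \<inter> B \<noteq> {}" using B(1) by auto
  qed
  ultimately show ?thesis using B by (intro exI[of _ B]) simp
qed

text \<open>The permutation is revealed point by point. The next query is a point of
  \<open>R\<close> or the image of a queried point; both are known in advance to be moved, and each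
  query has at most \<open>D\<close> answers. If no query is left, the queried points are a union of
  cycles containing \<open>R\<close>, hence the whole support.\<close>

lemma card_restricted_perms_aux:
  fixes D :: real
  assumes F: "finite F" "\<And>h. h \<in> F \<Longrightarrow> inj h \<and> finite (moved h) \<and> card (moved h) = k"
    and R: "\<And>h. h \<in> F \<Longrightarrow> R \<subseteq> moved h \<and> meets_cycles h R"
    and A: "\<And>h y. h \<in> F \<Longrightarrow> h y \<in> A y" "\<And>y. finite (A y)" "\<And>y. card (A y) \<le> D" and D: "D \<ge> 1"
    and "card Q + j = k"
  shows "card {h \<in> F. Q \<subseteq> moved h \<and> (\<forall>x\<in>Q. h x = q x)} \<le> D ^ j"
  using assms(8)
proof (induction j arbitrary: Q q)
  case (0 Q q)
  have "h = h'" if "h \<in> {h \<in> F. Q \<subseteq> moved h \<and> (\<forall>x\<in>Q. h x = q x)}" "h' \<in> {h \<in> F. Q \<subseteq> moved h \<and> (\<forall>x\<in>Q. h x = q x)}" for h h'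
  proof
    fix x
    have "Q = moved k'" if "k' \<in> {h \<in> F. Q \<subseteq> moved h \<and> (\<forall>x\<in>Q. h x = q x)}" for k'
      using that F(2)[of k'] 0 by (intro card_subset_eq) auto
    then have "Q = moved h" "Q = moved h'" using that by blast+
    then show "h x = h' x" using that by (cases "x \<in> Q") (auto simp: moved_def)
  qed
  then have "card {h \<in> F. Q \<subseteq> moved h \<and> (\<forall>x\<in>Q. h x = q x)} \<le> 1"
    using card_le_Suc0_iff_eq[of "{h \<in> F. Q \<subseteq> moved h \<and> (\<forall>x\<in>Q. h x = q x)}"] F(1) by auto
  then show ?case by simp
next
  case (Suc j Q q)
  let ?F = "\<lambda>Q q. {h \<in> F. Q \<subseteq> moved h \<and> (\<forall>x\<in>Q. h x = q x)}"
  show ?case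
  proof (cases "?F Q q = {}")
    case True then show ?thesis using D by (simp only: card.empty) simp
  next
    case False
    then obtain h1 where h1: "h1 \<in> ?F Q q" by blast
    have "\<exists>y. y \<notin> Q \<and> (\<forall>h\<in>?F Q q. y \<in> moved h)"
    proof (cases "R \<subseteq> Q \<and> q ` Q \<subseteq> Q")
      case False
      then consider y where "y \<in> R" "y \<notin> Q" | x where "x \<in> Q" "q x \<notin> Q" by blast
      then show ?thesis
      proof cases
        case 1 then show ?thesis using R by blast
      next
        case (2 x)
        have "q x \<in> moved h" if h: "h \<in> ?F Q q" for h
        proof -
          have "h x \<noteq> x" "h x = q x" "inj h" using h 2 F(2) by (auto simp: moved_def)
          then show ?thesis by (metis (mono_tags) inj_eq mem_Collect_eq moved_def)
        qed
        then show ?thesis using 2 by blast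
      qed
    next
      case True
      have finm: "finite (moved h1)" "inj h1" "card (moved h1) = k" using h1 F(2) by auto
      have QS: "Q \<subseteq> moved h1" "\<And>x. x \<in> Q \<Longrightarrow> h1 x = q x" using h1 by auto
      have finQ: "finite Q" using QS finm finite_subset by blast
      have "h1 ` Q \<subseteq> Q" using True QS by auto
      then have Qc: "h1 ` Q = Q" by (rule image_eq_self[OF finQ finm(2)])
      have "h1 ` (moved h1 - Q) = moved h1 - Q"
        by (simp only: Qc image_set_diff[OF finm(2)] image_moved[OF finm(2,1)])
      moreover have "meets_cycles h1 R" using R h1 by blast
      ultimately have "moved h1 - Q \<noteq> {} \<Longrightarrow> (moved h1 - Q) \<inter> R \<noteq> {}"
        unfolding meets_cycles_def by simp
      then have "moved h1 - Q = {}" using True by blast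
      then have "card Q = k" using QS finm by (metis Diff_eq_empty_iff subset_antisym)
      then show ?thesis using Suc.prems by simp
    qed
    then obtain y where y: "y \<notin> Q" "\<And>h. h \<in> ?F Q q \<Longrightarrow> y \<in> moved h" by blast
    have finQ: "finite Q" using h1 F(2) finite_subset by blast
    have sub: "?F Q q \<subseteq> (\<Union>z\<in>A y. ?F (insert y Q) (q(y := z)))"
    proof
      fix h assume h: "h \<in> ?F Q q"
      then have "h \<in> ?F (insert y Q) (q(y := h y))" using y by auto
      moreover have "h y \<in> A y" using h A(1) by blast
      ultimately show "h \<in> (\<Union>z\<in>A y. ?F (insert y Q) (q(y := z)))" by blast
    qed
    have "card (?F Q q) \<le> card (\<Union>z\<in>A y. ?F (insert y Q) (q(y := z)))"
      using A(2) F(1) by (intro card_mono sub) auto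
    also have "\<dots> \<le> (\<Sum>z\<in>A y. card (?F (insert y Q) (q(y := z))))" by (rule card_UN_le[OF A(2)])
    finally have "real (card (?F Q q)) \<le> real (\<Sum>z\<in>A y. card (?F (insert y Q) (q(y := z))))"
      by (simp only: of_nat_le_iff)
    also have "\<dots> = (\<Sum>z\<in>A y. real (card (?F (insert y Q) (q(y := z)))))" by (rule of_nat_sum)
    also have "\<dots> \<le> (\<Sum>z\<in>A y. D ^ j)"
    proof (rule sum_mono)
      fix z
      have "card (insert y Q) + j = k" using Suc.prems y(1) finQ by simp
      then show "real (card (?F (insert y Q) (q(y := z)))) \<le> D ^ j" by (rule Suc.IH)
    qed
    also have "\<dots> \<le> D * D ^ j" using A(3)[of y] D by (simp add: mult_right_mono)
    finally show ?thesis by (simp only: power_Suc)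
  qed
qed

lemma card_restricted_perms:
  fixes D :: real
  assumes \<Omega>: "finite \<Omega>" and F: "\<And>h. h \<in> F \<Longrightarrow> h permutes \<Omega> \<and> card (moved h) = k"
    and A: "\<And>h y. h \<in> F \<Longrightarrow> h y \<in> A y" "\<And>y. finite (A y)" "\<And>y. card (A y) \<le> D" and D: "D \<ge> 1"
  shows "card F \<le> (card \<Omega> choose (k div 2)) * D ^ k"
proof -
  have finF: "finite F" using finite_subset[OF _ finite_permutations[OF \<Omega>]] F by blast
  have mv: "moved h \<subseteq> \<Omega>" "finite (moved h)" "inj h" if "h \<in> F" for h
  proof -
    show "moved h \<subseteq> \<Omega>" using F[OF that] by (auto simp: moved_def permutes_def)
    then show "finite (moved h)" using \<Omega> finite_subset by blast
    show "inj h" using F[OF that] permutes_inj by blast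
  qed
  have "\<forall>h\<in>F. \<exists>R. R \<subseteq> moved h \<and> card R = k div 2 \<and> meets_cycles h R"
    using ex_half_transversal[OF _ \<Omega>] F by blast
  then obtain R where R: "\<And>h. h \<in> F \<Longrightarrow> R h \<subseteq> moved h \<and> card (R h) = k div 2 \<and> meets_cycles h (R h)"
    by metis
  have "card F \<le> card (R ` F) * D ^ k"
  proof (rule card_le_fibres[OF finF])
    fix \<gamma> assume "\<gamma> \<in> R ` F"
    let ?F = "{h \<in> F. R h = \<gamma>}"
    have "card {h \<in> ?F. {} \<subseteq> moved h \<and> (\<forall>x\<in>{}. h x = id x)} \<le> D ^ k"
      by (rule card_restricted_perms_aux[where R = \<gamma> and A = A and k = k]) (use finF F R A D mv in auto)
    then show "card ?F \<le> D ^ k" by simp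
  qed
  moreover have "card (R ` F) \<le> card \<Omega> choose (k div 2)"
  proof -
    have "R ` F \<subseteq> {B. B \<subseteq> \<Omega> \<and> card B = k div 2}" using R mv by blast
    then have "card (R ` F) \<le> card {B. B \<subseteq> \<Omega> \<and> card B = k div 2}"
      using \<Omega> by (intro card_mono) auto
    then show ?thesis using n_subsets[OF \<Omega>] by simp
  qed
  then have "real (card (R ` F)) * D ^ k \<le> (card \<Omega> choose (k div 2)) * D ^ k"
    using D by (intro mult_right_mono of_nat_mono) auto
  ultimately show ?thesis by linarith
qed

lemma (in perm_group) card_degree_le_of_base:
  fixes C D :: real and k :: nat
  defines "F \<equiv> {h \<in> G. card (moved h) = k}"
  defines "w \<equiv> \<lambda>x. real (card {h \<in> F. h x \<noteq> x})"
  assumes C: "C > 0" and k: "k \<ge> 1" and X: "X \<subseteq> \<Omega>" "C * sum w X \<le> sum w \<Omega>"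
    and D: "D \<ge> 1" "\<And>y. y \<in> \<Omega> \<Longrightarrow> card (orb (fixer G X) y) \<le> D"
  shows "card F \<le> 2 * (real (card \<Omega>) ^ 2 + 1) ^ nat \<lfloor>2 * k / C\<rfloor> * ((card \<Omega> choose (k div 2)) * D ^ k)"
proof -
  define e where "e = nat \<lfloor>2 * k / C\<rfloor>"
  have FG: "F \<subseteq> G" by (auto simp: F_def)
  have finF: "finite F" using finite_G FG finite_subset by blast
  have count: "sum w Z = (\<Sum>h\<in>F. real (card (Z \<inter> moved h)))" if "Z \<subseteq> \<Omega>" for Z
  proof -
    have finZ: "finite Z" using that finite_\<Omega> finite_subset by blast
    have "sum w Z = (\<Sum>x\<in>Z. \<Sum>h\<in>F. if h x \<noteq> x then 1 else 0)"
      unfolding w_def using finF by (intro sum.cong refl) (simp flip: sum.inter_filter)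
    also have "\<dots> = (\<Sum>h\<in>F. \<Sum>x\<in>Z. if h x \<noteq> x then 1 else 0)" by (rule sum.swap)
    also have "\<dots> = (\<Sum>h\<in>F. real (card (Z \<inter> moved h)))"
      using finZ by (intro sum.cong refl) (simp add: moved_def Int_def flip: sum.inter_filter)
    finally show ?thesis .
  qed
  have w\<Omega>: "sum w \<Omega> = k * real (card F)"
  proof -
    have "\<Omega> \<inter> moved h = moved h" if "h \<in> F" for h using that FG moved_subset by blast
    then show ?thesis using count[of \<Omega>] by (simp add: F_def)
  qed
  \<comment> \<open>Markov's inequality: the average intersection with \<open>X\<close> has at most
    \<open>k / C\<close> points, so at least half of \<open>F\<close> meets \<open>X\<close> in at
    most \<open>2 * k / C\<close> points.\<close>
  define F1 where "F1 = {h \<in> F. C * card (X \<inter> moved h) \<le> 2 * k}"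
  have "2 * k * real (card (F - F1)) \<le> C * (\<Sum>h\<in>F. real (card (X \<inter> moved h)))"
  proof -
    have "2 * k * real (card (F - F1)) = (\<Sum>h\<in>F - F1. real (2 * k))" by simp
    also have "\<dots> \<le> (\<Sum>h\<in>F - F1. C * real (card (X \<inter> moved h)))"
      by (intro sum_mono) (auto simp: F1_def)
    also have "\<dots> \<le> (\<Sum>h\<in>F. C * real (card (X \<inter> moved h)))"
      using finF C by (intro sum_mono2) auto
    finally show ?thesis by (simp add: sum_distrib_left)
  qed
  also have "\<dots> \<le> k * real (card F)" using X count[OF X(1)] w\<Omega> by simp
  finally have "k * (2 * real (card (F - F1))) \<le> k * real (card F)" by (simp add: algebra_simps)
  then have "2 * real (card (F - F1)) \<le> card F" using k by simp
  moreover have "card F = card F1 + card (F - F1)"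
    using finF card_Diff_subset[of F1 F] card_mono[of F F1] by (auto simp: F1_def)
  ultimately have half: "real (card F) \<le> 2 * card F1" by simp
  \<comment> \<open>Recording only the moved points of \<open>X\<close> keeps the graph small, and
    it still determines the restriction to \<open>X\<close>, whose other points are fixed.\<close>
  define gr where "gr h = (\<lambda>x. (x, h x)) ` (X \<inter> moved h)" for h :: "'a \<Rightarrow> 'a"
  have finX: "finite X" using X(1) finite_\<Omega> finite_subset by blast
  have F1: "h \<in> G" "card (moved h) = k" "h permutes \<Omega>" "C * card (X \<inter> moved h) \<le> 2 * k" if "h \<in> F1" for h
    using that permutes by (auto simp: F1_def F_def)
  have "card F1 \<le> card (gr ` F1) * ((card \<Omega> choose (k div 2)) * D ^ k)"
  proof (rule card_le_fibres)
    show "finite F1" using finF by (simp add: F1_def)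
    fix \<gamma> assume "\<gamma> \<in> gr ` F1"
    then obtain h0 where h0: "h0 \<in> F1" "\<gamma> = gr h0" by blast
    have h0G: "h0 \<in> G" using F1(1)[OF h0(1)] .
    \<comment> \<open>Elements that agree with \<open>h0\<close> on \<open>X\<close> lie in the
      coset of \<open>h0\<close> by the stabiliser of \<open>X\<close>, so each value is confined to
      the image under \<open>h0\<close> of a short orbit.\<close>
    define A where "A y = (if y \<in> \<Omega> then h0 ` orb (fixer G X) y else {y})" for y
    show "card {h \<in> F1. gr h = \<gamma>} \<le> (card \<Omega> choose (k div 2)) * D ^ k"
    proof (rule card_restricted_perms[OF finite_\<Omega>])
      show "h permutes \<Omega> \<and> card (moved h) = k" if "h \<in> {h \<in> F1. gr h = \<gamma>}" for h
        using that F1 by simp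
      show "finite (A y)" for y unfolding A_def
        using perm_group.finite_orb[OF fixer_perm_group] by simp
      show "card (A y) \<le> D" for y
      proof (cases "y \<in> \<Omega>")
        case True
        have "card (A y) \<le> card (orb (fixer G X) y)"
          unfolding A_def using True perm_group.finite_orb[OF fixer_perm_group] by (simp add: card_image_le)
        then show ?thesis using D(2)[OF True] by linarith
      qed (use D in \<open>simp add: A_def\<close>)
      fix h y assume "h \<in> {h \<in> F1. gr h = \<gamma>}"
      then have h: "h \<in> F1" "gr h = gr h0" using h0 by auto
      have hG: "h \<in> G" using F1(1)[OF h(1)] .
      show "h y \<in> A y"
      proof (cases "y \<in> \<Omega>")
        case True
        have agree: "h x = h0 x" if x: "x \<in> X" for x
        proof (cases "h x = x")
          case True
          have "h0 x = x"
          proof (rule ccontr)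
            assume "h0 x \<noteq> x"
            then have "(x, h0 x) \<in> gr h0" using x by (auto simp: gr_def moved_def)
            then have "(x, h0 x) \<in> gr h" using h by simp
            then show False using True by (auto simp: gr_def moved_def)
          qed
          then show ?thesis using True by simp
        next
          case False
          then have "(x, h x) \<in> gr h" using x by (auto simp: gr_def moved_def)
          then have "(x, h x) \<in> gr h0" using h by simp
          then show ?thesis by (auto simp: gr_def)
        qed
        have "inv' h0 \<circ> h \<in> fixer G X"
          using agree inv_apply(1)[OF h0G] by (auto simp: fixer_def comp_mem inv_mem h0G hG)
        then have mem: "(inv' h0 \<circ> h) y \<in> orb (fixer G X) y" unfolding orb_def by (rule imageI)
        have "h y = h0 ((inv' h0 \<circ> h) y)" using inv_apply(2)[OF h0G] by simp
        with mem have "h y \<in> h0 ` orb (fixer G X) y" by (rule rev_image_eqI)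
        then show ?thesis using True by (simp only: A_def if_True)
      next
        case False
        then show ?thesis using F1(3)[OF h(1)] by (simp add: A_def permutes_def)
      qed
    qed (rule D(1))
  qed
  moreover have "card (gr ` F1) \<le> (card \<Omega> ^ 2 + 1) ^ e"
  proof -
    have "gr h \<subseteq> \<Omega> \<times> \<Omega> \<and> card (gr h) \<le> e" if h: "h \<in> F1" for h
    proof
      show "gr h \<subseteq> \<Omega> \<times> \<Omega>"
        using X(1) permutes_in_image[OF F1(3)[OF h]] by (auto simp: gr_def)
      have "card (gr h) \<le> card (X \<inter> moved h)" unfolding gr_def using finX by (intro card_image_le) simp
      moreover have "real (card (X \<inter> moved h)) \<le> 2 * k / C" using F1(4)[OF h] C by (simp add: field_simps)
      then have "card (X \<inter> moved h) \<le> e" unfolding e_def by linarith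
      ultimately show "card (gr h) \<le> e" by simp
    qed
    then have "gr ` F1 \<subseteq> {A. A \<subseteq> \<Omega> \<times> \<Omega> \<and> card A \<le> e}" by blast
    then have "card (gr ` F1) \<le> card {A. A \<subseteq> \<Omega> \<times> \<Omega> \<and> card A \<le> e}"
      using card_small_subsets_le[of "\<Omega> \<times> \<Omega>" e] finite_\<Omega> by (intro card_mono) auto
    also have "\<dots> \<le> (card (\<Omega> \<times> \<Omega>) + 1) ^ e"
      using card_small_subsets_le[of "\<Omega> \<times> \<Omega>" e] finite_\<Omega> by auto
    finally show ?thesis by (simp add: card_cartesian_product power2_eq_square)
  qed
  then have "real (card (gr ` F1)) \<le> real ((card \<Omega> ^ 2 + 1) ^ e)" by (simp only: of_nat_le_iff)
  then have "real (card (gr ` F1)) * ((card \<Omega> choose (k div 2)) * D ^ k)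
      \<le> real ((card \<Omega> ^ 2 + 1) ^ e) * ((card \<Omega> choose (k div 2)) * D ^ k)"
    using D by (intro mult_right_mono) auto
  ultimately have "card F1 \<le> real ((card \<Omega> ^ 2 + 1) ^ e) * ((card \<Omega> choose (k div 2)) * D ^ k)" by linarith
  then have "real (card F) \<le> 2 * (real ((card \<Omega> ^ 2 + 1) ^ e) * ((card \<Omega> choose (k div 2)) * D ^ k))"
    using half by linarith
  then show ?thesis by (simp add: e_def algebra_simps)
qed

section \<open>Factorial and binomial estimates for large degree\<close>

lemma power_self_le_exp_fact: "real k ^ k \<le> exp k * fact k"
proof -
  have "real k ^ k / fact k \<le> exp (real k)"
  proof -
    have s: "(\<lambda>i. real k ^ i /\<^sub>R fact i) sums exp (real k)" by (rule exp_converges)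
    have "(\<Sum>i\<in>{k}. real k ^ i /\<^sub>R fact i) \<le> (\<Sum>i. real k ^ i /\<^sub>R fact i)"
      by (rule sum_le_suminf) (use s in \<open>auto simp: sums_iff\<close>)
    then show ?thesis using s by (simp add: sums_iff field_simps)
  qed
  then show ?thesis by (simp add: field_simps)
qed

lemma fact_le_half_squared: "fact k \<le> (4::nat) ^ k * (fact (k div 2))\<^sup>2"
proof -
  let ?j = "k div 2"
  have "k - ?j = ?j \<or> k - ?j = Suc ?j" by linarith
  then have a: "fact (k - ?j) \<le> (k + 1) * (fact ?j :: nat)" by (auto simp: algebra_simps intro: mult_right_mono)
  have "k + 1 \<le> 2 ^ k" by (metis Suc_eq_plus1 Suc_leI less_exp)
  have "(fact k :: nat) = fact ?j * fact (k - ?j) * (k choose ?j)"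
    using binomial_fact_lemma[of ?j k] by simp
  also have "\<dots> \<le> fact ?j * ((k + 1) * fact ?j) * 2 ^ k"
    using a binomial_le_pow2[of k ?j] by (intro mult_mono) auto
  also have "\<dots> \<le> fact ?j * (2 ^ k * fact ?j) * 2 ^ k"
    using \<open>k + 1 \<le> 2 ^ k\<close> by (intro mult_mono) auto
  also have "\<dots> = 4 ^ k * (fact ?j)\<^sup>2"
    by (simp add: power2_eq_square flip: power_mult_distrib)
  finally show ?thesis .
qed

text \<open>Choosing half of the support costs n^(k/2) (k!)^(-1/2) up to \<open>2 ^ k\<close>, which
  undercuts n^(k/2) (k!)^(-1/4) by a fourth root of k!.\<close>

lemma binomial_half_le:
  assumes "n \<ge> 1"
  shows "real (n choose (k div 2)) * sqrt (fact k) \<le> 2 ^ k * real n powr (k / 2)"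
proof -
  let ?j = "k div 2"
  have "sqrt (fact k) \<le> 2 ^ k * fact ?j"
  proof (rule real_le_lsqrt)
    have "real (fact k) \<le> real (4 ^ k * (fact ?j)\<^sup>2)" using fact_le_half_squared[of k] by (simp only: of_nat_le_iff)
    moreover have "(2 ^ k)\<^sup>2 = (4 ^ k :: real)" by (simp add: power2_eq_square flip: power_mult_distrib)
    then have "(2 ^ k * fact ?j :: real)\<^sup>2 = 4 ^ k * (fact ?j)\<^sup>2" by (simp only: power_mult_distrib)
    ultimately show "fact k \<le> (2 ^ k * fact ?j :: real)\<^sup>2" by simp
  qed auto
  then have "real (n choose ?j) * sqrt (fact k) \<le> real (n choose ?j) * (2 ^ k * fact ?j)" by (intro mult_left_mono) auto
  also have "\<dots> = 2 ^ k * real ((n choose ?j) * fact ?j)" by simp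
  also have "\<dots> \<le> 2 ^ k * real (n ^ ?j)" using binomial_fact_pow[of n ?j] by (intro mult_left_mono of_nat_mono) auto
  also have "real (n ^ ?j) = real n powr ?j" using assms by (simp add: powr_realpow)
  also have "2 ^ k * (real n powr ?j) \<le> 2 ^ k * (real n powr (k / 2))"
    using assms by (intro mult_left_mono powr_mono) auto
  finally show ?thesis .
qed

text \<open>Everything is compared on the logarithmic scale: with \<open>ln k! \<ge> k ln k - k\<close> the fourth root of \<open>k!\<close>
  outweighs all error terms as soon as \<open>k\<close> is at least a fixed power of \<open>n\<close>.\<close>

lemma large_degree_bound:
  fixes \<kappa> \<gamma> :: real and n k :: nat
  defines "\<gamma> \<equiv> \<kappa> / 32"
  assumes \<kappa>: "0 < \<kappa>" "\<kappa> \<le> 1" and n: "n \<ge> 2" "4 * exp 1 \<le> real n powr \<gamma>"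
    and k: "real n powr \<kappa> \<le> k" "k \<le> n"
  shows "2 * (real n ^ 2 + 1) ^ nat \<lfloor>2 * k / (6 / \<gamma>)\<rfloor> * ((n choose (k div 2)) * (real n powr \<gamma>) ^ k)
    \<le> real n powr (- \<gamma> * k) * real (n choose k) powr (1/2) * fact k powr (1/4)"
proof -
  define L where "L = ln (real n)"
  define K where "K = ln (real k)"
  define P where "P = ln (fact k :: real)"
  have \<gamma>: "\<gamma> > 0" "\<kappa> = 32 * \<gamma>" using \<kappa> by (auto simp: \<gamma>_def)
  have L: "L > 0" using n by (simp add: L_def)
  have "real n powr \<kappa> \<ge> 1" using n \<kappa> by (intro ge_one_powr_ge_zero) auto
  then have k1: "k \<ge> 1" using k by linarith
  have "ln (real n powr \<kappa>) \<le> K" unfolding K_def using k n by (intro ln_mono) auto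
  then have KL: "32 * \<gamma> * L \<le> K" using n \<gamma> by (simp add: L_def ln_powr)
  have "ln (4 * exp 1) \<le> ln (real n powr \<gamma>)" using n by (intro ln_mono) auto
  then have c4: "ln 4 + 1 \<le> \<gamma> * L" using n by (simp add: L_def ln_powr ln_mult)
  have "ln (real k ^ k) \<le> ln (exp k * fact k)" using power_self_le_exp_fact[of k] k1 by (intro ln_mono) auto
  then have P: "k * K \<le> k + P" using k1 by (simp add: K_def P_def ln_mult ln_realpow)
  have f1: "(real n ^ 2 + 1) ^ nat \<lfloor>2 * k / (6 / \<gamma>)\<rfloor> \<le> exp (\<gamma> * k * L)"
  proof -
    let ?e = "nat \<lfloor>2 * k / (6 / \<gamma>)\<rfloor>"
    have "2 * 1 \<le> real n ^ 2" using n power_mono[of 2 "real n" 2] by simp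
    moreover have "2 * real n ^ 2 \<le> real n * real n ^ 2" using n by (intro mult_right_mono) auto
    ultimately have "real n ^ 2 + 1 \<le> real n * real n ^ 2" by linarith
    then have b: "real n ^ 2 + 1 \<le> real n ^ 3" by (simp add: power3_eq_cube power2_eq_square)
    have "(real n ^ 2 + 1) ^ ?e \<le> (real n ^ 3) ^ ?e" using b by (intro power_mono) auto
    also have "\<dots> = exp (3 * ?e * L)" using n by (simp add: L_def exp_of_nat_mult exp_ln flip: power_mult) (metis exp_ln exp_of_nat_mult gr0I not_numeral_le_zero of_nat_0_less_iff of_nat_mult of_nat_numeral)
    also have "3 * real ?e \<le> \<gamma> * k"
    proof -
      have "real ?e \<le> 2 * k / (6 / \<gamma>)" using \<gamma> by (intro of_nat_floor) auto
      then show ?thesis using \<gamma> by (simp add: field_simps)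
    qed
    then have "exp (3 * ?e * L) \<le> exp (\<gamma> * k * L)" using L by (simp add: mult_right_mono)
    finally show ?thesis .
  qed
  have f2: "real (n choose (k div 2)) \<le> exp (k * ln 2 + k / 2 * L - P / 2)"
  proof -
    have "sqrt (fact k) = exp (P / 2)" by (simp add: P_def ln_sqrt flip: ln_sqrt) 
    moreover have "2 ^ k * real n powr (k / 2) = exp (k * ln 2 + k / 2 * L)"
      using n by (simp add: L_def powr_def exp_add exp_of_nat_mult)
    ultimately have "real (n choose (k div 2)) * exp (P / 2) \<le> exp (k * ln 2 + k / 2 * L)"
      using binomial_half_le[of n k] n by simp
    then have "real (n choose (k div 2)) \<le> exp (k * ln 2 + k / 2 * L) / exp (P / 2)"
      by (simp only: pos_le_divide_eq exp_gt_zero)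
    then show ?thesis by (simp only: exp_diff)
  qed
  have f3: "(real n powr \<gamma>) ^ k = exp (\<gamma> * k * L)"
    using n by (simp add: powr_def L_def algebra_simps flip: exp_of_nat_mult)
  have "2 * (real n ^ 2 + 1) ^ nat \<lfloor>2 * k / (6 / \<gamma>)\<rfloor> * ((n choose (k div 2)) * (real n powr \<gamma>) ^ k)
      \<le> exp (ln 2) * exp (\<gamma> * k * L) * (exp (k * ln 2 + k / 2 * L - P / 2) * exp (\<gamma> * k * L))"
    unfolding f3 using f1 f2 by (intro mult_mono) auto
  also have "\<dots> = exp (ln 2 + \<gamma> * k * L + (k * ln 2 + k / 2 * L - P / 2) + \<gamma> * k * L)"
    by (simp only: exp_add mult.assoc)
  also have "\<dots> \<le> exp (- \<gamma> * k * L + (k / 2 * L - k / 2 * K) + P / 4)"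
  proof -
    define g where "g = \<gamma> * k * L"
    define a where "a = real k * ln 2"
    define q where "q = k / 2 * L"
    define u where "u = k * K"
    have "ln (4::real) = 2 * ln 2" using ln_realpow[of 2 2] by simp
    then have "k * (2 * ln 2 + 1) \<le> k * (\<gamma> * L)" using c4 by (intro mult_left_mono) auto
    then have 1: "k + 2 * a \<le> g" by (simp add: a_def g_def algebra_simps)
    have "k * (32 * \<gamma> * L) \<le> k * K" using KL by (intro mult_left_mono) auto
    then have 2: "32 * g \<le> u" by (simp only: g_def u_def ac_simps)
    have "1 * ln 2 \<le> k * ln (2::real)" using k1 by (intro mult_right_mono) auto
    then have 3: "ln 2 \<le> a" by (simp add: a_def)
    have 4: "u \<le> k + P" using P by (simp add: u_def)
    have 5: "- \<gamma> * k * L = - g" "k / 2 * K = u / 2" by (simp_all add: g_def u_def)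
    \<comment> \<open>After cancellation the claim is
      \<open>ln 2 + 3 * g + a + u / 2 <= 3 * P / 4\<close>. Since \<open>P >= u - k\<close>, an
      amount \<open>u / 4 >= 8 * g\<close> is available, while
      \<open>ln 2 + 3 * g + a + 3 * k / 4\<close> is at most \<open>4 * g\<close>.\<close>
    have "ln 2 + g + (a + q - P / 2) + g \<le> - g + (q - u / 2) + P / 4"
    proof -
      have "0 \<le> real k" "0 \<le> a" by (simp_all add: a_def)
      then have "0 \<le> g" using 1 by linarith
      then show ?thesis using 1 2 3 4 \<open>0 \<le> real k\<close> by linarith
    qed
    then show ?thesis unfolding exp_le_cancel_iff 5 by (simp only: g_def a_def q_def)
  qed
  also have "\<dots> \<le> real n powr (- \<gamma> * k) * real (n choose k) powr (1/2) * fact k powr (1/4)"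
  proof -
    have "(real n / k) ^ k \<le> real (n choose k)" using binomial_ge_n_over_k_pow_k[of k n] k by simp
    moreover have "(real n / k) ^ k = exp (k * L - k * K)"
      using n k1 by (simp add: L_def K_def exp_diff exp_of_nat_mult power_divide)
    ultimately have "exp (k * L - k * K) powr (1/2) \<le> real (n choose k) powr (1/2)" by (intro powr_mono2) auto
    then have "exp (k / 2 * L - k / 2 * K) \<le> real (n choose k) powr (1/2)"
      by (simp add: powr_def algebra_simps diff_divide_distrib)
    moreover have "exp (- \<gamma> * k * L) = real n powr (- \<gamma> * k)" using n by (simp add: powr_def L_def)
    moreover have "exp (P / 4) = fact k powr (1/4)" by (simp add: powr_def P_def)
    ultimately have "exp (- \<gamma> * k * L) * exp (k / 2 * L - k / 2 * K) * exp (P / 4)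
        \<le> real n powr (- \<gamma> * k) * real (n choose k) powr (1/2) * fact k powr (1/4)"
      by (intro mult_mono) auto
    then show ?thesis by (simp only: exp_add)
  qed
  finally show ?thesis .
qed

text \<open>Closure under intersection makes the minimal nonempty members pairwise disjoint. As each
  has at least \<open>m / 3\<close> points, there are at most \<open>3 * card U / m\<close> of them,
  and one point from each meets every nonempty member.\<close>

lemma ex_hitting_set_of_minimal:
  fixes m :: nat
  assumes U: "finite U" and V: "\<And>V. V \<in> \<V> \<Longrightarrow> V \<subseteq> U" "\<And>V W. V \<in> \<V> \<Longrightarrow> W \<in> \<V> \<Longrightarrow> V \<inter> W \<in> \<V>"
    and m: "\<And>V. V \<in> \<V> \<Longrightarrow> V \<noteq> {} \<Longrightarrow> m \<le> 3 * card V"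
  shows "\<exists>Q\<subseteq>U. m * card Q \<le> 3 * card U \<and> (\<forall>V\<in>\<V>. V \<noteq> {} \<longrightarrow> V \<inter> Q \<noteq> {})"
proof -
  define M where "M = {V \<in> \<V>. V \<noteq> {} \<and> (\<forall>W\<in>\<V>. W \<noteq> {} \<longrightarrow> W \<subseteq> V \<longrightarrow> W = V)}"
  have "M \<subseteq> Pow U" using V(1) by (auto simp: M_def)
  then have finM: "finite M" using U finite_subset by blast
  have fin: "finite V" if "V \<in> M" for V using that \<open>M \<subseteq> Pow U\<close> U finite_subset by blast
  have disj: "V \<inter> W = {}" if "V \<in> M" "W \<in> M" "V \<noteq> W" for V W
  proof (rule ccontr)
    assume "V \<inter> W \<noteq> {}"
    moreover have "V \<inter> W \<in> \<V>" using that V(2) by (auto simp: M_def)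
    ultimately have "V \<inter> W = V" "V \<inter> W = W" using that unfolding M_def by auto
    then show False using that by simp
  qed
  define r where "r V = (SOME x. x \<in> V)" for V :: "'a set"
  have r: "r V \<in> V" if "V \<in> M" for V
    using that unfolding r_def M_def by (simp add: some_in_eq)
  have "m * card M = (\<Sum>V\<in>M. m)" by simp
  also have "\<dots> \<le> (\<Sum>V\<in>M. 3 * card V)" using m by (intro sum_mono) (auto simp: M_def)
  also have "\<dots> = 3 * card (\<Union>M)"
    using finM fin disj by (subst card_Union_disjoint) (auto simp: pairwise_def disjnt_def sum_distrib_left)
  also have "\<dots> \<le> 3 * card U" using \<open>M \<subseteq> Pow U\<close> U by (intro mult_left_mono card_mono) auto
  finally have "m * card M \<le> 3 * card U" .
  moreover have "m * card (r ` M) \<le> m * card M" using card_image_le[OF finM] by (intro mult_left_mono) auto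
  ultimately have "m * card (r ` M) \<le> 3 * card U" by (rule le_trans[rotated])
  moreover have "V \<inter> r ` M \<noteq> {}" if Vne: "V \<in> \<V>" "V \<noteq> {}" for V
  proof -
    let ?c = "\<lambda>W. W \<in> \<V> \<and> W \<noteq> {} \<and> W \<subseteq> V"
    obtain W where W: "?c W" "\<And>W'. ?c W' \<Longrightarrow> card W \<le> card W'"
      using ex_has_least_nat[of ?c V card] Vne by blast
    have "W' = W" if "W' \<in> \<V>" "W' \<noteq> {}" "W' \<subseteq> W" for W'
    proof (rule card_seteq[OF _ that(3)])
      show "finite W" using W(1) V(1) U finite_subset by blast
      show "card W \<le> card W'" using W that by blast
    qed
    then have "W \<in> M" using W(1) by (auto simp: M_def)
    then show ?thesis using r W(1) by blast
  qed
  moreover have "r ` M \<subseteq> U" using r \<open>M \<subseteq> Pow U\<close> by blast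
  ultimately show ?thesis by (intro exI[of _ "r ` M"]) simp
qed

lemma ex_large_fibre:
  assumes "finite F" "finite T" "f ` F \<subseteq> T" "F \<noteq> {}"
  shows "\<exists>\<gamma>\<in>T. card F \<le> card T * card {h \<in> F. f h = \<gamma>}"
proof (rule ccontr)
  assume "\<not> ?thesis"
  then have *: "card T * card {h \<in> F. f h = \<gamma>} < card F" if "\<gamma> \<in> T" for \<gamma> using that by auto
  have "T \<noteq> {}" using assms by auto
  have "card F = card (\<Union>\<gamma>\<in>T. {h \<in> F. f h = \<gamma>})" using assms(3) by (intro arg_cong[of _ _ card]) auto
  also have "\<dots> \<le> (\<Sum>\<gamma>\<in>T. card {h \<in> F. f h = \<gamma>})" using assms(2) by (rule card_UN_le)
  finally have "card T * card F \<le> (\<Sum>\<gamma>\<in>T. card T * card {h \<in> F. f h = \<gamma>})"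
    by (simp flip: sum_distrib_left)
  also have "\<dots> < (\<Sum>\<gamma>\<in>T. card F)" using * assms(2) \<open>T \<noteq> {}\<close> by (intro sum_strict_mono) auto
  finally show False by simp
qed

text \<open>A random colouring of the points by \<open>U\<close> makes the images of different elements of \<open>U\<close>
  distinguishable, at the cost of a factor \<open>|U|^|U|\<close>.\<close>

lemma ex_compatible_colouring:
  assumes \<Omega>: "finite \<Omega>" and U: "finite U" "U \<noteq> {}" and F: "finite F"
    and inj: "\<And>h. h \<in> F \<Longrightarrow> inj_on h U" and im: "\<And>h. h \<in> F \<Longrightarrow> h ` U \<subseteq> \<Omega>"
  shows "\<exists>\<chi>. card F \<le> card U ^ card U * card {h \<in> F. \<forall>u\<in>U. \<chi> (h u) = u}"
proof (rule ccontr)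
  assume "\<not> ?thesis"
  then have *: "card U ^ card U * card {h \<in> F. \<forall>u\<in>U. \<chi> (h u) = u} < card F" for \<chi> by (meson not_le)
  define X where "X = (\<Pi>\<^sub>E y\<in>\<Omega>. U)"
  have finX: "finite X" unfolding X_def using \<Omega> U by (intro finite_PiE) auto
  have "X \<noteq> {}" using U by (simp add: X_def PiE_eq_empty_iff)
  have cX: "card X = card U ^ card \<Omega>" unfolding X_def using \<Omega> by (simp add: card_PiE)
  \<comment> \<open>A compatible colouring is prescribed on the image of \<open>U\<close> under
    \<open>h\<close> and free elsewhere. So each \<open>h\<close> is compatible with the same
    proportion of all colourings, and averaging over the colourings finds one that is good for many
    \<open>h\<close>.\<close>
  have fibre: "card {\<chi> \<in> X. \<forall>u\<in>U. \<chi> (h u) = u} * card U ^ card U = card X" if h: "h \<in> F" for h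
  proof -
    have "{\<chi> \<in> X. \<forall>u\<in>U. \<chi> (h u) = u} = (\<Pi>\<^sub>E y\<in>\<Omega>. if y \<in> h ` U then {the_inv_into U h y} else U)" (is "?A = ?B")
    proof
      show "?A \<subseteq> ?B"
        using inj[OF h] by (auto simp: X_def PiE_iff the_inv_into_f_f extensional_def)
      show "?B \<subseteq> ?A"
      proof
        fix \<chi> assume \<chi>: "\<chi> \<in> ?B"
        have "\<chi> (h u) = u" if u: "u \<in> U" for u
        proof -
          have "h u \<in> \<Omega>" using im[OF h] u by blast
          then have "\<chi> (h u) \<in> (if h u \<in> h ` U then {the_inv_into U h (h u)} else U)" using \<chi> by (auto simp: PiE_iff)
          then show ?thesis using u inj[OF h] by (simp add: the_inv_into_f_f)
        qed
        moreover have "\<chi> \<in> X" unfolding X_def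
        proof (rule PiE_I)
          fix y assume "y \<in> \<Omega>"
          then have "\<chi> y \<in> (if y \<in> h ` U then {the_inv_into U h y} else U)" using \<chi> by (auto simp: PiE_iff)
          then show "\<chi> y \<in> U" using inj[OF h] by (auto simp: the_inv_into_f_f split: if_splits)
        next
          fix y assume "y \<notin> \<Omega>" then show "\<chi> y = undefined" using \<chi> by (auto simp: PiE_iff extensional_def)
        qed
        ultimately show "\<chi> \<in> ?A" by blast
      qed
    qed
    then have "card ?A = (\<Prod>y\<in>\<Omega>. card (if y \<in> h ` U then {the_inv_into U h y} else U))"
      using \<Omega> by (simp add: card_PiE)
    also have "\<dots> = (\<Prod>y\<in>\<Omega>. if y \<in> h ` U then 1 else card U)" by (intro prod.cong) auto
    also have "\<dots> = (\<Prod>y\<in>\<Omega> - h ` U. card U)"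
      using \<Omega> im[OF h] by (subst prod.If_cases) (auto simp: Diff_eq)
    also have "\<dots> = card U ^ (card \<Omega> - card U)"
      using im[OF h] U inj[OF h] by (simp add: card_Diff_subset card_image)
    moreover have "card U \<le> card \<Omega>" using card_inj_on_le[OF inj[OF h] im[OF h] \<Omega>] .
    ultimately show ?thesis unfolding cX by (simp flip: power_add)
  qed
  have "card F * card X = (\<Sum>h\<in>F. card U ^ card U * card {\<chi> \<in> X. \<forall>u\<in>U. \<chi> (h u) = u})"
    using fibre by (simp add: mult.commute)
  also have "\<dots> = card U ^ card U * (\<Sum>h\<in>F. \<Sum>\<chi>\<in>X. if \<forall>u\<in>U. \<chi> (h u) = u then 1 else 0)"
    using finX by (simp add: sum_distrib_left flip: sum.inter_filter)
  also have "\<dots> = card U ^ card U * (\<Sum>\<chi>\<in>X. \<Sum>h\<in>F. if \<forall>u\<in>U. \<chi> (h u) = u then 1 else 0)"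
    by (subst sum.swap) simp
  also have "\<dots> = (\<Sum>\<chi>\<in>X. card U ^ card U * card {h \<in> F. \<forall>u\<in>U. \<chi> (h u) = u})"
    using F by (simp add: sum_distrib_left flip: sum.inter_filter)
  also have "\<dots> < (\<Sum>\<chi>\<in>X. card F)" using * finX \<open>X \<noteq> {}\<close> by (intro sum_strict_mono) auto
  finally show False by simp
qed

context perm_group begin

text \<open>When neither permutation maps a point of the common support \<open>W\<close> back into
  \<open>W\<close>, the commutator consists of the three-cycles w, x w, y w. This gives exact
  control of what it does on \<open>W\<close>, and it is nontrivial as soon as \<open>W\<close> is
  nonempty.\<close>

lemma commutator_three_cycles:
  assumes x: "x \<in> G" and y: "y \<in> G" and W: "W = moved x \<inter> moved y"
    and d: "x ` W \<inter> W = {}" "y ` W \<inter> W = {}"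
  defines "z \<equiv> x \<circ> y \<circ> inv' x \<circ> inv' y"
  shows "z \<in> G" "\<And>w. w \<in> W \<Longrightarrow> z w = x w" "\<And>w. w \<in> W \<Longrightarrow> z (x w) = y w" "\<And>w. w \<in> W \<Longrightarrow> z (y w) = w"
    "moved z \<subseteq> W \<union> x ` W \<union> y ` W" "card (moved z) \<le> 3 * card W" "W \<subseteq> moved z"
    "W \<noteq> {} \<Longrightarrow> z \<noteq> id"
proof -
  note ix = inv_apply[OF x] and iy = inv_apply[OF y]
  show "z \<in> G" unfolding z_def using x y by (intro comp_mem inv_mem)
  have mx: "x w \<in> moved x" "inv' x w \<in> moved x" if "w \<in> moved x" for w
    using that ix(2)[of w] inj_mem[OF x] by (auto simp: moved_def)
  have my: "y w \<in> moved y" "inv' y w \<in> moved y" if "w \<in> moved y" for w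
    using that iy(2)[of w] inj_mem[OF y] by (auto simp: moved_def)
  have xw: "y (x w) = x w" "inv' y (x w) = x w" if "w \<in> W" for w
  proof -
    have "x w \<notin> W" using that d by blast
    moreover have "x w \<in> moved x" using mx that W by blast
    ultimately show 1: "y (x w) = x w" using W by (auto simp: moved_def)
    then show "inv' y (x w) = x w" using iy(1)[of "x w"] by simp
  qed
  have yw: "x (y w) = y w" if "w \<in> W" for w
  proof -
    have "y w \<notin> W" using that d by blast
    moreover have "y w \<in> moved y" using my that W by blast
    ultimately show 1: "x (y w) = y w" using W by (auto simp: moved_def)
  qed
  have iyw: "x (inv' y w) = inv' y w" "inv' x (inv' y w) = inv' y w" if w: "w \<in> W" for w
  proof -
    have "inv' y w \<notin> W" using w d(2) iy(2)[of w] by (metis disjoint_iff image_eqI)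
    moreover have "inv' y w \<in> moved y" using my w W by blast
    ultimately show 1: "x (inv' y w) = inv' y w" using W by (auto simp: moved_def)
    then show "inv' x (inv' y w) = inv' y w" using ix(1)[of "inv' y w"] by simp
  qed
  have ixw: "y (inv' x w) = inv' x w" if w: "w \<in> W" for w
  proof -
    have "inv' x w \<notin> W" using w d(1) ix(2)[of w] by (metis disjoint_iff image_eqI)
    moreover have "inv' x w \<in> moved x" using mx w W by blast
    ultimately show 1: "y (inv' x w) = inv' x w" using W by (auto simp: moved_def)
  qed
  show z1: "z w = x w" if "w \<in> W" for w using iyw[OF that] iy by (simp add: z_def)
  show "z (x w) = y w" if "w \<in> W" for w using xw[OF that] ix yw[OF that] by (simp add: z_def)
  show "z (y w) = w" if "w \<in> W" for w using iy ixw[OF that] ix by (simp add: z_def)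
  show "moved z \<subseteq> W \<union> x ` W \<union> y ` W"
    using moved_commutator_subset[OF y x] unfolding z_def W by blast
  show "card (moved z) \<le> 3 * card W"
    using card_moved_commutator_le[OF y x] unfolding z_def W by (simp add: Int_commute)
  show "W \<subseteq> moved z" using z1 W by (auto simp: moved_def)
  then show "z \<noteq> id" if "W \<noteq> {}" using that by (auto simp: moved_def)
qed

end

section \<open>Elements of small degree\<close>

text \<open>The unit of measurement is \<open>t\<close>, the 400th root of n: \<open>k\<close> is at
  most \<open>t ^ 4\<close>, \<open>\<beta>\<close> at most \<open>t ^ 12\<close>, and the weights
  used lie between \<open>t ^ 199\<close> and \<open>t ^ 200\<close>, so estimates become
  comparisons of powers of a number that is at least 2.\<close>

locale small_degree = perm_group \<Omega> G for \<Omega> :: "'a set" and G +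
  fixes k m :: nat and t :: real
  assumes m300: "m \<ge> 300" and mk: "m \<le> k"
    and min: "h \<in> G \<Longrightarrow> h \<noteq> id \<Longrightarrow> m \<le> card (moved h)"
    and t2: "t \<ge> 2" and tn: "t ^ 400 = card \<Omega>" and kt: "k \<le> t ^ 4"
begin

definition F where "F = {h \<in> G. card (moved h) = k}"
text \<open>The square root of n times l^(-1/4). The product over all l up to \<open>k\<close> is
  n^(k/2) (k!)^(-1/4), which is the target up to a constant and the saving.\<close>

definition weight :: "nat \<Rightarrow> real" where "weight l = t ^ 200 * real l powr (- (1/4))"
text \<open>A cube, so that the at most \<open>k * k\<close> events of mapping a point of
  \<open>R - P\<close> into \<open>R\<close>, each of proportion at most \<open>1 / \<beta>\<close>,
  together stay below one half.\<close>

definition \<beta> :: real where "\<beta> = real k ^ 3"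
text \<open>Points are charged with the weights for \<open>k\<close>, \<open>k - 1\<close>, and so
  on. A new point is discounted by \<open>\<beta>\<close> and a new prescribed image costs
  \<open>\<beta>\<close>, so a point gained together with an image costs exactly its weight. Since
  \<open>j <= i\<close> in a state, the total never exceeds the product of the weights.\<close>

definition cost :: "nat \<Rightarrow> nat \<Rightarrow> real"
  where "cost i j = (\<Prod>l\<in>{k - i<..k}. weight l) * \<beta> ^ j / \<beta> ^ i"
definition fam where "fam R P h0 = {h \<in> F. R \<subseteq> moved h \<and> (\<forall>x\<in>P. h x = h0 x)}"
text \<open>The points that stay uncharged and yield the saving \<open>t ^ (199 * reserve)\<close>.
  A twentieth of \<open>m\<close> is small enough for \<open>card_K_le_1\<close>, which needs
  \<open>4 * (2 * reserve + 2) < m\<close>.\<close>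

definition reserve :: nat where "reserve = m div 20"
definition state where "state R P h0 \<longleftrightarrow> h0 \<in> F \<and> P \<subseteq> R \<and> R \<subseteq> moved h0 \<and> h0 ` P \<subseteq> R \<and>
    card R + reserve \<le> k \<and> card F \<le> card (fam R P h0) * cost (card R) (card P)"

lemma k300: "k \<ge> 300" using m300 mk by simp

lemma finite_F: "finite F" using finite_G by (simp add: F_def)

lemma F_G: "h \<in> F \<Longrightarrow> h \<in> G" by (simp add: F_def)

lemma \<beta>: "\<beta> \<ge> 1" "\<beta> \<le> t ^ 12" "\<beta> > 0"
proof -
  show "\<beta> \<ge> 1" using k300 by (simp add: \<beta>_def)
  then show "\<beta> > 0" by simp
  have "real k ^ 3 \<le> (t ^ 4) ^ 3" using kt by (intro power_mono) auto
  then show "\<beta> \<le> t ^ 12" by (simp add: \<beta>_def flip: power_mult)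
qed

lemma weight_ge: assumes "1 \<le> l" "l \<le> k" shows "weight l \<ge> t ^ 199"
proof -
  have "real l powr (1/4) \<le> (t ^ 4) powr (1/4)" using assms kt by (intro powr_mono2) auto
  also have "\<dots> = (t powr 4) powr (1/4)" using t2 by (simp add: powr_numeral)
  also have "\<dots> = t" using t2 by (simp only: powr_powr) simp
  finally have "real l powr (1/4) \<le> t" .
  moreover have "real l powr (1/4) > 0" using assms by simp
  ultimately have "t ^ 199 * real l powr (1/4) \<le> t ^ 199 * t" using t2 by (intro mult_left_mono) auto
  also have "t ^ 199 * t = t ^ 200" by (simp flip: power_Suc2)
  finally show ?thesis using \<open>real l powr (1/4) > 0\<close> by (simp add: weight_def powr_minus field_simps)
qed

lemma weight_pos: "1 \<le> l \<Longrightarrow> weight l > 0"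
  using t2 by (simp add: weight_def)

lemma weight_antimono: "1 \<le> l \<Longrightarrow> l \<le> l' \<Longrightarrow> weight l' \<le> weight l"
  unfolding weight_def using t2 by (intro mult_left_mono powr_mono2') auto

lemma cost_pos: "cost i j > 0"
  unfolding cost_def using \<beta>(3) by (intro divide_pos_pos mult_pos_pos prod_pos zero_less_power) (auto intro: weight_pos)

lemma cost_step:
  assumes "i + i' \<le> k"
  shows "cost i j * (weight (k - i) ^ i' * \<beta> ^ j') \<le> cost (i + i') (j + j') * \<beta> ^ i'"
proof -
  have "{k - (i + i')<..k} = {k - (i + i')<..k - i} \<union> {k - i<..k}" by auto
  then have "(\<Prod>l\<in>{k - (i + i')<..k}. weight l) =
      (\<Prod>l\<in>{k - (i + i')<..k - i}. weight l) * (\<Prod>l\<in>{k - i<..k}. weight l)"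
    by (simp add: prod.union_disjoint)
  moreover have "weight (k - i) ^ i' \<le> (\<Prod>l\<in>{k - (i + i')<..k - i}. weight l)"
  proof -
    have "card {k - (i + i')<..k - i} = i'" using assms by simp
    then have "weight (k - i) ^ i' = (\<Prod>l\<in>{k - (i + i')<..k - i}. weight (k - i))" by simp
    also have "\<dots> \<le> (\<Prod>l\<in>{k - (i + i')<..k - i}. weight l)"
      by (intro prod_mono conjI weight_antimono) (auto intro!: less_imp_le[OF weight_pos])
    finally show ?thesis .
  qed
  moreover have "0 < (\<Prod>l\<in>{k - i<..k}. weight l)" by (intro prod_pos) (auto intro: weight_pos)
  ultimately have "(\<Prod>l\<in>{k - i<..k}. weight l) * weight (k - i) ^ i' \<le> (\<Prod>l\<in>{k - (i + i')<..k}. weight l)"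
    by (simp add: mult.commute)
  then have "((\<Prod>l\<in>{k - i<..k}. weight l) * weight (k - i) ^ i') * (\<beta> ^ (j + j') / \<beta> ^ i) \<le>
      (\<Prod>l\<in>{k - (i + i')<..k}. weight l) * (\<beta> ^ (j + j') / \<beta> ^ i)"
    using \<beta>(3) by (intro mult_right_mono) auto
  then show ?thesis using \<beta>(3) by (simp add: cost_def power_add field_simps)
qed

end

section \<open>Consequences of maximality\<close>

locale maximal_state = small_degree +
  fixes R P h0
  assumes st: "state R P h0" and maximal: "state R' P' h1 \<Longrightarrow> card R' + card P' \<le> card R + card P"
begin

definition K where "K = fam R P h0"
definition k' where "k' = k - card R"
abbreviation "c \<equiv> real (card K)"

lemma st_simps: "h0 \<in> F" "P \<subseteq> R" "R \<subseteq> moved h0" "h0 ` P \<subseteq> R" "card R + reserve \<le> k"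
  "card F \<le> c * cost (card R) (card P)"
  using st by (auto simp: state_def K_def)

lemma finite_R: "finite R" and finite_P: "finite P"
proof -
  show "finite R" using st_simps(1,3) F_G finite_moved finite_subset by metis
  then show "finite P" using st_simps(2) finite_subset by blast
qed

lemma KD: assumes "h \<in> K" shows "h \<in> F" "h \<in> G" "R \<subseteq> moved h" "\<And>x. x \<in> P \<Longrightarrow> h x = h0 x" "h ` P \<subseteq> R"
    "card (moved h) = k" "card (moved h - R) = k'"
proof -
  show h: "h \<in> F" "R \<subseteq> moved h" and a: "\<And>x. x \<in> P \<Longrightarrow> h x = h0 x"
    using assms by (auto simp: K_def fam_def)
  then show "h \<in> G" "card (moved h) = k" by (auto simp: F_def)
  show "h ` P \<subseteq> R" using a st_simps(4) by force
  show "card (moved h - R) = k'" using h \<open>card (moved h) = k\<close> finite_R by (simp add: k'_def card_Diff_subset)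
qed

lemma KP: "h \<in> K \<Longrightarrow> h' \<in> K \<Longrightarrow> x \<in> P \<Longrightarrow> h x = h' x"
  using KD(4) by metis

lemma finite_K: "finite K" using finite_F by (simp add: K_def fam_def)

lemma h0_K: "h0 \<in> K" using st_simps by (simp add: K_def fam_def)

lemma c_pos: "c > 0" using finite_K h0_K by (auto simp: card_gt_0_iff)

lemma k'_ge: "reserve \<le> k'" using st_simps(5) by (simp add: k'_def)

lemma reserve_pos: "reserve \<ge> 15" using m300 by (simp add: reserve_def)

text \<open>The larger pair is not a state, by maximality, and the only defining condition that can
  fail is the lower bound on the size of its family. Comparing the two costs gives the
  estimate.\<close>

lemma extension_bound:
  assumes sub: "R \<subseteq> R'" "P \<subseteq> P'" "P' \<subseteq> R'" and h1: "h1 \<in> K" "R' \<subseteq> moved h1" "h1 ` P' \<subseteq> R'"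
    and i: "card R' = card R + i" "card P' = card P + j" "i + j > 0" "i + reserve \<le> k'"
  shows "card {h \<in> K. R' \<subseteq> moved h \<and> (\<forall>x\<in>P'. h x = h1 x)} * (weight k' ^ i * \<beta> ^ j) \<le> c * \<beta> ^ i"
proof -
  have eq: "fam R' P' h1 = {h \<in> K. R' \<subseteq> moved h \<and> (\<forall>x\<in>P'. h x = h1 x)}"
    using sub KD(4)[OF h1(1)] by (auto simp: K_def fam_def subset_iff)
  have "\<not> state R' P' h1" using maximal[of R' P' h1] i by auto
  moreover have "card R' + reserve \<le> k" using i st_simps(5) by (simp add: k'_def)
  ultimately have "card (fam R' P' h1) * cost (card R') (card P') < card F"
    using KD(1)[OF h1(1)] sub h1 by (auto simp: state_def)
  also have "\<dots> \<le> c * cost (card R) (card P)" by (rule st_simps(6))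
  finally have 1: "card (fam R' P' h1) * cost (card R') (card P') \<le> c * cost (card R) (card P)" by simp
  have "cost (card R) (card P) * (weight k' ^ i * \<beta> ^ j) \<le> cost (card R') (card P') * \<beta> ^ i"
    unfolding i(1,2) k'_def using i st_simps(5) by (intro cost_step) (simp add: k'_def)
  then have "card (fam R' P' h1) * (cost (card R) (card P) * (weight k' ^ i * \<beta> ^ j))
      \<le> card (fam R' P' h1) * (cost (card R') (card P') * \<beta> ^ i)" by (intro mult_left_mono) auto
  also have "\<dots> = (card (fam R' P' h1) * cost (card R') (card P')) * \<beta> ^ i" by simp
  also have "\<dots> \<le> (c * cost (card R) (card P)) * \<beta> ^ i" using 1 \<beta>(3) by (intro mult_right_mono) auto
  finally have "cost (card R) (card P) * (card (fam R' P' h1) * (weight k' ^ i * \<beta> ^ j))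
      \<le> cost (card R) (card P) * (c * \<beta> ^ i)" by (simp only: ac_simps)
  then show ?thesis using cost_pos eq by simp
qed

lemma k'_range: "1 \<le> k'" "k' \<le> k" "weight k' \<ge> t ^ 199"
proof -
  show "1 \<le> k'" using k'_ge reserve_pos by simp
  moreover show "k' \<le> k" by (simp add: k'_def)
  ultimately show "weight k' \<ge> t ^ 199" by (rule weight_ge)
qed

text \<open>An image inside \<open>R\<close> adds no point, so the gain is the single factor
  \<open>\<beta>\<close>.\<close>

lemma label_bound:
  assumes "u \<in> R - P" "r \<in> R"
  shows "card {h \<in> K. h u = r} * \<beta> \<le> c"
proof (cases "{h \<in> K. h u = r} = {}")
  case True show ?thesis using c_pos unfolding True by simp
next
  case False
  then obtain h1 where h1: "h1 \<in> K" "h1 u = r" by blast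
  have "card {h \<in> K. R \<subseteq> moved h \<and> (\<forall>x\<in>insert u P. h x = h1 x)} * (weight k' ^ 0 * \<beta> ^ 1) \<le> c * \<beta> ^ 0"
    by (rule extension_bound) (use h1 assms KD[OF h1(1)] st_simps finite_P k'_ge in auto)
  moreover have "{h \<in> K. R \<subseteq> moved h \<and> (\<forall>x\<in>insert u P. h x = h1 x)} = {h \<in> K. h u = r}"
  proof (intro Collect_cong conj_cong refl)
    fix h assume h: "h \<in> K"
    show "(R \<subseteq> moved h \<and> (\<forall>x\<in>insert u P. h x = h1 x)) = (h u = r)"
      using KD(3)[OF h] KP[OF h h1(1)] h1(2) by auto
  qed
  ultimately show ?thesis by simp
qed

text \<open>Points without images: each gains a weight divided by \<open>\<beta>\<close>, at least
  \<open>t ^ (199 - 12)\<close>.\<close>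

lemma many_points_bound:
  assumes A: "finite A" "A \<inter> R = {}" "A \<noteq> {}" "card A + reserve \<le> k'"
  shows "card {h \<in> K. A \<subseteq> moved h} * (t ^ 187) ^ card A \<le> c"
proof (cases "{h \<in> K. A \<subseteq> moved h} = {}")
  case True show ?thesis using c_pos unfolding True by simp
next
  case False
  let ?N = "card {h \<in> K. A \<subseteq> moved h}"
  obtain h1 where h1: "h1 \<in> K" "A \<subseteq> moved h1" using False by blast
  have "card {h \<in> K. R \<union> A \<subseteq> moved h \<and> (\<forall>x\<in>P. h x = h1 x)} * (weight k' ^ card A * \<beta> ^ 0) \<le> c * \<beta> ^ card A"
  proof (rule extension_bound)
    show "card (R \<union> A) = card R + card A" using A finite_R by (intro card_Un_disjoint) auto
    have "card A > 0" using A by (simp add: card_gt_0_iff)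
    then show "0 < card A + 0" by simp
  qed (use h1 A KD[OF h1(1)] st_simps in auto)
  moreover have "{h \<in> K. R \<union> A \<subseteq> moved h \<and> (\<forall>x\<in>P. h x = h1 x)} = {h \<in> K. A \<subseteq> moved h}"
  proof (intro Collect_cong conj_cong refl)
    fix h assume h: "h \<in> K"
    show "(R \<union> A \<subseteq> moved h \<and> (\<forall>x\<in>P. h x = h1 x)) = (A \<subseteq> moved h)"
      using KD(3)[OF h] KP[OF h h1(1)] by auto
  qed
  ultimately have "?N * weight k' ^ card A \<le> c * \<beta> ^ card A" by simp
  have "?N * (t ^ 187) ^ card A * \<beta> ^ card A = ?N * (t ^ 187 * \<beta>) ^ card A" by (simp add: power_mult_distrib)
  also have "\<dots> \<le> ?N * weight k' ^ card A"
  proof (intro mult_left_mono power_mono)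
    have "t ^ 187 * \<beta> \<le> t ^ 187 * t ^ 12" using \<beta> t2 by (intro mult_left_mono) auto
    also have "\<dots> = t ^ 199" by (simp flip: power_add)
    also have "\<dots> \<le> weight k'" by (rule k'_range)
    finally show "t ^ 187 * \<beta> \<le> weight k'" .
  qed (use \<beta> t2 in auto)
  also have "\<dots> \<le> c * \<beta> ^ card A" by fact
  finally show ?thesis using \<beta>(3) by simp
qed

text \<open>Two new points come with two new images, so the powers of \<open>\<beta>\<close> cancel
  and the gain is the squared weight, n divided by \<open>sqrt k'\<close>.\<close>

lemma swap_bound:
  assumes "a \<notin> R" "b \<notin> R" "a \<noteq> b" "2 + reserve \<le> k'"
  shows "card {h \<in> K. h a = b \<and> h b = a} * real (card \<Omega>) \<le> c * sqrt k'"
proof (cases "{h \<in> K. h a = b \<and> h b = a} = {}")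
  case True show ?thesis using c_pos unfolding True by simp
next
  case False
  let ?N = "card {h \<in> K. h a = b \<and> h b = a}"
  obtain h1 where h1: "h1 \<in> K" "h1 a = b" "h1 b = a" using False by blast
  have "card {h \<in> K. R \<union> {a, b} \<subseteq> moved h \<and> (\<forall>x\<in>P \<union> {a, b}. h x = h1 x)} * (weight k' ^ 2 * \<beta> ^ 2) \<le> c * \<beta> ^ 2"
  proof (rule extension_bound)
    show "card (R \<union> {a, b}) = card R + 2" "card (P \<union> {a, b}) = card P + 2"
      using assms finite_R finite_P st_simps(2) by (auto simp: card_insert_if)
  qed (use h1 assms KD[OF h1(1)] st_simps in \<open>auto simp: moved_def\<close>)
  moreover have "{h \<in> K. R \<union> {a, b} \<subseteq> moved h \<and> (\<forall>x\<in>P \<union> {a, b}. h x = h1 x)} = {h \<in> K. h a = b \<and> h b = a}"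
  proof (rule Collect_cong, rule conj_cong[OF refl])
    fix h assume h: "h \<in> K"
    show "R \<union> {a, b} \<subseteq> moved h \<and> (\<forall>x\<in>P \<union> {a, b}. h x = h1 x) \<longleftrightarrow> h a = b \<and> h b = a"
      using KD(3)[OF h] KP[OF h h1(1)] h1(2,3) assms(3) by (auto simp: moved_def)
  qed
  ultimately have "(?N * weight k' ^ 2) * \<beta> ^ 2 \<le> c * \<beta> ^ 2" by simp
  then have 1: "?N * weight k' ^ 2 \<le> c" using \<beta>(3) by simp
  have "weight k' ^ 2 * sqrt k' = real (card \<Omega>)"
  proof -
    have "(real k' powr (- (1/4)))\<^sup>2 = real k' powr (- (1/2))"
      by (simp add: power2_eq_square flip: powr_add)
    then have "weight k' ^ 2 = t ^ 400 * real k' powr (- (1/2))"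
      by (simp add: weight_def power_mult_distrib flip: power_mult)
    moreover have "real k' powr (- (1/2)) * sqrt k' = 1"
      using k'_range by (simp add: powr_minus powr_half_sqrt)
    ultimately show ?thesis using tn by simp
  qed
  then have "?N * real (card \<Omega>) = ?N * weight k' ^ 2 * sqrt k'" by simp
  also have "\<dots> \<le> c * sqrt k'" using 1 by (intro mult_right_mono) auto
  finally show ?thesis .
qed

text \<open>\<open>U1\<close> joins \<open>P\<close> and its images join \<open>R\<close>; equally
  many points and images are added, so the powers of \<open>\<beta>\<close> cancel.\<close>

lemma vector_bound:
  assumes U1: "U1 \<subseteq> R - P" "U1 \<noteq> {}" "card U1 + reserve \<le> k'" and h1: "h1 \<in> K" "h1 ` U1 \<inter> R = {}"
  shows "card {h \<in> K. \<forall>u\<in>U1. h u = h1 u} * (t ^ 199) ^ card U1 \<le> c"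
proof -
  let ?N = "card {h \<in> K. \<forall>u\<in>U1. h u = h1 u}"
  have finU: "finite U1" using U1(1) finite_R finite_subset by blast
  have inj: "inj_on h1 U1" using inj_mem[OF KD(2)[OF h1(1)]] by (auto simp: inj_on_def)
  have mv: "h u \<in> moved h" if "h \<in> K" "u \<in> R" for h u
    using KD(3)[OF that(1)] that inj_mem[OF KD(2)[OF that(1)]] by (auto simp: moved_def)
  have "card {h \<in> K. R \<union> h1 ` U1 \<subseteq> moved h \<and> (\<forall>x\<in>P \<union> U1. h x = h1 x)} * (weight k' ^ card U1 * \<beta> ^ card U1) \<le> c * \<beta> ^ card U1"
  proof (rule extension_bound)
    show "card (R \<union> h1 ` U1) = card R + card U1"
      using h1 finite_R finU inj by (subst card_Un_disjoint) (auto simp: card_image)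
    show "card (P \<union> U1) = card P + card U1" using U1 finite_P finU by (intro card_Un_disjoint) auto
    have "card U1 > 0" using U1 finU by (simp add: card_gt_0_iff)
    then show "0 < card U1 + card U1" by simp
    show "R \<union> h1 ` U1 \<subseteq> moved h1" using KD(3)[OF h1(1)] mv[OF h1(1)] U1 by blast
  qed (use h1 U1 KD[OF h1(1)] st_simps in auto)
  moreover have "{h \<in> K. R \<union> h1 ` U1 \<subseteq> moved h \<and> (\<forall>x\<in>P \<union> U1. h x = h1 x)} = {h \<in> K. \<forall>u\<in>U1. h u = h1 u}"
  proof -
    have "h1 u \<in> moved h" if "h \<in> K" "\<forall>u\<in>U1. h u = h1 u" "u \<in> U1" for h u
      using mv[of h u] that U1 by auto
    then have "R \<union> h1 ` U1 \<subseteq> moved h \<and> (\<forall>x\<in>P \<union> U1. h x = h1 x) \<longleftrightarrow> (\<forall>u\<in>U1. h u = h1 u)" if h: "h \<in> K" for h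
      using KD(3)[OF h] KP[OF h h1(1)] h by blast
    then show ?thesis by (intro Collect_cong conj_cong refl)
  qed
  ultimately have "(?N * weight k' ^ card U1) * \<beta> ^ card U1 \<le> c * \<beta> ^ card U1" by simp
  then have "?N * weight k' ^ card U1 \<le> c" using \<beta>(3) by simp
  moreover have "?N * (t ^ 199) ^ card U1 \<le> ?N * weight k' ^ card U1"
    using k'_range t2 by (intro mult_left_mono power_mono) auto
  ultimately show ?thesis by linarith
qed

end

section \<open>Points of \<open>R\<close> without prescribed image\<close>

context maximal_state begin

definition U where "U = R - P"
definition K0 where "K0 = {h \<in> K. h ` U \<inter> R = {}}"

lemma finite_U: "finite U" using finite_R by (simp add: U_def)

lemma card_R_le: "card R \<le> k" using st_simps(5) by simp

lemma K0D: "h \<in> K0 \<Longrightarrow> h \<in> K" "h \<in> K0 \<Longrightarrow> u \<in> U \<Longrightarrow> h u \<notin> R"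
  by (auto simp: K0_def)

lemma kreal: "real k \<le> t ^ 4" "real k \<ge> 300" using kt k300 by auto

lemma card_K_minus_K0: "2 * real (card (K - K0)) \<le> c"
proof -
  have "K - K0 \<subseteq> (\<Union>u\<in>U. \<Union>r\<in>R. {h \<in> K. h u = r})" by (auto simp: K0_def)
  then have "card (K - K0) \<le> card (\<Union>u\<in>U. \<Union>r\<in>R. {h \<in> K. h u = r})"
    using finite_U finite_R finite_K by (intro card_mono) auto
  also have "\<dots> \<le> (\<Sum>u\<in>U. \<Sum>r\<in>R. card {h \<in> K. h u = r})"
    by (intro order_trans[OF card_UN_le[OF finite_U]] sum_mono card_UN_le finite_R)
  finally have "real (card (K - K0)) \<le> real (\<Sum>u\<in>U. \<Sum>r\<in>R. card {h \<in> K. h u = r})" by (simp only: of_nat_le_iff)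
  also have "\<dots> = (\<Sum>u\<in>U. \<Sum>r\<in>R. real (card {h \<in> K. h u = r}))" by simp
  also have "\<dots> \<le> (\<Sum>u\<in>U. \<Sum>r\<in>R. c / \<beta>)"
    using label_bound \<beta>(3) by (intro sum_mono) (simp add: U_def pos_le_divide_eq)
  also have "\<dots> = real (card U) * real (card R) * (c / \<beta>)" by simp
  also have "\<dots> \<le> real k * real k * (c / \<beta>)"
    using card_R_le card_mono[OF finite_R, of U] \<beta>(3) by (intro mult_right_mono mult_mono) (auto simp: U_def)
  also have "\<dots> = c / k" using k300 by (simp add: \<beta>_def field_simps power3_eq_cube)
  also have "\<dots> \<le> c / 2" using k300 by (intro divide_left_mono) auto
  finally show ?thesis by simp
qed

lemma card_K0: "c \<le> 2 * real (card K0)"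
proof -
  have "card K = card K0 + card (K - K0)"
    using finite_K card_Diff_subset[of K0 K] card_mono[of K K0] by (auto simp: K0_def)
  then show ?thesis using card_K_minus_K0 by simp
qed

lemma K0_ne: "K0 \<noteq> {}" using card_K0 c_pos by auto

text \<open>A member of \<open>K0\<close> maps \<open>U\<close> injectively into the part of its
  support outside \<open>R\<close>.\<close>

lemma card_U_le: "card U \<le> k'"
proof -
  obtain h where h: "h \<in> K0" using K0_ne by blast
  then have hK: "h \<in> K" by (rule K0D)
  have "h ` U \<subseteq> moved h - R"
    using K0D(2)[OF h] KD(3)[OF hK] inj_mem[OF KD(2)[OF hK]] by (auto simp: U_def moved_def)
  moreover have "finite (moved h - R)" using finite_moved KD(2)[OF hK] by simp
  moreover have "inj_on h U" using inj_mem[OF KD(2)[OF hK]] by (auto simp: inj_on_def)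
  ultimately have "card U \<le> card (moved h - R)" using card_inj_on_le by blast
  then show ?thesis using KD(7)[OF hK] by simp
qed

text \<open>Members agree on \<open>P\<close>, so the quotient of two of them moves at most
  \<open>2 * (k - card P) = 2 * (k' + card U) <= 4 * k'\<close> points, which is less than the
  minimal degree.\<close>

lemma card_K_le_1: assumes "k' \<le> 2 * reserve + 2" shows "c \<le> 1"
proof -
  have "h1 = h2" if h: "h1 \<in> K" "h2 \<in> K" for h1 h2
  proof (rule ccontr)
    assume ne: "h1 \<noteq> h2"
    let ?D = "inv' h1 \<circ> h2"
    note G1 = KD(2)[OF h(1)] and G2 = KD(2)[OF h(2)]
    have "?D \<in> G" using G1 G2 by (intro comp_mem inv_mem)
    moreover have "?D \<noteq> id"
    proof
      assume "?D = id"
      then have "h1 (inv' h1 (h2 y)) = h1 y" for y by (metis comp_apply id_apply)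
      then show False using ne inv_apply(2)[OF G1] by auto
    qed
    ultimately have "m \<le> card (moved ?D)" by (rule min)
    also have "moved ?D \<subseteq> (moved h1 - P) \<union> (moved h2 - P)"
    proof
      fix y assume y: "y \<in> moved ?D"
      then have "h2 y \<noteq> h1 y" using inv_apply(1)[OF G1, of y] by (auto simp: moved_def)
      then have "y \<notin> P" using KP[OF h] by metis
      moreover have "y \<in> moved h1 \<union> moved h2" using \<open>h2 y \<noteq> h1 y\<close> by (auto simp: moved_def)
      ultimately show "y \<in> (moved h1 - P) \<union> (moved h2 - P)" by blast
    qed
    then have "card (moved ?D) \<le> card ((moved h1 - P) \<union> (moved h2 - P))"
      using finite_moved[OF G1] finite_moved[OF G2] by (intro card_mono) auto
    also have "\<dots> \<le> card (moved h1 - P) + card (moved h2 - P)" by (rule card_Un_le)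
    also have "card (moved h1 - P) = k - card P"
      using KD(3,6)[OF h(1)] st_simps(2) finite_P by (subst card_Diff_subset) auto
    also have "card (moved h2 - P) = k - card P"
      using KD(3,6)[OF h(2)] st_simps(2) finite_P by (subst card_Diff_subset) auto
    also have "k - card P = k' + card U"
      using st_simps(2) finite_P card_R_le card_mono[OF finite_R st_simps(2)]
      by (simp add: k'_def U_def card_Diff_subset)
    finally have "m \<le> 4 * k'" using card_U_le by simp
    then show False using assms m300 by (simp add: reserve_def)
  qed
  then have "card K \<le> 1" using card_le_Suc0_iff_eq[OF finite_K] by auto
  then show ?thesis by simp
qed

text \<open>Union bound: a point outside \<open>R\<close> is moved by a proportion of at most
  \<open>1 / t ^ 187\<close> of \<open>K\<close>, whereas \<open>K0\<close> is at least half of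
  \<open>K\<close>.\<close>

lemma ex_avoiding:
  assumes "finite \<Xi>" "\<Xi> \<inter> R = {}" "card \<Xi> \<le> 10 * k" "1 + reserve \<le> k'"
  shows "\<exists>h\<in>K0. moved h \<inter> \<Xi> = {}"
proof (rule ccontr)
  assume "\<not> ?thesis"
  then have "K0 \<subseteq> (\<Union>a\<in>\<Xi>. {h \<in> K. {a} \<subseteq> moved h})" using K0D(1) by blast
  then have "card K0 \<le> card (\<Union>a\<in>\<Xi>. {h \<in> K. {a} \<subseteq> moved h})"
    using finite_K assms(1) by (intro card_mono) auto
  also have "\<dots> \<le> (\<Sum>a\<in>\<Xi>. card {h \<in> K. {a} \<subseteq> moved h})" by (rule card_UN_le[OF assms(1)])
  finally have "real (card K0) \<le> (\<Sum>a\<in>\<Xi>. real (card {h \<in> K. {a} \<subseteq> moved h}))"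
    by (simp only: of_nat_le_iff flip: of_nat_sum)
  also have "\<dots> \<le> (\<Sum>a\<in>\<Xi>. c / t ^ 187)"
  proof (rule sum_mono)
    fix a assume "a \<in> \<Xi>"
    then have "card {h \<in> K. {a} \<subseteq> moved h} * (t ^ 187) ^ card {a} \<le> c"
      using assms by (intro many_points_bound) auto
    then show "real (card {h \<in> K. {a} \<subseteq> moved h}) \<le> c / t ^ 187" using t2 by (simp add: pos_le_divide_eq)
  qed
  also have "\<dots> \<le> 10 * t ^ 4 * (c / t ^ 187)"
  proof -
    have "real (card \<Xi>) \<le> 10 * real k" using assms(3) by linarith
    then have "real (card \<Xi>) \<le> 10 * t ^ 4" using kreal by linarith
    then have "real (card \<Xi>) * (c / t ^ 187) \<le> 10 * t ^ 4 * (c / t ^ 187)"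
      using t2 by (intro mult_right_mono) auto
    then show ?thesis by simp
  qed
  also have "\<dots> \<le> c / 4"
  proof -
    have "(2::real) ^ 6 \<le> t ^ 6" using t2 by (intro power_mono) auto
    moreover have "t ^ 6 \<le> t ^ 183" using t2 by (intro power_increasing) auto
    ultimately have "40 \<le> t ^ 183" by simp
    then have "40 * t ^ 4 * c \<le> t ^ 183 * t ^ 4 * c" using t2 by (intro mult_right_mono) auto
    also have "t ^ 183 * t ^ 4 = t ^ 187" by (simp flip: power_add)
    finally show ?thesis using t2 by (simp add: field_simps)
  qed
  finally show False using card_K0 c_pos by simp
qed

text \<open>If \<open>U\<close> is empty, the members of the family agree on the closed set \<open>R\<close> and are otherwise spread
  out. Two of them that meet outside \<open>R\<close> in at most two points commute, so they share a transposition.\<close>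

lemma overlap_cases:
  assumes U: "U = {}" and h: "h1 \<in> K" "h2 \<in> K"
  defines "I \<equiv> moved h1 \<inter> moved h2 - R"
  shows "card I \<le> card {(a, b). a \<in> I \<and> b \<in> I \<and> a \<noteq> b \<and> h1 a = b \<and> h1 b = a \<and> h2 a = b \<and> h2 b = a}
    + card {(a, b, d). a \<in> I \<and> b \<in> I \<and> d \<in> I \<and> a \<noteq> b \<and> a \<noteq> d \<and> b \<noteq> d}"
    (is "_ \<le> card ?A + card ?B")
proof -
  note G1 = KD(2)[OF h(1)] and G2 = KD(2)[OF h(2)]
  note i1 = inv_apply[OF G1] and i2 = inv_apply[OF G2]
  have finI: "finite I" using finite_moved[OF G1] by (simp add: I_def)
  have RP: "R = P" using U st_simps(2) by (auto simp: U_def)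
  have finA: "finite ?A" by (rule finite_subset[OF _ finite_cartesian_product[OF finI finI]]) auto
  have finB: "finite ?B" by (rule finite_subset[OF _ finite_cartesian_product[OF finI finite_cartesian_product[OF finI finI]]]) auto
  show ?thesis
  proof (cases "card I \<le> 2")
    case False
    then have "card {..<3::nat} \<le> card I" by simp
    then obtain T where T: "T \<subseteq> I" "card T = 3" using obtain_subset_with_card_n[of 3 I] False by auto
    \<comment> \<open>With at least three common points, each of them starts a triple of distinct
      common points, so the second summand alone suffices.\<close>
    have "\<exists>f. f ` I \<subseteq> ?B \<and> inj_on f I"
    proof -
      have "\<exists>b d. b \<in> I \<and> d \<in> I \<and> a \<noteq> b \<and> a \<noteq> d \<and> b \<noteq> d" if a: "a \<in> I" for a
      proof -
        have "card (I - {a}) \<ge> 2" using a finI False by simp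
        then obtain b d where "b \<in> I - {a}" "d \<in> I - {a}" "b \<noteq> d"
          using finI card_le_Suc0_iff_eq[of "I - {a}"] by auto
        then show ?thesis by blast
      qed
      then obtain b d where "\<And>a. a \<in> I \<Longrightarrow> b a \<in> I \<and> d a \<in> I \<and> a \<noteq> b a \<and> a \<noteq> d a \<and> b a \<noteq> d a" by metis
      then show ?thesis by (intro exI[of _ "\<lambda>a. (a, b a, d a)"]) (auto simp: inj_on_def)
    qed
    then have "card I \<le> card ?B" using finB card_inj_on_le by blast
    then show ?thesis by simp
  next
    case True
    have fixR: "h1 x \<in> R" "h2 x = h1 x" if "x \<in> R" for x
      using that KD(5)[OF h(1)] KP[OF h] RP by auto
    have R1: "h1 ` R = R"
      by (rule endo_inj_surj[OF finite_R]) (use fixR inj_mem[OF G1] in \<open>auto simp: inj_on_def\<close>)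
    have R2: "h2 ` R = R" using R1 fixR(2) by (simp cong: image_cong)
    define z where "z = h2 \<circ> h1 \<circ> inv' h2 \<circ> inv' h1"
    have zG: "z \<in> G"
      unfolding z_def by (rule comp_mem[OF comp_mem[OF comp_mem[OF G2 G1] inv_mem[OF G2]] inv_mem[OF G1]])
    have zR: "z y = y" if "y \<in> R" for y
    proof -
      have "y \<in> h1 ` R" using that by (simp only: R1)
      then obtain x where x: "y = h1 x" "x \<in> R" by (rule imageE)
      have "x \<in> h1 ` R" using x(2) by (simp only: R1)
      then obtain x' where x': "x = h1 x'" "x' \<in> R" by (rule imageE)
      have "inv' h1 y = x" using x(1) i1(1)[of x] by simp
      moreover have "inv' h2 x = x'" using x'(1) fixR(2)[OF x'(2)] i2(1)[of x'] by simp
      ultimately show ?thesis using x x' fixR(2)[OF x(2)] by (simp add: z_def)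
    qed
    \<comment> \<open>Both members induce the same permutation of \<open>R\<close>, so the
      commutator is trivial there; it moves at most 6 points in all and must be the
      identity.\<close>
    have "moved z \<subseteq> I \<union> h1 ` I \<union> h2 ` I"
    proof
      fix y assume y: "y \<in> moved z"
      then have "y \<notin> R" using zR by (auto simp: moved_def)
      moreover have "y \<in> (moved h1 \<inter> moved h2) \<union> h1 ` (moved h1 \<inter> moved h2) \<union> h2 ` (moved h1 \<inter> moved h2)"
        using y moved_commutator_subset[OF G1 G2] unfolding z_def by blast
      moreover have "h1 x \<in> R" "h2 x \<in> R" if "x \<in> R" for x using fixR that by auto
      ultimately show "y \<in> I \<union> h1 ` I \<union> h2 ` I" unfolding I_def by blast
    qed
    then have "card (moved z) \<le> card (I \<union> h1 ` I \<union> h2 ` I)" using finI by (intro card_mono) auto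
    also have "\<dots> \<le> card I + card (h1 ` I) + card (h2 ` I)"
      by (rule order_trans[OF card_Un_le]) (intro add_right_mono card_Un_le)
    also have "\<dots> \<le> 6" using True card_image_le[OF finI, of h1] card_image_le[OF finI, of h2] by linarith
    finally have "z = id" using min[OF zG] m300 by force
    have comm: "h2 (h1 x) = h1 (h2 x)" for x
    proof -
      have "z (h1 (h2 x)) = h2 (h1 x)" using i1 i2 by (simp add: z_def)
      then show ?thesis using \<open>z = id\<close> by simp
    qed
    \<comment> \<open>Commuting permutations preserve each other's supports, so \<open>I\<close> is
      closed under both. Having at most two points and no fixed ones, it is a common transposition
      unless empty.\<close>
    have I1: "h1 a \<in> I" "h2 a \<in> I" "h1 a \<noteq> a" "h2 a \<noteq> a" if a: "a \<in> I" for a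
    proof -
      show 1: "h1 a \<noteq> a" and 2: "h2 a \<noteq> a" using a by (auto simp: I_def moved_def)
      have "a \<notin> R" using a by (simp add: I_def)
      then have "h1 a \<notin> h1 ` R" "h2 a \<notin> h2 ` R" using inj_mem[OF G1] inj_mem[OF G2] by auto
      then have "h1 a \<notin> R" "h2 a \<notin> R" by (simp_all only: R1 R2 not_False_eq_True)
      moreover have "h2 (h1 a) \<noteq> h1 a" "h1 (h2 a) \<noteq> h2 a"
        using comm[of a] 1 2 inj_mem[OF G1] inj_mem[OF G2] by metis+
      ultimately show "h1 a \<in> I" "h2 a \<in> I" using 1 2 inj_mem[OF G1] inj_mem[OF G2] by (auto simp: I_def moved_def)
    qed
    have "\<exists>b. (a, b) \<in> ?A" if a: "a \<in> I" for a
    proof -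
      have "x = a \<or> x = h1 a" if "x \<in> I" for x
      proof (rule ccontr)
        assume "\<not> ?thesis"
        then have "card {a, h1 a, x} = 3" using I1[OF a] by auto
        moreover have "card {a, h1 a, x} \<le> card I" using I1[OF a] a that finI by (intro card_mono) auto
        ultimately show False using True by simp
      qed
      then have "h2 a = h1 a" "h1 (h1 a) = a" "h2 (h1 a) = a"
        using I1[OF a] I1[OF I1(1)[OF a]] by metis+
      then show ?thesis using I1[OF a] a by (intro exI[of _ "h1 a"]) auto
    qed
    then have "I \<subseteq> fst ` ?A" by force
    then have "card I \<le> card (fst ` ?A)" using finA by (intro card_mono) auto
    also have "\<dots> \<le> card ?A" using finA by (rule card_image_le)
    finally show ?thesis by simp
  qed
qed

end

section \<open>Second moments and the case \<open>P = R\<close>\<close>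

lemma sum_squared_le_card_times:
  fixes f :: "'b \<Rightarrow> real"
  shows "(\<Sum>a\<in>D. f a)\<^sup>2 \<le> (\<Sum>a\<in>D. (f a)\<^sup>2) * card D"
proof -
  have "0 \<le> (\<Sum>a\<in>D. \<Sum>b\<in>D. (f a - f b)\<^sup>2)" by (intro sum_nonneg) simp
  also have "\<dots> = (\<Sum>a\<in>D. \<Sum>b\<in>D. (f a)\<^sup>2 + (f b)\<^sup>2 - 2 * (f a * f b))"
    by (simp add: power2_diff mult.assoc)
  also have "\<dots> = (\<Sum>a\<in>D. (f a)\<^sup>2) * card D + (\<Sum>a\<in>D. (f a)\<^sup>2) * card D - 2 * (\<Sum>a\<in>D. \<Sum>b\<in>D. f a * f b)"
    by (simp add: sum_subtractf sum.distrib sum_distrib_left sum_distrib_right mult.commute)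
  also have "(\<Sum>a\<in>D. \<Sum>b\<in>D. f a * f b) = (\<Sum>a\<in>D. f a)\<^sup>2"
    by (simp add: sum_product power2_eq_square)
  finally show ?thesis by (simp add: mult.commute)
qed

lemma sum_pairs_card:
  assumes "finite K" "finite D"
  shows "(\<Sum>h1\<in>K. \<Sum>h2\<in>K. card {p \<in> D. s h1 p \<and> s h2 p}) = (\<Sum>p\<in>D. (card {h \<in> K. s h p})\<^sup>2)"
proof -
  have "(\<Sum>h1\<in>K. \<Sum>h2\<in>K. card {p \<in> D. s h1 p \<and> s h2 p})
      = (\<Sum>h1\<in>K. \<Sum>h2\<in>K. \<Sum>p\<in>D. of_bool (s h1 p) * of_bool (s h2 p))"
    using assms(2) by (intro sum.cong refl)
      (simp only: of_bool_conj[symmetric], simp add: of_bool_def flip: sum.inter_filter)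
  also have "\<dots> = (\<Sum>h1\<in>K. \<Sum>p\<in>D. \<Sum>h2\<in>K. of_bool (s h1 p) * of_bool (s h2 p))"
    by (intro sum.cong refl sum.swap)
  also have "\<dots> = (\<Sum>p\<in>D. \<Sum>h1\<in>K. \<Sum>h2\<in>K. of_bool (s h1 p) * of_bool (s h2 p))"
    by (rule sum.swap)
  also have "\<dots> = (\<Sum>p\<in>D. (card {h \<in> K. s h p})\<^sup>2)"
  proof (intro sum.cong refl)
    fix p
    have "card {h \<in> K. s h p} = (\<Sum>h\<in>K. of_bool (s h p))"
      using assms(1) by (simp add: of_bool_def flip: sum.inter_filter)
    then show "(\<Sum>h1\<in>K. \<Sum>h2\<in>K. of_bool (s h1 p) * of_bool (s h2 p)) = (card {h \<in> K. s h p})\<^sup>2"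
      by (simp add: power2_eq_square sum_product)
  qed
  finally show ?thesis .
qed

lemma sum_card_swap:
  assumes "finite K" "finite D"
  shows "(\<Sum>p\<in>D. card {h \<in> K. s h p}) = (\<Sum>h\<in>K. card {p \<in> D. s h p})"
proof -
  have "(\<Sum>p\<in>D. card {h \<in> K. s h p}) = (\<Sum>p\<in>D. \<Sum>h\<in>K. of_bool (s h p))"
    using assms(1) by (simp add: of_bool_def flip: sum.inter_filter)
  also have "\<dots> = (\<Sum>h\<in>K. \<Sum>p\<in>D. of_bool (s h p))" by (rule sum.swap)
  also have "\<dots> = (\<Sum>h\<in>K. card {p \<in> D. s h p})"
    using assms(2) by (simp add: of_bool_def flip: sum.inter_filter)
  finally show ?thesis .
qed

lemma sum_squares_card_le:
  fixes q B :: real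
  assumes fin: "finite K" "finite D" and q: "\<And>p. p \<in> D \<Longrightarrow> card {h \<in> K. s h p} \<le> q" "q \<ge> 0"
    and B: "\<And>h. h \<in> K \<Longrightarrow> card {p \<in> D. s h p} \<le> B"
  shows "real (\<Sum>p\<in>D. (card {h \<in> K. s h p})\<^sup>2) \<le> q * (card K * B)"
proof -
  have "real (\<Sum>p\<in>D. (card {h \<in> K. s h p})\<^sup>2) = (\<Sum>p\<in>D. real (card {h \<in> K. s h p}) * real (card {h \<in> K. s h p}))"
    by (simp add: power2_eq_square)
  also have "\<dots> \<le> (\<Sum>p\<in>D. q * real (card {h \<in> K. s h p}))" using q by (intro sum_mono mult_right_mono) auto
  also have "\<dots> = q * real (\<Sum>p\<in>D. card {h \<in> K. s h p})" by (simp add: sum_distrib_left)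
  also have "\<dots> = q * (\<Sum>h\<in>K. real (card {p \<in> D. s h p}))" unfolding sum_card_swap[OF fin] by simp
  also have "\<dots> \<le> q * (\<Sum>h\<in>K. B)" using q B by (intro mult_left_mono sum_mono) auto
  finally show ?thesis by simp
qed

context maximal_state begin

text \<open>By Cauchy-Schwarz the overlaps outside \<open>R\<close>, summed over all pairs of
  members, amount to at least \<open>c\<^sup>2 * k'\<^sup>2 / n\<close>. By
  \<open>overlap_cases\<close> they are accounted for by shared transpositions, at most
  \<open>c\<^sup>2 * k' * sqrt k' / n\<close>, and by shared triples, which are negligible since
  \<open>t ^ 561\<close> far exceeds n. Here the exponent 1/4 of \<open>weight\<close> matters:
  \<open>k' * sqrt k'\<close> is of smaller order than \<open>k'\<^sup>2\<close>.\<close>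

lemma no_closed_state:
  assumes U: "U = {}" and k': "3 + reserve \<le> k'"
  shows False
proof -
  define n where "n = real (card \<Omega>)"
  define D1 where "D1 = \<Omega> - R"
  define D2 where "D2 = {(a, b) \<in> D1 \<times> D1. a \<noteq> b}"
  define D3 where "D3 = {(a, b, d) \<in> D1 \<times> D1 \<times> D1. a \<noteq> b \<and> a \<noteq> d \<and> b \<noteq> d}"
  define s1 where "s1 h a \<longleftrightarrow> a \<in> moved h" for h :: "'a \<Rightarrow> 'a" and a
  define s2 where "s2 h p \<longleftrightarrow> h (fst p) = snd p \<and> h (snd p) = fst p" for h :: "'a \<Rightarrow> 'a" and p
  define s3 where "s3 h p \<longleftrightarrow> {fst p, fst (snd p), snd (snd p)} \<subseteq> moved h" for h :: "'a \<Rightarrow> 'a" and p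
  have fin: "finite D1" "finite D2" "finite D3"
  proof -
    show 1: "finite D1" using finite_\<Omega> by (simp add: D1_def)
    show "finite D2" by (rule finite_subset[OF _ finite_cartesian_product[OF 1 1]]) (auto simp: D2_def)
    show "finite D3" by (rule finite_subset[OF _ finite_cartesian_product[OF 1 finite_cartesian_product[OF 1 1]]]) (auto simp: D3_def)
  qed
  have mvD: "moved h - R \<subseteq> D1" "finite (moved h - R)" if "h \<in> K" for h
    using moved_subset[OF KD(2)[OF that]] finite_moved[OF KD(2)[OF that]] by (auto simp: D1_def)
  have n: "n = t ^ 400" using tn by (simp add: n_def)
  then have "n > 0" using t2 by simp
  note n = n this
  let ?I = "\<lambda>h1 h2. moved h1 \<inter> moved h2 - R"
  have eqI: "?I h1 h2 = {a \<in> D1. s1 h1 a \<and> s1 h2 a}" if "h1 \<in> K" for h1 h2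
    using mvD[OF that] by (auto simp: s1_def D1_def)
  have pairs: "card (?I h1 h2) \<le> card {p \<in> D2. s2 h1 p \<and> s2 h2 p} + card {p \<in> D3. s3 h1 p \<and> s3 h2 p}"
    if h: "h1 \<in> K" "h2 \<in> K" for h1 h2
  proof -
    have ID: "?I h1 h2 \<subseteq> D1" using mvD(1)[OF h(1)] by blast
    have "card {(a, b). a \<in> ?I h1 h2 \<and> b \<in> ?I h1 h2 \<and> a \<noteq> b \<and> h1 a = b \<and> h1 b = a \<and> h2 a = b \<and> h2 b = a}
        \<le> card {p \<in> D2. s2 h1 p \<and> s2 h2 p}"
      using ID fin(2) by (intro card_mono) (auto simp: D2_def s2_def)
    moreover have "card {(a, b, d). a \<in> ?I h1 h2 \<and> b \<in> ?I h1 h2 \<and> d \<in> ?I h1 h2 \<and> a \<noteq> b \<and> a \<noteq> d \<and> b \<noteq> d}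
        \<le> card {p \<in> D3. s3 h1 p \<and> s3 h2 p}"
      using ID fin(3) by (intro card_mono) (auto simp: D3_def s3_def)
    ultimately show ?thesis using overlap_cases[OF U h] by linarith
  qed
  have "(\<Sum>a\<in>D1. (card {h \<in> K. s1 h a})\<^sup>2) = (\<Sum>h1\<in>K. \<Sum>h2\<in>K. card (?I h1 h2))"
    unfolding sum_pairs_card[OF finite_K fin(1), symmetric] by (intro sum.cong refl) (simp add: eqI)
  also have "\<dots> \<le> (\<Sum>h1\<in>K. \<Sum>h2\<in>K. card {p \<in> D2. s2 h1 p \<and> s2 h2 p} + card {p \<in> D3. s3 h1 p \<and> s3 h2 p})"
    by (intro sum_mono pairs)
  also have "\<dots> = (\<Sum>p\<in>D2. (card {h \<in> K. s2 h p})\<^sup>2) + (\<Sum>p\<in>D3. (card {h \<in> K. s3 h p})\<^sup>2)"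
    by (simp add: sum.distrib sum_pairs_card[OF finite_K fin(2)] sum_pairs_card[OF finite_K fin(3)])
  finally have "real (\<Sum>a\<in>D1. (card {h \<in> K. s1 h a})\<^sup>2) \<le>
      real ((\<Sum>p\<in>D2. (card {h \<in> K. s2 h p})\<^sup>2) + (\<Sum>p\<in>D3. (card {h \<in> K. s3 h p})\<^sup>2))"
    by (simp only: of_nat_le_iff)
  then have main: "real (\<Sum>a\<in>D1. (card {h \<in> K. s1 h a})\<^sup>2) \<le>
      real (\<Sum>p\<in>D2. (card {h \<in> K. s2 h p})\<^sup>2) + real (\<Sum>p\<in>D3. (card {h \<in> K. s3 h p})\<^sup>2)"
    by (simp only: of_nat_add)
  have b2: "real (\<Sum>p\<in>D2. (card {h \<in> K. s2 h p})\<^sup>2) \<le> (c * sqrt k' / n) * (c * k')"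
  proof (rule sum_squares_card_le[OF finite_K fin(2)])
    fix p assume "p \<in> D2"
    then obtain a b where p: "p = (a, b)" "a \<notin> R" "b \<notin> R" "a \<noteq> b" by (auto simp: D2_def D1_def)
    then have "card {h \<in> K. h a = b \<and> h b = a} * n \<le> c * sqrt k'"
      unfolding n_def using k' by (intro swap_bound) auto
    then show "card {h \<in> K. s2 h p} \<le> c * sqrt k' / n" using n by (simp add: p s2_def pos_le_divide_eq)
  next
    fix h assume h: "h \<in> K"
    have "fst ` {p \<in> D2. s2 h p} \<subseteq> moved h - R" by (auto simp: D2_def D1_def s2_def moved_def)
    moreover have "inj_on fst {p \<in> D2. s2 h p}" by (auto simp: inj_on_def s2_def)
    ultimately have "card {p \<in> D2. s2 h p} \<le> card (moved h - R)" using mvD(2)[OF h] card_inj_on_le by blast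
    then show "real (card {p \<in> D2. s2 h p}) \<le> k'" using KD(7)[OF h] by simp
  qed (use n in auto)
  have b3: "real (\<Sum>p\<in>D3. (card {h \<in> K. s3 h p})\<^sup>2) \<le> (c / t ^ 561) * (c * real k' ^ 3)"
  proof (rule sum_squares_card_le[OF finite_K fin(3)])
    fix p assume "p \<in> D3"
    then obtain a b d where p: "p = (a, b, d)" "a \<notin> R" "b \<notin> R" "d \<notin> R" "a \<noteq> b" "a \<noteq> d" "b \<noteq> d"
      by (auto simp: D3_def D1_def)
    then have c3: "card {a, b, d} = 3" by simp
    have "card {h \<in> K. {a, b, d} \<subseteq> moved h} * (t ^ 187) ^ card {a, b, d} \<le> c"
      using p k' c3 by (intro many_points_bound) auto
    moreover have "(t ^ 187) ^ 3 = t ^ 561" by (simp flip: power_mult)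
    ultimately have "card {h \<in> K. {a, b, d} \<subseteq> moved h} * t ^ 561 \<le> c" using c3 by simp
    then show "card {h \<in> K. s3 h p} \<le> c / t ^ 561" using t2 by (simp add: p s3_def pos_le_divide_eq)
  next
    fix h assume h: "h \<in> K"
    let ?M = "moved h - R"
    have "card {p \<in> D3. s3 h p} \<le> card (?M \<times> ?M \<times> ?M)"
      using mvD(2)[OF h] by (intro card_mono) (auto simp: D3_def D1_def s3_def)
    then have "real (card {p \<in> D3. s3 h p}) \<le> real (card (?M \<times> ?M \<times> ?M))" by (simp only: of_nat_le_iff)
    then show "real (card {p \<in> D3. s3 h p}) \<le> real k' ^ 3"
      using KD(7)[OF h] by (simp add: card_cartesian_product power3_eq_cube)
  qed (use t2 in auto)
  have "real (\<Sum>a\<in>D1. card {h \<in> K. s1 h a}) = c * k'"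
  proof -
    have "{a \<in> D1. s1 h a} = moved h - R" if "h \<in> K" for h using mvD(1)[OF that] by (auto simp: s1_def D1_def)
    then show ?thesis unfolding sum_card_swap[OF finite_K fin(1)] using KD(7) by simp
  qed
  then have "(c * k')\<^sup>2 = (\<Sum>a\<in>D1. real (card {h \<in> K. s1 h a}))\<^sup>2" by simp
  also have "\<dots> \<le> (\<Sum>a\<in>D1. (real (card {h \<in> K. s1 h a}))\<^sup>2) * card D1"
    by (rule sum_squared_le_card_times)
  also have "\<dots> = real (\<Sum>a\<in>D1. (card {h \<in> K. s1 h a})\<^sup>2) * card D1" by simp
  also have "\<dots> \<le> ((c * sqrt k' / n) * (c * k') + (c / t ^ 561) * (c * real k' ^ 3)) * n"
  proof (intro mult_mono)
    show "real (card D1) \<le> n" unfolding n_def using finite_\<Omega> by (auto simp: D1_def intro: card_mono)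
  qed (use main b2 b3 n t2 in auto)
  also have "\<dots> = c\<^sup>2 * (k' * sqrt k' + real k' ^ 3 * (n / t ^ 561))"
    using n(2) by (simp add: power2_eq_square distrib_left distrib_right)
  finally have "c\<^sup>2 * (real k')\<^sup>2 \<le> c\<^sup>2 * (k' * sqrt k' + real k' ^ 3 * (n / t ^ 561))"
    by (simp only: power_mult_distrib)
  then have "(real k')\<^sup>2 \<le> k' * sqrt k' + real k' ^ 3 * (n / t ^ 561)"
    using c_pos by (simp only: mult_le_cancel_left_pos zero_less_power)
  moreover have "real k' ^ 3 * (n / t ^ 561) \<le> 1"
  proof -
    have "real k' ^ 3 \<le> (t ^ 4) ^ 3" using k'_range(2) kt by (intro power_mono) auto
    also have "\<dots> = t ^ 12" by (simp flip: power_mult)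
    also have "\<dots> \<le> t ^ 161" using t2 by (intro power_increasing) auto
    finally have "real k' ^ 3 * t ^ 400 \<le> t ^ 161 * t ^ 400" using t2 by (intro mult_right_mono) auto
    also have "t ^ 161 * t ^ 400 = t ^ 561" by (simp flip: power_add)
    finally show ?thesis using t2 by (simp add: n)
  qed
  ultimately have "(real k')\<^sup>2 \<le> k' * sqrt k' + 1" by simp
  moreover define s where "s = sqrt (real k')"
  have "s * s = k'" by (simp add: s_def)
  moreover have "s \<ge> 2"
    unfolding s_def by (rule real_le_rsqrt) (use k' reserve_pos in simp)
  ultimately have "(s * s)\<^sup>2 \<le> (s * s) * s + 1" by (simp add: s_def)
  then have "(s * s * s) * s \<le> s * s * s + 1" by (simp add: power2_eq_square algebra_simps)
  moreover have "(2 * 2) * 2 \<le> s * s * s" using \<open>s \<ge> 2\<close> by (intro mult_mono) auto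
  moreover have "(s * s * s) * 2 \<le> (s * s * s) * s" using \<open>s \<ge> 2\<close> by (intro mult_left_mono) auto
  ultimately show False by linarith
qed

section \<open>Fresh elements, traces and the case \<open>P \<noteq> R\<close>\<close>

lemma ex_fresh:
  assumes "finite \<Xi>" "\<Xi> \<inter> R = {}" "card \<Xi> \<le> 8 * k" "1 + reserve \<le> k'"
  shows "\<exists>g\<in>G. moved g \<inter> R = U \<and> g ` U \<inter> R = {} \<and> moved g \<inter> \<Xi> = {} \<and> card (moved g) \<le> 2 * k"
proof -
  obtain h1 where h1: "h1 \<in> K0" "moved h1 \<inter> \<Xi> = {}" using ex_avoiding[of \<Xi>] assms by auto
  note K1 = K0D(1)[OF h1(1)]
  note G1 = KD(2)[OF K1]
  have c1: "card (moved h1 - R) \<le> k" using KD(7)[OF K1] k'_range by simp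
  have "card (\<Xi> \<union> (moved h1 - R)) \<le> 10 * k"
    using card_Un_le[of \<Xi> "moved h1 - R"] c1 assms(3) by linarith
  moreover have "finite (\<Xi> \<union> (moved h1 - R))" "(\<Xi> \<union> (moved h1 - R)) \<inter> R = {}"
    using assms finite_moved[OF G1] by auto
  ultimately obtain h2 where h2: "h2 \<in> K0" "moved h2 \<inter> (\<Xi> \<union> (moved h1 - R)) = {}"
    using ex_avoiding assms(4) by blast
  note K2 = K0D(1)[OF h2(1)]
  note G2 = KD(2)[OF K2]
  \<comment> \<open>The quotient of two members with disjoint supports outside \<open>R\<close>: it
    is trivial on \<open>P\<close>, where they agree, and acts on \<open>U\<close> like
    \<open>h2\<close>, since \<open>h1\<close> fixes the images of \<open>U\<close> under
    \<open>h2\<close>.\<close>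
  define g where "g = inv' h1 \<circ> h2"
  have gG: "g \<in> G" unfolding g_def by (rule comp_mem[OF inv_mem[OF G1] G2])
  have gP: "g x = x" if "x \<in> P" for x
    using KP[OF K2 K1 that] inv_apply(1)[OF G1, of x] by (simp add: g_def)
  have gU: "g u = h2 u" "g u \<notin> R" "g u \<noteq> u" if u: "u \<in> U" for u
  proof -
    have nR: "h2 u \<notin> R" using K0D(2)[OF h2(1) u] .
    have "u \<in> moved h2" using KD(3)[OF K2] u by (auto simp: U_def)
    then have "h2 u \<in> moved h2" using inj_mem[OF G2] by (simp add: moved_def)
    then have "h2 u \<notin> moved h1" using h2(2) nR by blast
    then have "inv' h1 (h2 u) = h2 u" using inv_apply(1)[OF G1, of "h2 u"] by (simp add: moved_def)
    then show "g u = h2 u" by (simp add: g_def)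
    then show "g u \<notin> R" using nR by simp
    then show "g u \<noteq> u" using u by (auto simp: U_def)
  qed
  have sub: "moved g \<subseteq> moved h1 \<union> moved h2"
  proof
    fix y assume y: "y \<in> moved g"
    show "y \<in> moved h1 \<union> moved h2"
    proof (rule ccontr)
      assume "y \<notin> moved h1 \<union> moved h2"
      then have "h2 y = y" "h1 y = y" by (auto simp: moved_def)
      then have "g y = y" using inv_apply(1)[OF G1, of y] by (simp add: g_def)
      with y show False by (simp add: moved_def)
    qed
  qed
  have "moved g \<inter> R = U"
  proof
    show "moved g \<inter> R \<subseteq> U" using gP by (auto simp: U_def moved_def)
    show "U \<subseteq> moved g \<inter> R" using gU(3) by (auto simp: moved_def) (simp add: U_def)
  qed
  moreover have "g ` U \<inter> R = {}" using gU(2) by blast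
  moreover have "moved g \<inter> \<Xi> = {}" using sub h1(2) h2(2) by blast
  moreover have "card (moved g) \<le> 2 * k"
  proof -
    have "card (moved g) \<le> card (moved h1 \<union> moved h2)"
      using sub finite_moved[OF G1] finite_moved[OF G2] by (intro card_mono) auto
    also have "\<dots> \<le> card (moved h1) + card (moved h2)" by (rule card_Un_le)
    finally show ?thesis using KD(6)[OF K1] KD(6)[OF K2] by simp
  qed
  ultimately show ?thesis using gG by blast
qed

text \<open>The disjointness condition makes \<open>commutator_three_cycles\<close> applicable, and
  the bound \<open>3 * k\<close> is preserved by commutators with fresh elements while leaving room
  within the \<open>8 * k\<close> points that a fresh element can avoid.\<close>

definition traces :: "'a set set"
  where "traces = {V. V \<subseteq> U \<and> (\<exists>d\<in>G. moved d \<inter> R = V \<and> d ` V \<inter> V = {} \<and> card (moved d) \<le> 3 * k)}"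

lemma moved_image_mem: "g \<in> G \<Longrightarrow> x \<in> moved g \<Longrightarrow> g x \<in> moved g"
  using inj_mem by (simp add: moved_def)

lemma card_moved_diff_le: "g \<in> G \<Longrightarrow> card (moved g) \<le> j \<Longrightarrow> card (moved g - A) \<le> j"
  using card_mono[OF finite_moved, of g "moved g - A"] by auto

lemma card_le_k: "V \<subseteq> U \<Longrightarrow> card V \<le> k"
  using card_mono[OF finite_U, of V] card_U_le k'_range by linarith

text \<open>The commutator with a fresh element meeting the support of \<open>d\<close> exactly in
  \<open>V\<close> is nontrivial and moves at most \<open>3 * card V\<close> points.\<close>

lemma trace_card:
  assumes "V \<in> traces" "V \<noteq> {}" "1 + reserve \<le> k'" shows "m \<le> 3 * card V"
proof -
  obtain d where d: "d \<in> G" "moved d \<inter> R = V" "d ` V \<inter> V = {}" "card (moved d) \<le> 3 * k" and V: "V \<subseteq> U"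
    using assms by (auto simp: traces_def)
  obtain g where g: "g \<in> G" "moved g \<inter> R = U" "g ` U \<inter> R = {}" "moved g \<inter> (moved d - R) = {}"
  proof -
    have "finite (moved d - R)" "(moved d - R) \<inter> R = {}" "card (moved d - R) \<le> 8 * k"
      using finite_moved[OF d(1)] card_moved_diff_le[OF d(1,4), of R] by auto
    from ex_fresh[OF this assms(3)] show ?thesis using that by auto
  qed
  have W: "V = moved d \<inter> moved g" using d(2) g(2,4) V by blast
  have "g ` V \<inter> V = {}" using g(3) V by (auto simp: U_def)
  note z = commutator_three_cycles[OF d(1) g(1) W d(3) this]
  show ?thesis using min[OF z(1) z(8)[OF assms(2)]] z(6) by simp
qed

text \<open>Commutators with fresh elements push an element away from any given set outside \<open>R\<close>, so that the
  commutator of two elements only involves the intersection of their traces.\<close>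

lemma trace_Int:
  assumes V: "V \<in> traces" "V' \<in> traces" "1 + reserve \<le> k'" shows "V \<inter> V' \<in> traces"
proof -
  obtain d where d: "d \<in> G" "moved d \<inter> R = V" "d ` V \<inter> V = {}" "card (moved d) \<le> 3 * k" and VU: "V \<subseteq> U"
    using V by (auto simp: traces_def)
  obtain e where e: "e \<in> G" "moved e \<inter> R = V'" "e ` V' \<inter> V' = {}" "card (moved e) \<le> 3 * k" and VU': "V' \<subseteq> U"
    using V by (auto simp: traces_def)
  let ?X1 = "(moved d - R) \<union> (moved e - R)"
  have cX1: "card ?X1 \<le> 8 * k"
    using card_Un_le[of "moved d - R" "moved e - R"] card_moved_diff_le[OF d(1,4), of R] card_moved_diff_le[OF e(1,4), of R]
    by linarith
  obtain g where g: "g \<in> G" "moved g \<inter> R = U" "g ` U \<inter> R = {}" "moved g \<inter> ?X1 = {}"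
  proof -
    have "finite ?X1" "?X1 \<inter> R = {}" using finite_moved[OF d(1)] finite_moved[OF e(1)] by auto
    from ex_fresh[OF this cX1 V(3)] show ?thesis using that by auto
  qed
  have W1: "V' = moved e \<inter> moved g" using e(2) g(2,4) VU' by blast
  have gV: "g ` V' \<inter> V' = {}" using g(3) VU' by (auto simp: U_def)
  define z where "z = e \<circ> g \<circ> inv' e \<circ> inv' g"
  note z = commutator_three_cycles[OF e(1) g(1) W1 e(3) gV, folded z_def]
  \<comment> \<open>The support of \<open>z\<close> contains the images of \<open>V'\<close> under
    \<open>e\<close>, which may meet the support of \<open>d\<close>. Its inverse sends
    \<open>V'\<close> to the images under the fresh \<open>g\<close> instead, so in a second
    commutator, with \<open>g2\<close>, only images under \<open>g\<close> and \<open>g2\<close>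
    remain.\<close>
  define x where "x = inv' z"
  have xG: "x \<in> G" unfolding x_def by (rule inv_mem[OF z(1)])
  have xv: "x v = g v" if "v \<in> V'" for v
    using z(4)[OF that] inv_apply(1)[OF z(1), of "g v"] by (simp add: x_def)
  have mx: "moved x = moved z"
  proof -
    have "x y = y \<longleftrightarrow> z y = y" for y
      using inv_apply[OF z(1), of y] unfolding x_def by metis
    then show ?thesis by (simp add: moved_def)
  qed
  have eR: "e v \<notin> R" if "v \<in> V'" for v
  proof
    assume "e v \<in> R"
    moreover have "e v \<in> moved e" using moved_image_mem[OF e(1)] that e(2) by blast
    ultimately show False using e(2,3) that by blast
  qed
  have gR: "g v \<notin> R" if "v \<in> V'" for v using g(3) that VU' by blast
  have mxR: "moved x \<inter> R = V'"
  proof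
    show "moved x \<inter> R \<subseteq> V'" using z(5) eR gR unfolding mx by blast
    show "V' \<subseteq> moved x \<inter> R" using z(7) e(2) unfolding mx by blast
  qed
  have cx: "card (moved x) \<le> 3 * k" using z(6) card_le_k[OF VU'] unfolding mx by linarith
  let ?X2 = "(moved d - R) \<union> (moved x - R)"
  have cX2: "card ?X2 \<le> 8 * k"
    using card_Un_le[of "moved d - R" "moved x - R"] card_moved_diff_le[OF d(1,4), of R] card_moved_diff_le[OF xG cx, of R]
    by linarith
  obtain g2 where g2: "g2 \<in> G" "moved g2 \<inter> R = U" "g2 ` U \<inter> R = {}" "moved g2 \<inter> ?X2 = {}"
  proof -
    have "finite ?X2" "?X2 \<inter> R = {}" using finite_moved[OF d(1)] finite_moved[OF xG] by auto
    from ex_fresh[OF this cX2 V(3)] show ?thesis using that by auto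
  qed
  have W2: "V' = moved x \<inter> moved g2" using mxR g2(2,4) VU' by blast
  have "x ` V' = g ` V'" using xv by (intro image_cong) auto
  then have xV: "x ` V' \<inter> V' = {}" using gV by simp
  have g2V: "g2 ` V' \<inter> V' = {}" using g2(3) VU' by (auto simp: U_def)
  define f where "f = x \<circ> g2 \<circ> inv' x \<circ> inv' g2"
  note f = commutator_three_cycles[OF xG g2(1) W2 xV g2V, folded f_def]
  have fv: "f v = g v" if "v \<in> V'" for v using f(2)[OF that] xv[OF that] by simp
  have gmv: "g v \<in> moved g" "g2 v \<in> moved g2" "g2 v \<notin> R" if "v \<in> V'" for v
  proof -
    have "v \<in> U" using that VU' by blast
    then show "g v \<in> moved g" "g2 v \<in> moved g2"
      using moved_image_mem[OF g(1)] moved_image_mem[OF g2(1)] g(2) g2(2) by blast+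
    show "g2 v \<notin> R" using g2(3) \<open>v \<in> U\<close> by blast
  qed
  have mf: "moved f \<subseteq> V' \<union> g ` V' \<union> g2 ` V'" using f(5) \<open>x ` V' = g ` V'\<close> by simp
  \<comment> \<open>Outside \<open>R\<close> the support of \<open>f\<close> consists of images of
    \<open>V'\<close> under \<open>g\<close> and \<open>g2\<close>, which avoid the support of
    \<open>d\<close>; so \<open>d\<close> and \<open>f\<close> meet exactly in the intersection of
    the traces.\<close>
  have W3: "V \<inter> V' = moved d \<inter> moved f"
  proof
    show "V \<inter> V' \<subseteq> moved d \<inter> moved f" using d(2) f(7) by blast
    show "moved d \<inter> moved f \<subseteq> V \<inter> V'"
    proof
      fix y assume y: "y \<in> moved d \<inter> moved f"
      have "y \<notin> g ` V'" using y g(4) gmv(1) gR by blast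
      moreover have "y \<notin> g2 ` V'" using y g2(4) gmv(2,3) by blast
      ultimately have "y \<in> V'" using y mf by blast
      moreover have "y \<in> R" using \<open>y \<in> V'\<close> e(2) by blast
      ultimately show "y \<in> V \<inter> V'" using y d(2) by blast
    qed
  qed
  have dW: "d ` (V \<inter> V') \<inter> (V \<inter> V') = {}" using d(3) by blast
  have fW: "f ` (V \<inter> V') \<inter> (V \<inter> V') = {}"
  proof -
    have "f v \<notin> R" if "v \<in> V \<inter> V'" for v using fv gR that by simp
    then show ?thesis using d(2) by blast
  qed
  define q where "q = d \<circ> f \<circ> inv' d \<circ> inv' f"
  note q = commutator_three_cycles[OF d(1) f(1) W3 dW fW, folded q_def]
  have dR: "d v \<notin> R" if "v \<in> V" for v
  proof
    assume "d v \<in> R"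
    moreover have "d v \<in> moved d" using moved_image_mem[OF d(1)] that d(2) by blast
    ultimately show False using d(2,3) that by blast
  qed
  have "moved q \<inter> R = V \<inter> V'"
  proof
    have "f v \<notin> R" if "v \<in> V'" for v using fv[OF that] gR[OF that] by simp
    then show "moved q \<inter> R \<subseteq> V \<inter> V'" using q(5) dR by blast
    show "V \<inter> V' \<subseteq> moved q \<inter> R" using q(7) d(2) by blast
  qed
  moreover have "q ` (V \<inter> V') \<inter> (V \<inter> V') = {}"
  proof -
    have "q ` (V \<inter> V') = d ` (V \<inter> V')" using q(2) by (intro image_cong) auto
    then show ?thesis using dW by simp
  qed
  moreover have "card (moved q) \<le> 3 * k" using q(6) card_le_k[of "V \<inter> V'"] VU by force
  ultimately show ?thesis using q(1) VU unfolding traces_def by blast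
qed

text \<open>Fixing the images of \<open>Q\<close> and demanding compatibility with a colouring keeps
  a controlled proportion of \<open>K0\<close>. For two remaining members the set where they differ
  on \<open>U\<close> is a trace disjoint from \<open>Q\<close>, hence empty, so all of them agree
  on \<open>U\<close>. By \<open>vector_bound\<close> so few members agree on half of
  \<open>U\<close> that this is impossible.\<close>

lemma no_open_state:
  assumes U: "U \<noteq> {}" and k': "2 * reserve \<le> k'"
  shows False
proof -
  have k1: "1 + reserve \<le> k'" using k' reserve_pos by simp
  have "\<exists>Q\<subseteq>U. m * card Q \<le> 3 * card U \<and> (\<forall>V\<in>traces. V \<noteq> {} \<longrightarrow> V \<inter> Q \<noteq> {})"
  proof (rule ex_hitting_set_of_minimal[OF finite_U])
    show "V \<subseteq> U" if "V \<in> traces" for V using that by (simp add: traces_def)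
    show "V \<inter> W \<in> traces" if "V \<in> traces" "W \<in> traces" for V W using trace_Int[OF that k1] .
    show "m \<le> 3 * card V" if "V \<in> traces" "V \<noteq> {}" for V using trace_card[OF that k1] .
  qed
  then obtain Q where Q0: "Q \<subseteq> U \<and> m * card Q \<le> 3 * card U \<and> (\<forall>V\<in>traces. V \<noteq> {} \<longrightarrow> V \<inter> Q \<noteq> {})" ..
  then have Q: "Q \<subseteq> U" "m * card Q \<le> 3 * card U" by simp_all
  have Qhit: "V \<inter> Q \<noteq> {}" if "V \<in> traces" "V \<noteq> {}" for V using Q0 that by simp
  have finK0: "finite K0" using finite_K by (simp add: K0_def)
  have finQ: "finite Q" using Q(1) finite_U finite_subset by blast
  have U\<Omega>: "U \<subseteq> \<Omega>" using st_simps(3) moved_subset[OF F_G[OF st_simps(1)]] by (auto simp: U_def)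
  have K0G: "h \<in> G" if "h \<in> K0" for h using KD(2)[OF K0D(1)[OF that]] .
  have im: "h ` U \<subseteq> \<Omega>" if "h \<in> K0" for h
    using U\<Omega> permutes_in_image[OF permutes[OF K0G[OF that]]] by blast
  define n where "n = card \<Omega>"
  have "\<exists>\<gamma>\<in>Q \<rightarrow>\<^sub>E \<Omega>. card K0 \<le> card (Q \<rightarrow>\<^sub>E \<Omega>) * card {h \<in> K0. restrict h Q = \<gamma>}"
  proof (rule ex_large_fibre[OF finK0 _ _ K0_ne])
    show "finite (Q \<rightarrow>\<^sub>E \<Omega>)" using finQ finite_\<Omega> by (intro finite_PiE) auto
    show "(\<lambda>h. restrict h Q) ` K0 \<subseteq> Q \<rightarrow>\<^sub>E \<Omega>" using im Q(1) by fastforce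
  qed
  then obtain \<gamma> where \<gamma>: "card K0 \<le> card (Q \<rightarrow>\<^sub>E \<Omega>) * card {h \<in> K0. restrict h Q = \<gamma>}" by blast
  define K1 where "K1 = {h \<in> K0. restrict h Q = \<gamma>}"
  have K1: "K1 \<subseteq> K0" by (auto simp: K1_def)
  have c1: "card K0 \<le> n ^ card Q * card K1" using \<gamma> finQ by (simp add: K1_def card_PiE n_def)
  obtain \<chi> where \<chi>: "card K1 \<le> card U ^ card U * card {h \<in> K1. \<forall>u\<in>U. \<chi> (h u) = u}"
  proof -
    have "\<exists>\<chi>. card K1 \<le> card U ^ card U * card {h \<in> K1. \<forall>u\<in>U. \<chi> (h u) = u}"
    proof (rule ex_compatible_colouring[OF finite_\<Omega> finite_U U])
      show "finite K1" using K1 finK0 finite_subset by blast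
      show "inj_on h U" if "h \<in> K1" for h using inj_mem[OF K0G] that K1 by (auto simp: inj_on_def)
      show "h ` U \<subseteq> \<Omega>" if "h \<in> K1" for h using im that K1 by blast
    qed
    then show ?thesis using that by blast
  qed
  define K2 where "K2 = {h \<in> K1. \<forall>u\<in>U. \<chi> (h u) = u}"
  have c2: "card K0 \<le> n ^ card Q * (card U ^ card U * card K2)"
    using le_trans[OF c1 mult_le_mono2[OF \<chi>]] by (simp add: K2_def)
  have "K2 \<noteq> {}"
  proof
    assume "K2 = {}"
    then have "card K0 = 0" using c2 by simp
    then show False using finK0 K0_ne by simp
  qed
  then obtain h1 where h1: "h1 \<in> K2" by blast
  have K2D: "h \<in> K0" "restrict h Q = \<gamma>" "\<And>u. u \<in> U \<Longrightarrow> \<chi> (h u) = u" if "h \<in> K2" for h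
    using that by (auto simp: K2_def K1_def)
  have agree: "h2 u = h1 u" if h2: "h2 \<in> K2" and u: "u \<in> U" for h2 u
  proof -
    note G1 = K0G[OF K2D(1)[OF h1]] and G2 = K0G[OF K2D(1)[OF h2]]
    define d where "d = inv' h1 \<circ> h2"
    define V where "V = {u \<in> U. h2 u \<noteq> h1 u}"
    have dG: "d \<in> G" unfolding d_def by (rule comp_mem[OF inv_mem[OF G1] G2])
    have d_iff: "d x = x \<longleftrightarrow> h2 x = h1 x" for x
      using inv_apply[OF G1] unfolding d_def by (metis comp_apply)
    have "moved d \<inter> R = V"
      using KP[OF K0D(1)[OF K2D(1)[OF h2]] K0D(1)[OF K2D(1)[OF h1]]] d_iff by (auto simp: moved_def V_def U_def)
    moreover have "d ` V \<inter> V = {}"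
    proof -
      \<comment> \<open>A coincidence means \<open>h1 v' = h2 v\<close>; the colour of this common
        value is both \<open>v'\<close> and \<open>v\<close>.\<close>
      have "d v \<noteq> v'" if v: "v \<in> V" "v' \<in> V" for v v'
      proof
        assume "d v = v'"
        then have "h1 v' = h2 v" using inv_apply(2)[OF G1, of "h2 v"] by (simp add: d_def)
        then have "v' = v" using K2D(3)[OF h1, of v'] K2D(3)[OF h2, of v] v by (simp add: V_def)
        then show False using \<open>d v = v'\<close> d_iff v by (simp add: V_def)
      qed
      then show ?thesis by blast
    qed
    moreover have "card (moved d) \<le> 3 * k"
    proof -
      have "moved d \<subseteq> moved h1 \<union> moved h2"
      proof
        fix x assume "x \<in> moved d"
        then have "h2 x \<noteq> h1 x" by (simp add: moved_def d_iff)
        then have "h1 x \<noteq> x \<or> h2 x \<noteq> x" by metis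
        then show "x \<in> moved h1 \<union> moved h2" by (simp add: moved_def)
      qed
      then have "card (moved d) \<le> card (moved h1 \<union> moved h2)"
        using finite_moved[OF G1] finite_moved[OF G2] by (intro card_mono) auto
      also have "\<dots> \<le> card (moved h1) + card (moved h2)" by (rule card_Un_le)
      finally show ?thesis
        using KD(6)[OF K0D(1)[OF K2D(1)[OF h1]]] KD(6)[OF K0D(1)[OF K2D(1)[OF h2]]] by simp
    qed
    ultimately have "V \<in> traces" using dG by (auto simp: traces_def V_def)
    moreover have "V \<inter> Q = {}"
    proof -
      have "h2 q = h1 q" if "q \<in> Q" for q
        using K2D(2)[OF h1] K2D(2)[OF h2] that by (metis restrict_apply')
      then show ?thesis by (auto simp: V_def)
    qed
    ultimately have "V = {}" using Qhit[of V] by auto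
    then show ?thesis using u by (simp add: V_def)
  qed
  \<comment> \<open>Only half of \<open>U\<close>, rounded up, is used: \<open>vector_bound\<close>
    requires that \<open>reserve\<close> points be left over, and \<open>card U\<close> may be as
    large as \<open>k'\<close>.\<close>
  define j where "j = (card U + 1) div 2"
  have "card U \<ge> 1" using U finite_U by (simp add: Suc_le_eq card_gt_0_iff)
  then have j: "j \<le> card U" "j \<ge> 1" "card U \<le> 2 * j" by (auto simp: j_def)
  obtain U' where U': "U' \<subseteq> U" "card U' = j" using obtain_subset_with_card_n[OF j(1)] by blast
  have "card {h \<in> K. \<forall>u\<in>U'. h u = h1 u} * (t ^ 199) ^ card U' \<le> c"
  proof (rule vector_bound)
    show "U' \<subseteq> R - P" using U' by (simp add: U_def)
    show "U' \<noteq> {}" using U' j by auto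
    show "card U' + reserve \<le> k'" using U'(2) k' card_U_le unfolding j_def by linarith
    show "h1 \<in> K" using K0D(1)[OF K2D(1)[OF h1]] .
    show "h1 ` U' \<inter> R = {}" using K0D(2)[OF K2D(1)[OF h1]] U'(1) by blast
  qed
  then have le: "card {h \<in> K. \<forall>u\<in>U'. h u = h1 u} * (t ^ 199) ^ j \<le> c" by (simp only: U'(2))
  have "card K2 \<le> card {h \<in> K. \<forall>u\<in>U'. h u = h1 u}"
    using agree U'(1) K0D(1)[OF K2D(1)] finite_K by (intro card_mono) auto
  then have "card K2 * (t ^ 199) ^ j \<le> card {h \<in> K. \<forall>u\<in>U'. h u = h1 u} * (t ^ 199) ^ j"
    using t2 by (intro mult_right_mono) auto
  also have "\<dots> \<le> c" by (rule le)
  also have "\<dots> \<le> 2 * real (card K0)" by (rule card_K0)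
  also have "\<dots> \<le> 2 * (t ^ (8 * j) * (t ^ (8 * j) * card K2))"
  proof -
    have "real (card K0) \<le> real (n ^ card Q * (card U ^ card U * card K2))" using c2 by (simp only: of_nat_le_iff)
    also have "\<dots> = real n ^ card Q * (real (card U) ^ card U * card K2)" by simp
    \<comment> \<open>As \<open>m >= 300\<close>, the hitting set has at most
      \<open>card U / 100\<close> points, so its images cost at most
      \<open>t ^ (4 * card U)\<close>; the colouring costs no more because
      \<open>card U <= t ^ 4\<close>.\<close>
    also have "\<dots> \<le> t ^ (8 * j) * (t ^ (8 * j) * card K2)"
    proof (intro mult_mono)
      have "real n ^ card Q = t ^ (400 * card Q)" using tn by (simp add: n_def power_mult)
      also have "\<dots> \<le> t ^ (8 * j)"
      proof (rule power_increasing)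
        have "300 * card Q \<le> m * card Q" using m300 by (intro mult_right_mono) auto
        then show "400 * card Q \<le> 8 * j" using Q(2) j(3) by linarith
      qed (use t2 in simp)
      finally show "real n ^ card Q \<le> t ^ (8 * j)" .
      have "real (card U) \<le> t ^ 4" using card_U_le k'_range(2) kreal by linarith
      then have "real (card U) ^ card U \<le> (t ^ 4) ^ card U" by (intro power_mono) auto
      also have "\<dots> = t ^ (4 * card U)" by (simp add: power_mult)
      also have "\<dots> \<le> t ^ (8 * j)" using j(3) t2 by (intro power_increasing) auto
      finally show "real (card U) ^ card U \<le> t ^ (8 * j)" .
    qed (use t2 in auto)
    finally show ?thesis by simp
  qed
  also have "\<dots> = card K2 * (2 * t ^ (16 * j))" by (simp flip: power_add)
  finally have "card K2 * (t ^ 199) ^ j \<le> card K2 * (2 * t ^ (16 * j))" .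
  moreover have "real (card K2) > 0"
  proof -
    have "K2 \<subseteq> K0" using K2D(1) by blast
    then have "finite K2" using finK0 finite_subset by blast
    then show ?thesis using \<open>K2 \<noteq> {}\<close> by (simp add: card_gt_0_iff)
  qed
  ultimately have "(t ^ 199) ^ j \<le> 2 * t ^ (16 * j)" by simp
  moreover have "2 * t ^ (16 * j) < t ^ 2 * t ^ (16 * j)"
  proof -
    have "2 * 2 \<le> t * t" using t2 by (intro mult_mono) auto
    then show ?thesis using t2 by (simp add: power2_eq_square)
  qed
  moreover have "t ^ 2 * t ^ (16 * j) \<le> t ^ (199 * j)"
    using j t2 unfolding power_add[symmetric] by (intro power_increasing) auto
  ultimately show False by (simp add: power_mult)
qed

end

text \<open>The empty state has cost 1, so a maximal state exists, and by the two impossibility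
  lemmas it has \<open>k' <= 2 * reserve + 2\<close>. Its family then has at most one member, so
  \<open>cost\<close> bounds \<open>F\<close>.\<close>

lemma (in small_degree) card_F_le:
  "card F \<le> t ^ (200 * k) * fact k powr (- (1/4)) / t ^ (199 * reserve)"
proof (cases "F = {}")
  case True
  show ?thesis unfolding True using t2 by simp
next
  case False
  then obtain h where h: "h \<in> F" by blast
  let ?st = "\<lambda>(R, P, h0). state R P h0"
  have "reserve \<le> k" using mk by (simp add: reserve_def)
  then have "?st ({}, {}, h)" using h by (simp add: state_def fam_def cost_def)
  moreover have "card (fst s) + card (fst (snd s)) < 2 * k + 1" if "?st s" for s
  proof -
    obtain R P h0 where s: "s = (R, P, h0)" by (cases s) auto
    then have st: "state R P h0" using that by simp
    then have "finite R" using finite_moved[OF F_G] finite_subset unfolding state_def by blast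
    then have "card P \<le> card R" using st by (intro card_mono) (auto simp: state_def)
    moreover have "card R \<le> k" using st by (simp add: state_def)
    ultimately show ?thesis by (simp add: s)
  qed
  ultimately obtain s where s: "?st s" "\<And>s'. ?st s' \<Longrightarrow> card (fst s') + card (fst (snd s')) \<le> card (fst s) + card (fst (snd s))"
    using ex_has_greatest_nat[of ?st "({}, {}, h)" "\<lambda>s. card (fst s) + card (fst (snd s))" "2 * k + 1"] by blast
  obtain R P h0 where sR: "s = (R, P, h0)" by (cases s) auto
  have st: "state R P h0" using s(1) by (simp add: sR)
  have mx: "card R' + card P' \<le> card R + card P" if "state R' P' h1" for R' P' h1
    using s(2)[of "(R', P', h1)"] that by (simp add: sR)
  interpret M: maximal_state \<Omega> G k m t R P h0
    by unfold_locales (use st mx in auto)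
  have "M.k' \<le> 2 * reserve + 2"
  proof (rule ccontr)
    assume "\<not> ?thesis"
    then have "3 + reserve \<le> M.k'" "2 * reserve \<le> M.k'" by auto
    then show False using M.no_closed_state M.no_open_state by blast
  qed
  then have "real (card M.K) \<le> 1" by (rule M.card_K_le_1)
  then have "card M.K * cost (card R) (card P) \<le> 1 * cost (card R) (card P)"
    using cost_pos[of "card R" "card P"] by (intro mult_right_mono) auto
  with M.st_simps(6) have le: "card F \<le> cost (card R) (card P)" by simp
  let ?i = "card R"
  have ik: "?i \<le> k" "reserve \<le> k - ?i" using M.st_simps(5) by auto
  let ?T = "\<Prod>l\<in>{k - ?i<..k}. weight l"
  have Tpos: "?T > 0" by (intro prod_pos) (auto intro: weight_pos)
  have "cost ?i (card P) \<le> ?T"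
  proof -
    have "card P \<le> ?i" using M.st_simps(2) M.finite_R by (intro card_mono)
    then have "\<beta> ^ card P \<le> \<beta> ^ ?i" using \<beta> by (intro power_increasing) auto
    then have "?T * \<beta> ^ card P \<le> ?T * \<beta> ^ ?i" using Tpos by (intro mult_left_mono) auto
    then show ?thesis using \<beta>(3) by (simp add: cost_def divide_le_eq)
  qed
  moreover have "?T * t ^ (199 * reserve) \<le> t ^ (200 * k) * fact k powr (- (1/4))"
  proof -
    have all: "(\<Prod>l\<in>{1..j}. weight l) = t ^ (200 * j) * fact j powr (- (1/4))" for j
    proof (induction j)
      case (Suc j)
      have "{1..Suc j} = insert (Suc j) {1..j}" by auto
      then have "(\<Prod>l\<in>{1..Suc j}. weight l) = weight (Suc j) * (\<Prod>l\<in>{1..j}. weight l)" by simp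
      also have "\<dots> = (t ^ 200 * real (Suc j) powr (- (1/4))) * (t ^ (200 * j) * fact j powr (- (1/4)))"
        unfolding Suc.IH by (simp only: weight_def)
      also have "\<dots> = (t ^ 200 * t ^ (200 * j)) * (real (Suc j) powr (- (1/4)) * fact j powr (- (1/4)))"
        by (simp only: ac_simps)
      also have "t ^ 200 * t ^ (200 * j) = t ^ (200 * Suc j)" by (simp flip: power_add)
      also have "real (Suc j) powr (- (1/4)) * fact j powr (- (1/4)) = fact (Suc j) powr (- (1/4))"
        by (subst powr_mult[symmetric]) (auto simp: fact_Suc)
      finally show ?case .
    qed simp
    have un: "{1..k} = {1..k - ?i} \<union> {k - ?i<..k}" by auto
    have "(\<Prod>l\<in>{1..k}. weight l) = (\<Prod>l\<in>{1..k - ?i}. weight l) * ?T"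
      unfolding un by (rule prod.union_disjoint) auto
    \<comment> \<open>The saving: at least \<open>reserve\<close> of the weights have not been
      charged, and each is at least \<open>t ^ 199\<close>.\<close>
    moreover have "t ^ (199 * reserve) \<le> (\<Prod>l\<in>{1..k - ?i}. weight l)"
    proof -
      have "t ^ (199 * reserve) \<le> t ^ (199 * (k - ?i))" using ik(2) t2 by (intro power_increasing) auto
      also have "\<dots> = (\<Prod>l\<in>{1..k - ?i}. t ^ 199)" by (simp add: power_mult)
      also have "\<dots> \<le> (\<Prod>l\<in>{1..k - ?i}. weight l)" using t2 by (intro prod_mono conjI weight_ge) auto
      finally show ?thesis .
    qed
    ultimately have "?T * t ^ (199 * reserve) \<le> (\<Prod>l\<in>{1..k}. weight l)"
      using Tpos by (simp only: mult.commute[of _ ?T] mult_le_cancel_left_pos)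
    then show ?thesis unfolding all .
  qed
  then have "?T \<le> t ^ (200 * k) * fact k powr (- (1/4)) / t ^ (199 * reserve)"
    using t2 by (simp add: pos_le_divide_eq)
  ultimately show ?thesis using le by linarith
qed

section \<open>Comparison with the stated bound and combination of the two ranges\<close>

lemma binomial_fact_ge:
  assumes "k \<le> n" shows "(real n - real k) ^ k \<le> real (n choose k) * fact k"
  using assms
proof (induction k)
  case (Suc k)
  have "Suc k * (n choose Suc k) = (n - k) * (n choose k)"
    using binomial_absorption[of k n] binomial_absorb_comp[of n k] by simp
  then have "real (Suc k * (n choose Suc k)) = real ((n - k) * (n choose k))" by (rule arg_cong)
  then have eq: "real (Suc k) * real (n choose Suc k) = (real n - real k) * real (n choose k)"
    using Suc.prems by (simp only: of_nat_mult) (simp add: of_nat_diff)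
  have "(real n - real (Suc k)) ^ Suc k \<le> (real n - real k) ^ Suc k"
    using Suc.prems by (intro power_mono) auto
  also have "\<dots> = (real n - real k) * (real n - real k) ^ k" by simp
  also have "\<dots> \<le> (real n - real k) * (real (n choose k) * fact k)"
    using Suc by (intro mult_left_mono) auto
  also have "\<dots> = (real (Suc k) * real (n choose Suc k)) * fact k" unfolding eq by (simp only: ac_simps)
  also have "\<dots> = real (n choose Suc k) * fact (Suc k)" by (simp only: fact_Suc ac_simps)
  finally show ?case .
qed simp

lemma binomial_fact_ge_half:
  assumes "k \<le> n" "2 * real k ^ 2 \<le> n" "n > 0"
  shows "real n ^ k \<le> 2 * (real (n choose k) * fact k)"
proof -
  have "1 / 2 \<le> 1 + real k * (- (real k / n))"
    using assms by (simp add: field_simps power2_eq_square)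
  also have "\<dots> \<le> (1 + (- (real k / n))) ^ k"
    using assms by (intro Bernoulli_inequality) (simp add: field_simps)
  finally have "real n ^ k * (1 / 2) \<le> real n ^ k * (1 - real k / n) ^ k" by (intro mult_left_mono) auto
  also have "\<dots> = (real n - real k) ^ k" using assms by (simp add: field_simps flip: power_mult_distrib)
  also have "\<dots> \<le> real (n choose k) * fact k" by (rule binomial_fact_ge[OF assms(1)])
  finally show ?thesis by simp
qed

text \<open>Conjugation by \<open>g\<close> preserves degrees. This is the invariance that the
  weights of \<open>light_base_eventually\<close> must have.\<close>

lemma (in perm_group) card_moving_invariant:
  assumes g: "g \<in> G"
  shows "card {h \<in> {h \<in> G. card (moved h) = k}. h (g x) \<noteq> g x} = card {h \<in> {h \<in> G. card (moved h) = k}. h x \<noteq> x}"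
proof -
  have conj: "inv' g \<circ> h \<circ> g \<in> G" "card (moved (inv' g \<circ> h \<circ> g)) = card (moved h)"
    if g: "g \<in> G" and h: "h \<in> G" for g h
  proof -
    show "inv' g \<circ> h \<circ> g \<in> G" using g h by (simp add: comp_mem inv_mem)
    note i = inv_apply[OF g]
    have "moved h = g ` moved (inv' g \<circ> h \<circ> g)"
    proof (intro equalityI subsetI)
      fix y assume "y \<in> moved h"
      then have "inv' g (h y) \<noteq> inv' g y" using inj_mem[OF inv_mem[OF g]] by (simp add: moved_def)
      then have "inv' g y \<in> moved (inv' g \<circ> h \<circ> g)" using i by (simp add: moved_def)
      then show "y \<in> g ` moved (inv' g \<circ> h \<circ> g)" by (rule rev_image_eqI) (simp add: i)
    next
      fix y assume "y \<in> g ` moved (inv' g \<circ> h \<circ> g)"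
      then obtain x where x: "y = g x" "inv' g (h (g x)) \<noteq> x" by (auto simp: moved_def)
      have "h (g x) \<noteq> g x" using x(2) i by metis
      then show "y \<in> moved h" by (simp add: moved_def x(1))
    qed
    then show "card (moved (inv' g \<circ> h \<circ> g)) = card (moved h)"
      using inj_mem[OF g] by (simp add: card_image inj_on_def)
  qed
  note i = inv_apply[OF g]
  have ii: "inv' (inv' g) = g" using permutes_inv_inv[OF permutes[OF g]] .
  have "bij_betw (\<lambda>h. inv' g \<circ> h \<circ> g) {h \<in> {h \<in> G. card (moved h) = k}. h (g x) \<noteq> g x}
      {h \<in> {h \<in> G. card (moved h) = k}. h x \<noteq> x}"
  proof (rule bij_betwI[where g = "\<lambda>h. g \<circ> h \<circ> inv' g"])
    show "(\<lambda>h. inv' g \<circ> h \<circ> g) \<in> {h \<in> {h \<in> G. card (moved h) = k}. h (g x) \<noteq> g x} \<rightarrow> {h \<in> {h \<in> G. card (moved h) = k}. h x \<noteq> x}"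
    proof
      fix h assume "h \<in> {h \<in> {h \<in> G. card (moved h) = k}. h (g x) \<noteq> g x}"
      then have h: "h \<in> G" "card (moved h) = k" "h (g x) \<noteq> g x" by auto
      then have "inv' g (h (g x)) \<noteq> x" using i(2)[of "h (g x)"] by auto
      then show "inv' g \<circ> h \<circ> g \<in> {h \<in> {h \<in> G. card (moved h) = k}. h x \<noteq> x}" using conj[OF g h(1)] h by simp
    qed
    show "(\<lambda>h. g \<circ> h \<circ> inv' g) \<in> {h \<in> {h \<in> G. card (moved h) = k}. h x \<noteq> x} \<rightarrow> {h \<in> {h \<in> G. card (moved h) = k}. h (g x) \<noteq> g x}"
    proof
      fix h assume "h \<in> {h \<in> {h \<in> G. card (moved h) = k}. h x \<noteq> x}"
      then have h: "h \<in> G" "card (moved h) = k" "h x \<noteq> x" by auto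
      moreover have "g (h (inv' g (g x))) \<noteq> g x" using h(3) i(1)[of x] inj_mem[OF g] by simp
      ultimately show "g \<circ> h \<circ> inv' g \<in> {h \<in> {h \<in> G. card (moved h) = k}. h (g x) \<noteq> g x}"
        using conj[OF inv_mem[OF g] h(1)] by (simp add: ii)
    qed
  qed (use i in \<open>auto simp: fun_eq_iff\<close>)
  then show ?thesis by (rule bij_betw_same_card)
qed

lemma small_degree_count:
  fixes n k m :: nat
  assumes G: "perm_group \<Omega> G" "card \<Omega> = n" and min: "\<And>h. h \<in> G \<Longrightarrow> h \<noteq> id \<Longrightarrow> m \<le> card (moved h)"
    and m: "m \<ge> 300" "m \<le> k" and n: "real n \<ge> 2 ^ 400" and k: "k \<le> real n powr (1/100)" "k \<le> n"
  shows "card {h \<in> G. card (moved h) = k}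
    \<le> real n powr (- (1/3200) * m) * real (n choose k) powr (1/2) * fact k powr (1/4)"
proof -
  define t where "t = real n powr (1/400)"
  have n0: "real n > 0" using n by (rule less_le_trans[rotated]) simp
  have tn: "t ^ 400 = n" using n0 by (simp add: t_def powr_powr flip: powr_numeral)
  have t2: "t \<ge> 2"
  proof -
    have "(2 ^ 400) powr (1/400) \<le> t" unfolding t_def using n by (intro powr_mono2) auto
    moreover have "(2 ^ 400 :: real) powr (1/400) = 2"
    proof -
      have "(2 ^ 400 :: real) = 2 powr 400" by (simp only: powr_numeral)
      then show ?thesis by (simp only: powr_powr) simp
    qed
    ultimately show ?thesis by simp
  qed
  have "t ^ 4 = real n powr (1/100)" using n0 by (simp add: t_def powr_powr flip: powr_numeral)
  then have kt: "real k \<le> t ^ 4" using k by simp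
  interpret perm_group \<Omega> G by (rule G(1))
  interpret S: small_degree \<Omega> G k m t
    by unfold_locales (use m min t2 tn kt G in auto)
  have half: "real n ^ k \<le> 2 * (real (n choose k) * fact k)"
  proof (rule binomial_fact_ge_half)
    have "2 * real k ^ 2 \<le> t * (t ^ 4) ^ 2" using t2 kt by (intro mult_mono power_mono) auto
    also have "\<dots> = t ^ 9" by (simp flip: power_mult power_Suc)
    also have "\<dots> \<le> t ^ 400" using t2 by (intro power_increasing) auto
    finally show "2 * real k ^ 2 \<le> n" using tn by simp
  qed (use k n0 in auto)
  define f where "f = (fact k :: real)"
  define b where "b = real (n choose k)"
  have f: "f > 0" and b: "b > 0" using k by (auto simp: f_def b_def)
  have nk: "real n ^ k = t ^ (400 * k)" using tn by (simp add: power_mult)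
  have "t ^ (400 * k) / 2 \<le> b * f" using half nk by (simp add: b_def f_def)
  then have "(t ^ (400 * k) / 2) powr (1/2) \<le> (b * f) powr (1/2)" using t2 by (intro powr_mono2) auto
  moreover have "(t ^ (400 * k) / 2) powr (1/2) \<ge> t ^ (200 * k) / 2"
  proof -
    have "(t ^ (200 * k) / 2)\<^sup>2 \<le> t ^ (400 * k) / 2" using t2 by (simp add: power_divide flip: power_mult)
    then have "t ^ (200 * k) / 2 \<le> sqrt (t ^ (400 * k) / 2)" by (rule real_le_rsqrt)
    then show ?thesis using t2 by (simp add: powr_half_sqrt)
  qed
  ultimately have A: "t ^ (200 * k) \<le> 2 * (b powr (1/2) * f powr (1/2))" using b f by (simp add: powr_mult)
  have "card {h \<in> G. card (moved h) = k} \<le> t ^ (200 * k) * f powr (- (1/4)) / t ^ (199 * S.reserve)"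
    using S.card_F_le by (simp only: S.F_def f_def)
  also have "\<dots> \<le> (2 * (b powr (1/2) * f powr (1/2))) * f powr (- (1/4)) / t ^ (199 * S.reserve)"
    using A t2 by (intro divide_right_mono mult_right_mono) auto
  also have "\<dots> = b powr (1/2) * (f powr (1/2) * f powr (- (1/4))) * (2 / t ^ (199 * S.reserve))" by simp
  also have "f powr (1/2) * f powr (- (1/4)) = f powr (1/4)" by (simp flip: powr_add)
  also have "2 / t ^ (199 * S.reserve) \<le> real n powr (- (1/3200) * m)"
  proof -
    have "real n = t powr 400" using tn t2 by (simp add: powr_numeral)
    then have "real n powr (- (1/3200) * m) = t powr (- (m / 8))" by (simp add: powr_powr)
    moreover have "2 / t ^ (199 * S.reserve) \<le> t powr (- (m / 8))"
    proof -
      \<comment> \<open>The exponent 1/3200 is 1/8 divided by 400, as \<open>t\<close> is the 400th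
        root of n. The extra 1 absorbs the factor 2 of \<open>A\<close>.\<close>
      have "real m / 8 + 1 \<le> 199 * S.reserve" using m unfolding S.reserve_def by linarith
      then have "t powr (m / 8 + 1) \<le> t powr (199 * S.reserve)" using t2 by (intro powr_mono) auto
      also have "\<dots> = t ^ (199 * S.reserve)" using t2 by (simp flip: powr_realpow)
      finally have "t powr (m / 8) * t \<le> t ^ (199 * S.reserve)" using t2 by (simp add: powr_add)
      moreover have "t powr (m / 8) * 2 \<le> t powr (m / 8) * t" using t2 by (intro mult_left_mono) auto
      ultimately have "t powr (m / 8) * 2 \<le> t ^ (199 * S.reserve)" by linarith
      then show ?thesis using t2 by (simp add: powr_minus field_simps)
    qed
    ultimately show ?thesis by simp
  qed
  then have "b powr (1/2) * f powr (1/4) * (2 / t ^ (199 * S.reserve))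
      \<le> b powr (1/2) * f powr (1/4) * real n powr (- (1/3200) * m)" by (intro mult_left_mono) auto
  finally show ?thesis by (simp only: b_def f_def ac_simps)
qed

lemma large_degree_count:
  obtains B n0 where "\<And>(\<Omega> :: nat set) G k m. perm_group \<Omega> G \<Longrightarrow> card \<Omega> \<ge> n0 \<Longrightarrow>
    (\<forall>h\<in>G. h \<noteq> id \<longrightarrow> card (moved h) > B) \<Longrightarrow> real (card \<Omega>) powr (1/100) \<le> real k \<Longrightarrow> k \<le> card \<Omega> \<Longrightarrow> m \<le> k \<Longrightarrow>
    card {h \<in> G. card (moved h) = k}
      \<le> real (card \<Omega>) powr (- (1/3200) * real m) * real (card \<Omega> choose k) powr (1/2) * fact k powr (1/4)"
proof -
  \<comment> \<open>The threshold exponent 1/100 divided by the 32 of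
    \<open>large_degree_bound\<close>, the same exponent as in the small range.\<close>
  define \<gamma> :: real where "\<gamma> = 1 / 3200"
  have \<gamma>: "\<gamma> = 1/100/32" "0 < \<gamma>" "\<gamma> \<le> 6" "1 \<le> 6 / \<gamma>" by (auto simp: \<gamma>_def)
  obtain B n0 where Bn0: "\<And>(\<Omega> :: nat set) G w. perm_group \<Omega> G \<Longrightarrow> card \<Omega> \<ge> n0 \<Longrightarrow>
    (\<forall>h\<in>G. h \<noteq> id \<longrightarrow> card (moved h) > B) \<Longrightarrow> (\<forall>y\<in>\<Omega>. w y \<ge> 0) \<Longrightarrow> (\<forall>g\<in>G. \<forall>y\<in>\<Omega>. w (g y) = w y) \<Longrightarrow>
    \<exists>X. X \<subseteq> \<Omega> \<and> 6 / \<gamma> * sum w X \<le> sum w \<Omega> \<and> (\<forall>y\<in>\<Omega>. card (orb (fixer G X) y) \<le> real (card \<Omega>) powr \<gamma>)"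
    using light_base_eventually[OF \<gamma>(4,2,3), where ?'a = nat] by blast
  have "\<forall>\<^sub>F x in at_top. 4 * exp 1 \<le> x powr \<gamma>" using \<gamma> by real_asymp
  then have "\<forall>\<^sub>F n in sequentially. 4 * exp 1 \<le> real n powr \<gamma>"
    using filterlim_real_sequentially by (rule eventually_compose_filterlim)
  then obtain n1 where n1: "\<And>n. n \<ge> n1 \<Longrightarrow> 4 * exp 1 \<le> real n powr \<gamma>"
    unfolding eventually_sequentially by blast
  have "card {h \<in> G. card (moved h) = k}
      \<le> real (card \<Omega>) powr (- (1/3200) * real m) * real (card \<Omega> choose k) powr (1/2) * fact k powr (1/4)"
    if G: "perm_group \<Omega> G" and n: "card \<Omega> \<ge> max (max n0 n1) 2" and B: "\<forall>h\<in>G. h \<noteq> id \<longrightarrow> card (moved h) > B"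
      and k: "real (card \<Omega>) powr (1/100) \<le> real k" "k \<le> card \<Omega>" and m: "m \<le> k" for \<Omega> :: "nat set" and G k m
  proof -
    interpret perm_group \<Omega> G by (rule G)
    define w where "w x = real (card {h \<in> {h \<in> G. card (moved h) = k}. h x \<noteq> x})" for x
    have "\<exists>X. X \<subseteq> \<Omega> \<and> 6 / \<gamma> * sum w X \<le> sum w \<Omega> \<and> (\<forall>y\<in>\<Omega>. card (orb (fixer G X) y) \<le> real (card \<Omega>) powr \<gamma>)"
      by (rule Bn0[OF G]) (use n B card_moving_invariant in \<open>auto simp: w_def\<close>)
    then obtain X where X: "X \<subseteq> \<Omega>" "6 / \<gamma> * sum w X \<le> sum w \<Omega>"
        "\<And>y. y \<in> \<Omega> \<Longrightarrow> card (orb (fixer G X) y) \<le> real (card \<Omega>) powr \<gamma>" by blast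
    have "real (card \<Omega>) powr (1/100) \<ge> 1" using n by (intro ge_one_powr_ge_zero) auto
    then have k1: "k \<ge> 1" using k by linarith
    have D: "real (card \<Omega>) powr \<gamma> \<ge> 1" using n \<gamma> by (intro ge_one_powr_ge_zero) auto
    have "real (card {h \<in> G. card (moved h) = k}) \<le> 2 * (real (card \<Omega>) ^ 2 + 1) ^ nat \<lfloor>2 * k / (6 / \<gamma>)\<rfloor>
        * ((card \<Omega> choose (k div 2)) * (real (card \<Omega>) powr \<gamma>) ^ k)"
      by (rule card_degree_le_of_base[where X = X]) (use \<gamma> k1 X D in \<open>auto simp: w_def\<close>)
    also have "\<dots> \<le> real (card \<Omega>) powr (- \<gamma> * k) * real (card \<Omega> choose k) powr (1/2) * fact k powr (1/4)"
      unfolding \<gamma>(1) by (rule large_degree_bound) (use n n1[of "card \<Omega>"] k in \<open>auto simp: \<gamma>(1)\<close>)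
    also have "\<dots> \<le> real (card \<Omega>) powr (- \<gamma> * m) * real (card \<Omega> choose k) powr (1/2) * fact k powr (1/4)"
      using n m \<gamma> by (intro mult_right_mono powr_mono) auto
    finally show ?thesis by (simp only: \<gamma>_def)
  qed
  then show ?thesis by (rule that)
qed

theorem theoremB:
  shows "\<exists>b \<epsilon> :: real. b > 0 \<and> \<epsilon> > 0 \<and>
    (\<forall>(n::nat) (H :: (nat \<Rightarrow> nat) set) (k::nat).
      n \<ge> 1 \<longrightarrow> subgroup H (sym_group n) \<longrightarrow> H \<noteq> {\<one>\<^bsub>sym_group n\<^esub>} \<longrightarrow>
      real (min_degree n H) \<ge> b \<longrightarrow> 1 \<le> k \<longrightarrow> k \<le> n \<longrightarrow>
      real (card (elems_of_degree n H k))
        \<le> real n powr (- \<epsilon> * real (min_degree n H))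
           * real (n choose k) powr (1/2) * (fact k :: real) powr (1/4))"
proof (rule large_degree_count)
  fix B n0
  assume Bn0: "\<And>(\<Omega> :: nat set) G k m. perm_group \<Omega> G \<Longrightarrow> card \<Omega> \<ge> n0 \<Longrightarrow>
    (\<forall>h\<in>G. h \<noteq> id \<longrightarrow> card (moved h) > B) \<Longrightarrow> real (card \<Omega>) powr (1/100) \<le> real k \<Longrightarrow> k \<le> card \<Omega> \<Longrightarrow> m \<le> k \<Longrightarrow>
    card {h \<in> G. card (moved h) = k}
      \<le> real (card \<Omega>) powr (- (1/3200) * real m) * real (card \<Omega> choose k) powr (1/2) * fact k powr (1/4)"
  \<comment> \<open>The minimal degree is at most \<open>n\<close>, so a large minimal degree also
    makes \<open>n\<close> large. The summands serve the small range, the degree bound of the base,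
    and the threshold on \<open>n\<close> for the large range.\<close>
  define b where "b = 2 ^ 400 + real B + real n0"
  have "real (card (elems_of_degree n H k)) \<le> real n powr (- (1/3200) * real (min_degree n H))
      * real (n choose k) powr (1/2) * (fact k :: real) powr (1/4)"
    if "n \<ge> 1" and H: "subgroup H (sym_group n)" "H \<noteq> {\<one>\<^bsub>sym_group n\<^esub>}"
      and b: "real (min_degree n H) \<ge> b" and k: "1 \<le> k" "k \<le> n" for n H k
  proof -
    let ?m = "min_degree n H"
    have perm: "h permutes {1..n}" if "h \<in> H" for h
      using subgroup.subset[OF H(1)] that by (auto simp: sym_group_def)
    interpret perm_group "{1..n}" H
    proof
      show "id \<in> H" using subgroup.one_closed[OF H(1)] by (simp add: sym_group_def)
      show "g \<circ> h \<in> H" if "g \<in> H" "h \<in> H" for g h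
        using subgroup.m_closed[OF H(1) that] by (simp add: sym_group_def)
      show "inv' g \<in> H" if "g \<in> H" for g
        using subgroup.m_inv_closed[OF H(1) that] sym_group_inv_equality[of g n] perm[OF that]
        by (simp add: sym_group_carrier)
    qed (use perm in auto)
    have supp: "supp n h = moved h" if "h \<in> H" for h
      using moved_subset[OF that] by (auto simp: supp_def moved_def)
    let ?D = "{card (supp n h) | h. h \<in> H \<and> h \<noteq> \<one>\<^bsub>sym_group n\<^esub>}"
    have one: "\<one>\<^bsub>sym_group n\<^esub> = id" by (simp add: sym_group_def)
    have finD: "finite ?D" using finite_G by simp
    have min: "?m \<le> card (moved h)" if "h \<in> H" "h \<noteq> id" for h
    proof -
      have "card (supp n h) \<in> ?D" using that unfolding one by blast
      from Min_le[OF finD this] show ?thesis unfolding min_degree_def supp[OF that(1)] .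
    qed
    obtain h where "h \<in> H" "h \<noteq> id" using H(2) id_mem unfolding one by blast
    then have "?m \<le> card (moved h)" "card (moved h) \<le> n"
      using min card_mono[OF _ moved_subset, of h] by auto
    then have mn: "?m \<le> n" by simp
    have m: "real ?m \<ge> 2 ^ 400 + real B + real n0" using b by (simp add: b_def)
    have big: "real ?m \<ge> 2 ^ 400" "?m > B" "?m \<ge> n0"
    proof -
      have "(0::real) < 2 ^ 400" by simp
      then show "real ?m \<ge> 2 ^ 400" "?m > B" "?m \<ge> n0" using m by linarith+
    qed
    have n400: "real n \<ge> 2 ^ 400" using big(1) mn by linarith
    have F: "elems_of_degree n H k = {h \<in> H. card (moved h) = k}"
      using supp by (auto simp: elems_of_degree_def)
    show ?thesis
    \<comment> \<open>If the class is nonempty, its degree is at least the minimal degree, which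
      both ranges require.\<close>
    proof (cases "elems_of_degree n H k = {}")
      case True
      show ?thesis unfolding True by simp
    next
      case False
      then obtain h where h: "h \<in> H" "card (moved h) = k" unfolding F by blast
      then have "h \<noteq> id" using k by (auto simp: moved_def)
      then have mk: "?m \<le> k" using min h by blast
      have cn: "card {1..n} = n" by simp
      show ?thesis
      proof (cases "real k \<le> real n powr (1/100)")
        case True
        have "(300::real) \<le> 2 ^ 400" by simp
        then have "?m \<ge> 300" using big(1) by linarith
        then show ?thesis unfolding F
          by (intro small_degree_count[OF perm_group_axioms cn _ _ mk n400 True k(2)] min)
      next
        case False
        have "card {h \<in> H. card (moved h) = k} \<le> real (card {1..n}) powr (- (1/3200) * real ?m)
            * real (card {1..n} choose k) powr (1/2) * fact k powr (1/4)"
        proof (rule Bn0[OF perm_group_axioms])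
          show "\<forall>h\<in>H. h \<noteq> id \<longrightarrow> B < card (moved h)" using min big(2) by (meson less_le_trans)
        qed (use False k mk big mn in auto)
        then show ?thesis unfolding F cn .
      qed
    qed
  qed
  moreover have "b > 0" unfolding b_def by (intro add_pos_nonneg) auto
  ultimately show ?thesis by (intro exI[of _ b] exI[of _ "1/3200 :: real"]) auto
qed

end
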